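(* Suppose that $(x_j)_{j\in\mathbb{Z}}$ is a (fixed) Riesz-basis sequence, and for $\lambda>0$ let $I_\lambda$ be the associated Gaussian interpolation operator. Then for every $f\in PW_\pi$ we have $f=\lim_{\lambda\to0^+} I_\lambda(f)$ in $L_2(\mathbb{R})$ and uniformly on $\mathbb{R}$.
   Context: For $g\in L_1(\mathbb{R})$, $\widehat g(x)=\int_{-\infty}^{\infty} g(t)e^{-ixt}\,dt$; $\mathcal{F}$ denotes the Fourier transform on $L_2(\mathbb{R})$, i.e. the bounded linear operator on $L_2(\mathbb{R})$ with $\mathcal{F}[g]=\widehat g$ for $g\in L_1(\mathbb{R})\cap L_2(\mathbb{R})$ (so $\|\mathcal{F}[g]\|_{L_2}^2=2\pi\|g\|_{L_2}^2$). $PW_\pi:=\{g\in L_2(\mathbb{R}):\mathcal{F}[g]=0 \text{ a.e. outside } [-\pi,\pi]\}$. Every $g\in PW_\pi$ is taken to be its continuous representative, so that $g(t)=\frac1{2\pi}\int_{-\pi}^{\pi}\mathcal{F}[g](x)e^{ixt}\,dx$ for every $t\in\mathbb{R}$. A real sequence $(x_j)_{j\in\mathbb{Z}}$ is a Riesz-basis sequence if $x_j<x_{j+1}$ for all $j\in\mathbb{Z}$ and the functions $e_j(t):=e^{-ix_jt}$, $j\in\mathbb{Z}$, form a Riesz basis for $L_2[-\pi,\pi]$; i.e. every $h\in L_2[-\pi,\pi]$ has a unique representation $h=\sum_j a_je_j$ with $\sum_j|a_j|^2<\infty$, and there is a constant $B$ such that $B^{-1}(\sum|c_j|^2)^{1/2}\le\|\sum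 c_je_j\|_{L_2[-\pi,\pi]}\le B(\sum|c_j|^2)^{1/2}$ for every square-summable $(c_j)$. Gaussian interpolation operator: for $\lambda>0$ and $f\in PW_\pi$, there is a unique square-summable sequence $(a_j)_{j\in\mathbb{Z}}$ (depending on $\lambda$, $f$ and $(x_j)$) such that the function $I_\lambda(f)(x):=\sum_{j\in\mathbb{Z}}a_je^{-\lambda(x-x_j)^2}$, $x\in\mathbb{R}$, is continuous and square integrable on $\mathbb{R}$ and satisfies $I_\lambda(f)(x_k)=f(x_k)$ for all $k\in\mathbb{Z}$. *)

theory Defs
  imports "HOL-Analysis.Analysis"
begin

text \<open>
  Elements of \<open>L\<^sub>2\<close> are represented by Borel functions. No quotient by a.e. equality is taken, so an
  element of \<open>L\<^sub>2\<close> is determined only up to null sets.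
\<close>

definition L2_space :: "'a measure \<Rightarrow> ('a \<Rightarrow> complex) set" where
  "L2_space M = {g \<in> borel_measurable M. integrable M (\<lambda>t. (cmod (g t))\<^sup>2)}"

definition L2_norm :: "'a measure \<Rightarrow> ('a \<Rightarrow> complex) \<Rightarrow> real" where
  "L2_norm M g = sqrt (\<integral>t. (cmod (g t))\<^sup>2 \<partial>M)"

text \<open>
  Since \<open>L2_norm\<close> is \<open>0\<close> on functions that are not square integrable, membership in
  \<open>L\<^sub>2\<close> is part of the notion of convergence.
\<close>

definition L2_tendsto ::
  "'a measure \<Rightarrow> ('i \<Rightarrow> 'a \<Rightarrow> complex) \<Rightarrow> ('a \<Rightarrow> complex) \<Rightarrow> 'i filter \<Rightarrow> bool" where
  "L2_tendsto M u g F \<longleftrightarrow>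
     g \<in> L2_space M \<and> (\<forall>\<^sub>F i in F. u i \<in> L2_space M) \<and>
     ((\<lambda>i. L2_norm M (\<lambda>t. u i t - g t)) \<longlongrightarrow> 0) F"

definition fourier :: "(real \<Rightarrow> complex) \<Rightarrow> real \<Rightarrow> complex" where
  "fourier g x = (\<integral>t. g t * exp (- \<i> * complex_of_real (x * t)) \<partial>lborel)"

text \<open>
  The graph of the Fourier transform on \<open>L\<^sub>2(\<real>)\<close>, as the extension by continuity of
  \<open>fourier\<close> from the dense subspace \<open>L\<^sub>1 \<inter> L\<^sub>2\<close>: \<open>G\<close> represents the Fourier transform of \<open>g\<close>.
\<close>

definition has_fourier_L2 :: "(real \<Rightarrow> complex) \<Rightarrow> (real \<Rightarrow> complex) \<Rightarrow> bool" where
  "has_fourier_L2 g G \<longleftrightarrow>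
     (\<exists>u :: nat \<Rightarrow> real \<Rightarrow> complex.
        (\<forall>n. integrable lborel (u n) \<and> u n \<in> L2_space lborel) \<and>
        L2_tendsto lborel u g sequentially \<and>
        L2_tendsto lborel (\<lambda>n. fourier (u n)) G sequentially)"

text \<open>Continuity selects the continuous representative of the a.e. class.\<close>

definition PW_pi :: "(real \<Rightarrow> complex) set" where
  "PW_pi = {g \<in> L2_space lborel. continuous_on UNIV g \<and>
     (\<exists>G. has_fourier_L2 g G \<and> (AE x in lborel. x \<notin> {-pi..pi} \<longrightarrow> G x = 0))}"

definition square_summable :: "(int \<Rightarrow> complex) \<Rightarrow> bool" where
  "square_summable a \<longleftrightarrow> (\<lambda>j. (cmod (a j))\<^sup>2) summable_on UNIV"

definition l2_norm :: "(int \<Rightarrow> complex) \<Rightarrow> real" where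
  "l2_norm a = sqrt (\<Sum>\<^sub>\<infinity>j. (cmod (a j))\<^sup>2)"

text \<open>Unconditional convergence of \<open>\<Sum>\<^sub>j a\<^sub>j e\<^sub>j\<close> to \<open>h\<close> in \<open>L\<^sub>2\<close>.\<close>

definition has_L2_sum ::
  "'a measure \<Rightarrow> (int \<Rightarrow> 'a \<Rightarrow> complex) \<Rightarrow> (int \<Rightarrow> complex) \<Rightarrow> ('a \<Rightarrow> complex) \<Rightarrow> bool" where
  "has_L2_sum M e a h \<longleftrightarrow>
     L2_tendsto M (\<lambda>J t. \<Sum>j\<in>J. a j * e j t) h (finite_subsets_at_top UNIV)"

definition riesz_basis :: "'a measure \<Rightarrow> (int \<Rightarrow> 'a \<Rightarrow> complex) \<Rightarrow> bool" where
  "riesz_basis M e \<longleftrightarrow>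
     (\<forall>h \<in> L2_space M. \<exists>!a. square_summable a \<and> has_L2_sum M e a h) \<and>
     (\<exists>B > 0. \<forall>c. square_summable c \<longrightarrow>
        (\<exists>h. has_L2_sum M e c h \<and>
             inverse B * l2_norm c \<le> L2_norm M h \<and> L2_norm M h \<le> B * l2_norm c))"

definition riesz_basis_sequence :: "(int \<Rightarrow> real) \<Rightarrow> bool" where
  "riesz_basis_sequence x \<longleftrightarrow>
     (\<forall>j. x j < x (j + 1)) \<and>
     riesz_basis (restrict_space lborel {-pi..pi})
       (\<lambda>j t. exp (- \<i> * complex_of_real (x j * t)))"

definition gaussian_series ::
  "(int \<Rightarrow> real) \<Rightarrow> real \<Rightarrow> (int \<Rightarrow> complex) \<Rightarrow> real \<Rightarrow> complex" where
  "gaussian_series x l a t = (\<Sum>\<^sub>\<infinity>j. a j * complex_of_real (exp (- l * (t - x j)\<^sup>2)))"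

text \<open>
  The summability condition excludes the default value \<open>0\<close> of a divergent \<open>infsum\<close>.
\<close>

definition is_gaussian_coeffs ::
  "(int \<Rightarrow> real) \<Rightarrow> real \<Rightarrow> (real \<Rightarrow> complex) \<Rightarrow> (int \<Rightarrow> complex) \<Rightarrow> bool" where
  "is_gaussian_coeffs x l f a \<longleftrightarrow>
     square_summable a \<and>
     (\<forall>t. (\<lambda>j. a j * complex_of_real (exp (- l * (t - x j)\<^sup>2))) summable_on UNIV) \<and>
     continuous_on UNIV (gaussian_series x l a) \<and>
     gaussian_series x l a \<in> L2_space lborel \<and>
     (\<forall>k. gaussian_series x l a (x k) = f (x k))"

definition gaussian_interpolant ::
  "(int \<Rightarrow> real) \<Rightarrow> real \<Rightarrow> (real \<Rightarrow> complex) \<Rightarrow> real \<Rightarrow> complex" where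
  "gaussian_interpolant x l f = gaussian_series x l (THE a. is_gaussian_coeffs x l f a)"

end

theory Submission
  imports Defs "HOL-Probability.Characteristic_Functions" "HOL-Real_Asymp.Real_Asymp"
begin

text \<open>
  Write \<open>f\<close> as the inverse Fourier transform of \<open>F\<close>, supported in \<open>[-\<pi>, \<pi>]\<close>. The Fourier transform of
  \<open>I\<^sub>\<lambda> f\<close> is, up to a constant, \<open>w \<psi>\<close> with \<open>w \<xi> = exp ((\<pi>\<^sup>2 - \<xi>\<^sup>2) / (4 \<lambda>))\<close> and
  \<open>\<psi> = \<Sum>\<^sub>j b\<^sub>j e\<^sub>j\<close>, and the interpolation conditions say that \<open>F - w \<psi>\<close> is orthogonal on the real
  line to all the \<open>e\<^sub>k\<close>. Pairing this with \<open>\<psi>\<close> itself gives the energy inequality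
  \<open>\<integral> w |\<psi>|\<^sup>2 \<le> \<integral> |F|\<^sup>2 / w\<close>, whose right-hand side \<open>\<delta>\<close> tends to \<open>0\<close> with \<open>\<lambda>\<close> because \<open>w \<rightarrow> \<infinity>\<close> on
  the open band. As \<open>w \<ge> 1\<close> on the band, the Riesz-basis inequality bounds \<open>\<parallel>b\<parallel>\<^sup>2\<close> by a multiple of
  \<open>\<delta>\<close>. Outside the band \<open>w\<close> lies below a fixed Gaussian, so \<open>w \<psi>\<close> is \<open>O(\<parallel>b\<parallel>)\<close> there; by
  orthogonality and the density of the \<open>e\<^sub>k\<close>, so is \<open>F - w \<psi>\<close> inside it. Plancherel's inequality
  and integrability of the fixed Gaussian turn this into convergence in \<open>L\<^sub>2\<close> and uniformly.

  The same form \<open>\<integral> w \<psi> \<phi>\<close> is bounded and coercive in the coefficients, which gives existence and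
  uniqueness of the interpolant. All of this is carried out for finite sections of \<open>b\<close>, so that
  \<open>\<psi>\<close> never has to be defined as an \<open>L\<^sub>2\<close> limit on the real line.
\<close>

section \<open>The space of square-integrable functions\<close>

text \<open>The obstacle is that the bounds on the interpolation matrix blow up as \<open>l\<close>
  tends to \<open>0\<close>: the weight reaches \<open>exp (pi\<^sup>2 / (4 * l))\<close> at the
  origin. Such bounds are used only at a fixed \<open>l\<close>, to solve the system and to let
  finite sections exhaust the coefficients. The error constants are built from \<open>B\<close>,
  \<open>Om\<close> and \<open>V\<close> alone, and none of these depends on \<open>l\<close>. This
  is possible because the weight is normalised to \<open>1\<close> at the band edge: it is at least
  \<open>1\<close> inside, where the lower Riesz inequality applies, and for
  \<open>l \<le> 1\<close> it lies below a fixed Gaussian outside. The energy inequality rests on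
  the support of \<open>F\<close>: paired with \<psi>, the equations give
  \<open>\<integral> w |\<psi>|^2 = \<integral> F cnj \<psi>\<close>. Since \<open>F\<close>
  vanishes off the band, the right-hand side can be weighted by \<open>1 / w\<close> on
  \<open>F\<close> and \<open>w\<close> on \<psi>, and the part containing \<psi> is absorbed on the
  left.\<close>

lemma L2_norm_nonneg [simp]: "0 \<le> L2_norm M g"
  by (simp add: L2_norm_def)

lemma L2_norm_power2: "(L2_norm M g)\<^sup>2 = (\<integral>t. (cmod (g t))\<^sup>2 \<partial>M)"
  by (simp add: L2_norm_def)

lemma L2_spaceI: "g \<in> borel_measurable M \<Longrightarrow> integrable M (\<lambda>t. (cmod (g t))\<^sup>2) \<Longrightarrow> g \<in> L2_space M"
  by (simp add: L2_space_def)

lemma L2_space_measurable [measurable_dest]: "g \<in> L2_space M \<Longrightarrow> g \<in> borel_measurable M"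
  by (simp add: L2_space_def)

lemma L2_space_integrable: "g \<in> L2_space M \<Longrightarrow> integrable M (\<lambda>t. (cmod (g t))\<^sup>2)"
  by (simp add: L2_space_def)

declare L2_space_measurable [simp] L2_space_integrable [simp]

lemma L2_space_mono:
  assumes "g \<in> L2_space M" "f \<in> borel_measurable M" "\<And>t. cmod (f t) \<le> C * cmod (g t)"
  shows "f \<in> L2_space M"
proof -
  have 1: "(cmod (f t))\<^sup>2 \<le> C\<^sup>2 * (cmod (g t))\<^sup>2" for t
    using power_mono[OF assms(3)[of t], of 2] by (simp add: power_mult_distrib)
  have "integrable M (\<lambda>t. (cmod (f t))\<^sup>2)"
  proof (rule Bochner_Integration.integrable_bound)
    show "integrable M (\<lambda>t. C\<^sup>2 * (cmod (g t))\<^sup>2)"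
      by (intro integrable_mult_right L2_space_integrable assms)
    show "AE t in M. norm ((cmod (f t))\<^sup>2) \<le> norm (C\<^sup>2 * (cmod (g t))\<^sup>2)"
      using 1 by simp
  qed (use assms(2) in measurable)
  then show ?thesis using assms(2) by (intro L2_spaceI)
qed
lemma L2_space_mult_integrable:
  assumes "f \<in> L2_space M" "g \<in> L2_space M"
  shows "integrable M (\<lambda>t. f t * g t)"
proof (rule Bochner_Integration.integrable_bound)
  show "integrable M (\<lambda>t. (cmod (f t))\<^sup>2 + (cmod (g t))\<^sup>2)"
    using assms by auto
  have "norm (f t * g t) \<le> norm ((cmod (f t))\<^sup>2 + (cmod (g t))\<^sup>2)" for t
  proof -
    have "0 \<le> cmod (f t) * cmod (g t)" by simp
    then have "cmod (f t) * cmod (g t) \<le> (cmod (f t))\<^sup>2 + (cmod (g t))\<^sup>2"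
      using sum_squares_bound[of "cmod (f t)" "cmod (g t)"] by linarith
    then show ?thesis by (simp add: norm_mult)
  qed
  then show "AE t in M. norm (f t * g t) \<le> norm ((cmod (f t))\<^sup>2 + (cmod (g t))\<^sup>2)"
    by blast
qed (use assms(1,2)[THEN L2_space_measurable] in measurable)

lemma L2_space_add:
  assumes "f \<in> L2_space M" "g \<in> L2_space M"
  shows "(\<lambda>t. f t + g t) \<in> L2_space M"
proof -
  have "integrable M (\<lambda>t. (cmod (f t + g t))\<^sup>2)"
  proof (rule Bochner_Integration.integrable_bound)
    show "integrable M (\<lambda>t. 2 * (cmod (f t))\<^sup>2 + 2 * (cmod (g t))\<^sup>2)"
      using assms by auto
    have "norm ((cmod (f t + g t))\<^sup>2) \<le> norm (2 * (cmod (f t))\<^sup>2 + 2 * (cmod (g t))\<^sup>2)" for t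
    proof -
      have "(cmod (f t + g t))\<^sup>2 \<le> (cmod (f t) + cmod (g t))\<^sup>2"
        by (intro power_mono norm_triangle_ineq) auto
      also have "\<dots> \<le> 2 * (cmod (f t))\<^sup>2 + 2 * (cmod (g t))\<^sup>2"
        using sum_squares_bound[of "cmod (f t)" "cmod (g t)"] by (simp add: power2_sum)
      finally show ?thesis by simp
    qed
    then show "AE t in M. norm ((cmod (f t + g t))\<^sup>2) \<le> norm (2 * (cmod (f t))\<^sup>2 + 2 * (cmod (g t))\<^sup>2)"
      by blast
  qed (use assms(1,2)[THEN L2_space_measurable] in measurable)
  then show ?thesis using assms(1,2)[THEN L2_space_measurable] by (intro L2_spaceI) auto
qed

lemma L2_space_cmult: "f \<in> L2_space M \<Longrightarrow> (\<lambda>t. c * f t) \<in> L2_space M"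
  using L2_space_mono[of f M "\<lambda>t. c * f t" "cmod c"] by (simp add: norm_mult)

lemma borel_measurable_cnj [measurable]:
  "f \<in> borel_measurable M \<Longrightarrow> (\<lambda>t. cnj (f t)) \<in> borel_measurable M"
  by (rule borel_measurable_continuous_on) (auto intro: continuous_intros)

lemma L2_space_cnj: "f \<in> L2_space M \<Longrightarrow> (\<lambda>t. cnj (f t)) \<in> L2_space M"
  using L2_space_mono[of f M "\<lambda>t. cnj (f t)" 1] by (simp add: borel_measurable_cnj)

lemma L2_space_diff:
  "f \<in> L2_space M \<Longrightarrow> g \<in> L2_space M \<Longrightarrow> (\<lambda>t. f t - g t) \<in> L2_space M"
  using L2_space_add[of f M "\<lambda>t. (-1) * g t"] L2_space_cmult[of g M "-1"] by simp

lemma L2_cauchy_schwarz_norm: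
  assumes "f \<in> L2_space M" "g \<in> L2_space M"
  shows "(\<integral>t. cmod (f t * g t) \<partial>M) \<le> L2_norm M f * L2_norm M g"
proof -
  note [measurable] = assms[THEN L2_space_measurable]
  have "(\<integral>\<^sup>+t. ennreal (cmod (f t)) * ennreal (cmod (g t)) \<partial>M)\<^sup>2
      \<le> (\<integral>\<^sup>+t. (ennreal (cmod (f t)))\<^sup>2 \<partial>M) * (\<integral>\<^sup>+t. (ennreal (cmod (g t)))\<^sup>2 \<partial>M)"
    by (rule Cauchy_Schwarz_nn_integral) auto
  moreover have "(\<integral>\<^sup>+t. ennreal (cmod (f t)) * ennreal (cmod (g t)) \<partial>M) = ennreal (\<integral>t. cmod (f t * g t) \<partial>M)"
    using L2_space_mult_integrable[OF assms]
    by (subst nn_integral_eq_integral[symmetric]) (auto simp flip: norm_mult ennreal_mult)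
  moreover have "(\<integral>\<^sup>+t. (ennreal (cmod (h t)))\<^sup>2 \<partial>M) = ennreal ((L2_norm M h)\<^sup>2)" if "h \<in> L2_space M" for h
    using that unfolding L2_norm_power2
    by (subst nn_integral_eq_integral[symmetric]) (auto simp: ennreal_power)
  ultimately have "(\<integral>t. cmod (f t * g t) \<partial>M)\<^sup>2 \<le> (L2_norm M f)\<^sup>2 * (L2_norm M g)\<^sup>2"
    using assms by (simp add: ennreal_power ennreal_mult[symmetric])
  then show ?thesis
    by (simp add: power_mult_distrib[symmetric] power2_le_iff_abs_le)
qed

lemma L2_cauchy_schwarz:
  assumes "f \<in> L2_space M" "g \<in> L2_space M"
  shows "cmod (\<integral>t. f t * g t \<partial>M) \<le> L2_norm M f * L2_norm M g"
  using integral_norm_bound[of M "\<lambda>t. f t * g t"] L2_cauchy_schwarz_norm[OF assms] by linarith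

lemma L2_norm_triangle:
  assumes "f \<in> L2_space M" "g \<in> L2_space M"
  shows "L2_norm M (\<lambda>t. f t + g t) \<le> L2_norm M f + L2_norm M g"
proof -
  note [measurable] = assms[THEN L2_space_measurable]
  have i: "integrable M (\<lambda>t. cmod (f t * g t))"
    using L2_space_mult_integrable[OF assms] by auto
  have "(L2_norm M (\<lambda>t. f t + g t))\<^sup>2
      \<le> (\<integral>t. (cmod (f t))\<^sup>2 + (cmod (g t))\<^sup>2 + 2 * cmod (f t * g t) \<partial>M)"
    unfolding L2_norm_power2
  proof (rule integral_mono)
    show "(cmod (f t + g t))\<^sup>2 \<le> (cmod (f t))\<^sup>2 + (cmod (g t))\<^sup>2 + 2 * cmod (f t * g t)" for t
      using power_mono[OF norm_triangle_ineq[of "f t" "g t"], of 2] by (simp add: power2_sum norm_mult)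
  qed (use assms i L2_space_add[OF assms] in auto)
  also have "\<dots> = (L2_norm M f)\<^sup>2 + (L2_norm M g)\<^sup>2 + 2 * (\<integral>t. cmod (f t * g t) \<partial>M)"
    using assms i by (simp add: L2_norm_power2)
  also have "\<dots> \<le> (L2_norm M f + L2_norm M g)\<^sup>2"
    using L2_cauchy_schwarz_norm[OF assms] by (simp add: power2_sum)
  finally show ?thesis
    by (simp add: power2_le_iff_abs_le)
qed

lemma L2_norm_cnj: "L2_norm M (\<lambda>t. cnj (f t)) = L2_norm M f"
  by (simp add: L2_norm_def)

lemma L2_norm_minus_commute: "L2_norm M (\<lambda>t. f t - g t) = L2_norm M (\<lambda>t. g t - f t)"
  by (simp add: L2_norm_def norm_minus_commute)

lemma L2_norm_triangle_sub:
  assumes "f \<in> L2_space M" "g \<in> L2_space M"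
  shows "L2_norm M f \<le> L2_norm M g + L2_norm M (\<lambda>t. f t - g t)"
  using L2_norm_triangle[OF assms(2) L2_space_diff[OF assms]] by simp

section \<open>Weak limits and testing against a dense family\<close>

lemma L2_tendsto_inner:
  assumes "L2_tendsto M u g F" "\<phi> \<in> L2_space M"
  shows "((\<lambda>i. \<integral>t. u i t * \<phi> t \<partial>M) \<longlongrightarrow> (\<integral>t. g t * \<phi> t \<partial>M)) F"
proof (rule LIM_zero_cancel, rule Lim_null_comparison)
  have g: "g \<in> L2_space M" and u: "\<forall>\<^sub>F i in F. u i \<in> L2_space M"
    and l: "((\<lambda>i. L2_norm M (\<lambda>t. u i t - g t)) \<longlongrightarrow> 0) F"
    using assms by (auto simp: L2_tendsto_def)
  show "\<forall>\<^sub>F i in F. norm ((\<integral>t. u i t * \<phi> t \<partial>M) - (\<integral>t. g t * \<phi> t \<partial>M)) \<le> L2_norm M (\<lambda>t. u i t - g t) * L2_norm M \<phi>"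
    using u
  proof eventually_elim
    case (elim i)
    have "(\<integral>t. u i t * \<phi> t \<partial>M) - (\<integral>t. g t * \<phi> t \<partial>M) = (\<integral>t. (u i t - g t) * \<phi> t \<partial>M)"
      using elim g assms(2) by (simp add: algebra_simps L2_space_mult_integrable)
    then show ?case
      using L2_cauchy_schwarz[OF L2_space_diff[OF elim g] assms(2)] by simp
  qed
  show "((\<lambda>i. L2_norm M (\<lambda>t. u i t - g t) * L2_norm M \<phi>) \<longlongrightarrow> 0) F"
    using tendsto_mult_right[OF l, of "L2_norm M \<phi>"] by simp
qed

text \<open>The squared norm of \<open>D\<close> is the pairing of \<open>D\<close> with
  \<open>D - u i\<close> plus its pairing with \<open>u i\<close>. The former vanishes in the limit
  and the latter is at most \<open>C\<close> times a norm tending to that of \<open>D\<close>. A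
  functional bound thus has to be known only on the approximants, later finite exponential
  sums.\<close>

lemma L2_norm_le_dense:
  assumes D: "D \<in> L2_space M"
    and u: "L2_tendsto M u D F" "F \<noteq> bot"
    and bound: "\<forall>\<^sub>F i in F. cmod (\<integral>t. D t * cnj (u i t) \<partial>M) \<le> C * L2_norm M (u i)"
    and C: "0 \<le> C"
  shows "L2_norm M D \<le> C"
proof -
  have 1: "((\<lambda>i. L2_norm M (\<lambda>t. u i t - D t)) \<longlongrightarrow> 0) F" and uL: "\<forall>\<^sub>F i in F. u i \<in> L2_space M"
    using u by (auto simp: L2_tendsto_def)
  have "(L2_norm M D)\<^sup>2 \<le> C * L2_norm M D"
  proof (rule tendsto_le[OF u(2) _ tendsto_const])
    show "((\<lambda>i. L2_norm M D * L2_norm M (\<lambda>t. u i t - D t) + C * (L2_norm M D + L2_norm M (\<lambda>t. u i t - D t)))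
      \<longlongrightarrow> C * L2_norm M D) F"
      by (rule tendsto_eq_intros 1 | simp)+
    show "\<forall>\<^sub>F i in F. (L2_norm M D)\<^sup>2 \<le>
      L2_norm M D * L2_norm M (\<lambda>t. u i t - D t) + C * (L2_norm M D + L2_norm M (\<lambda>t. u i t - D t))"
      using bound uL
    proof eventually_elim
      case (elim i)
      let ?e = "\<lambda>t. D t - u i t"
      have eL: "?e \<in> L2_space M" using D elim by (intro L2_space_diff)
      have "complex_of_real ((L2_norm M D)\<^sup>2) = (\<integral>t. D t * cnj (D t) \<partial>M)"
        unfolding L2_norm_power2 integral_complex_of_real[symmetric]
        by (intro Bochner_Integration.integral_cong refl) (rule complex_norm_square)
      also have "\<dots> = (\<integral>t. D t * cnj (?e t) + D t * cnj (u i t) \<partial>M)"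
        by (intro Bochner_Integration.integral_cong) (auto simp: algebra_simps)
      also have "\<dots> = (\<integral>t. D t * cnj (?e t) \<partial>M) + (\<integral>t. D t * cnj (u i t) \<partial>M)"
        by (intro Bochner_Integration.integral_add L2_space_mult_integrable L2_space_cnj D eL elim)
      finally have "cmod (complex_of_real ((L2_norm M D)\<^sup>2)) = cmod ((\<integral>t. D t * cnj (?e t) \<partial>M) + (\<integral>t. D t * cnj (u i t) \<partial>M))"
        by (rule arg_cong)
      then have "(L2_norm M D)\<^sup>2 = cmod ((\<integral>t. D t * cnj (?e t) \<partial>M) + (\<integral>t. D t * cnj (u i t) \<partial>M))"
        by (simp only: norm_of_real abs_power2)
      also have "\<dots> \<le> L2_norm M D * L2_norm M ?e + C * L2_norm M (u i)"
        using norm_triangle_ineq[of "\<integral>t. D t * cnj (?e t) \<partial>M" "\<integral>t. D t * cnj (u i t) \<partial>M"] elim(1)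
          L2_cauchy_schwarz[OF D L2_space_cnj[OF eL]] unfolding L2_norm_cnj by linarith
      also have "L2_norm M (u i) \<le> L2_norm M D + L2_norm M (\<lambda>t. u i t - D t)"
        by (rule L2_norm_triangle_sub) (use D elim in auto)
      finally show ?case
        using C by (simp add: L2_norm_minus_commute[of M D] mult_left_mono)
    qed
  qed
  then show ?thesis
    using C L2_norm_nonneg[of M D] by (cases "L2_norm M D = 0") (auto simp: power2_eq_square)
qed

section \<open>The Fourier transform of Gaussians and the Plancherel inequality\<close>

text \<open>The sign and the missing factor \<open>1 / (2 * pi)\<close> are those of an unnormalised
  inverse transform, so \<open>fourier g x = ft g (- x)\<close> and the constant is put into the
  spectrum \<open>F\<close> instead.\<close>

definition ft :: "(real \<Rightarrow> complex) \<Rightarrow> real \<Rightarrow> complex" where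
  "ft v t = (\<integral>\<xi>. v \<xi> * cis (t * \<xi>) \<partial>lborel)"

lemma borel_measurable_cis [measurable]:
  "f \<in> borel_measurable M \<Longrightarrow> (\<lambda>t. cis (f t)) \<in> borel_measurable M"
  by (rule borel_measurable_continuous_on) (auto intro: continuous_intros)

lemma integrable_mult_cis:
  assumes "integrable lborel v"
  shows "integrable lborel (\<lambda>\<xi>. v \<xi> * cis (t * \<xi>))"
  by (rule Bochner_Integration.integrable_bound[OF assms])
     (use assms in \<open>auto simp: norm_mult\<close>)

lemma ft_measurable [measurable]:
  assumes "integrable lborel v"
  shows "ft v \<in> borel_measurable borel"
proof -
  have [measurable]: "v \<in> borel_measurable borel" using assms by auto
  show ?thesis unfolding ft_def by measurable
qed

lemma norm_ft_le: "cmod (ft v t) \<le> (\<integral>\<xi>. cmod (v \<xi>) \<partial>lborel)"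
  using integral_norm_bound[of lborel "\<lambda>\<xi>. v \<xi> * cis (t * \<xi>)"]
  by (simp add: ft_def norm_mult)

lemma integrable_ft_mult:
  assumes u: "integrable lborel u" and v: "integrable lborel v"
  shows "integrable lborel (\<lambda>\<eta>. ft u \<eta> * v \<eta>)"
proof (rule Bochner_Integration.integrable_bound)
  have [measurable]: "v \<in> borel_measurable borel" using v by auto
  note [measurable] = ft_measurable[OF u]
  show "integrable lborel (\<lambda>\<eta>. (\<integral>\<xi>. cmod (u \<xi>) \<partial>lborel) * cmod (v \<eta>))"
    using v by auto
  show "AE \<eta> in lborel. norm (ft u \<eta> * v \<eta>) \<le> norm ((\<integral>\<xi>. cmod (u \<xi>) \<partial>lborel) * cmod (v \<eta>))"
    using norm_ft_le[of u] by (auto simp: norm_mult intro!: mult_right_mono)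
  show "(\<lambda>\<eta>. ft u \<eta> * v \<eta>) \<in> borel_measurable lborel" by measurable
qed

text \<open>Fubini for an absolutely integrable double integral. The parameter \<sigma> covers both
  signs of the exponent: \<open>1\<close> for \<open>ft\<close> and \<open>- 1\<close> for
  \<open>fourier\<close>.\<close>

lemma ft_multiplication:
  assumes u: "integrable lborel u" and v: "integrable lborel v"
  shows "(\<integral>t. u t * ft v (\<sigma> * t) \<partial>lborel) = (\<integral>\<eta>. ft u (\<sigma> * \<eta>) * v \<eta> \<partial>lborel)"
proof -
  have [measurable]: "u \<in> borel_measurable borel" "v \<in> borel_measurable borel"
    using assms by auto
  let ?f = "\<lambda>t \<eta>. u t * v \<eta> * cis (\<sigma> * t * \<eta>)"
  have "integrable (lborel \<Otimes>\<^sub>M lborel) (\<lambda>(t, \<eta>). ?f t \<eta>)"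
  proof (rule lborel_pair.Fubini_integrable)
    show "integrable lborel (\<lambda>t. \<integral>\<eta>. norm (case (t, \<eta>) of (t, \<eta>) \<Rightarrow> ?f t \<eta>) \<partial>lborel)"
      using u by (simp add: norm_mult)
    show "AE t in lborel. integrable lborel (\<lambda>\<eta>. case (t, \<eta>) of (t, \<eta>) \<Rightarrow> ?f t \<eta>)"
      using integrable_mult_cis[OF v, of "\<sigma> * _"] by (auto simp: mult.assoc intro!: AE_I2 integrable_mult_right)
  qed simp
  from lborel_pair.Fubini_integral[OF this]
  have "(\<integral>t. (\<integral>\<eta>. ?f t \<eta> \<partial>lborel) \<partial>lborel) = (\<integral>\<eta>. (\<integral>t. ?f t \<eta> \<partial>lborel) \<partial>lborel)"
    by simp
  moreover have "(\<integral>\<eta>. ?f t \<eta> \<partial>lborel) = u t * ft v (\<sigma> * t)" for t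
    by (simp add: ft_def mult.assoc)
  moreover have "(\<integral>t. ?f t \<eta> \<partial>lborel) = ft u (\<sigma> * \<eta>) * v \<eta>" for \<eta>
    unfolding ft_def integral_mult_left_zero[symmetric]
    by (intro Bochner_Integration.integral_cong) (auto simp: ac_simps)
  ultimately show ?thesis by simp
qed

text \<open>A rescaling of the characteristic function of the standard normal distribution;
  \<open>c = sqrt (2 * s)\<close> turns its exponent into \<open>- s * x\<^sup>2\<close>.\<close>

lemma gaussian_ft:
  assumes "s > 0"
  shows "ft (\<lambda>\<xi>. of_real (exp (- s * \<xi>\<^sup>2))) t = of_real (sqrt (pi / s) * exp (- t\<^sup>2 / (4 * s)))"
proof -
  define c where "c = sqrt (2 * s)"
  have c: "c > 0" "c\<^sup>2 = 2 * s" using assms by (auto simp: c_def)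
  have "of_real (exp (- ((t / c)\<^sup>2) / 2)) = char std_normal_distribution (t / c)"
    by (simp add: char_std_normal_distribution)
  also have "\<dots> = (\<integral>x. std_normal_density x *\<^sub>R iexp (t / c * x) \<partial>lborel)"
    by (simp add: char_def integral_density)
  also have "\<dots> = c *\<^sub>R (\<integral>x. std_normal_density (0 + c * x) *\<^sub>R iexp (t / c * (0 + c * x)) \<partial>lborel)"
    using c by (subst lborel_integral_real_affine[where c = c and t = 0]) auto
  also have "(\<integral>x. std_normal_density (0 + c * x) *\<^sub>R iexp (t / c * (0 + c * x)) \<partial>lborel)
     = (\<integral>x. (1 / sqrt (2 * pi)) *\<^sub>R (of_real (exp (- s * x\<^sup>2)) * cis (t * x)) \<partial>lborel)"
    using c by (intro Bochner_Integration.integral_cong)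
      (auto simp: std_normal_density_def cis_conv_exp power_mult_distrib scaleR_conv_of_real)
  also have "\<dots> = (1 / sqrt (2 * pi)) *\<^sub>R ft (\<lambda>\<xi>. of_real (exp (- s * \<xi>\<^sup>2))) t"
    by (simp add: ft_def)
  finally have "of_real (exp (- ((t / c)\<^sup>2) / 2)) = (c / sqrt (2 * pi)) *\<^sub>R ft (\<lambda>\<xi>. of_real (exp (- s * \<xi>\<^sup>2))) t"
    by simp
  then have "(sqrt (2 * pi) / c) *\<^sub>R complex_of_real (exp (- ((t / c)\<^sup>2) / 2)) = ft (\<lambda>\<xi>. of_real (exp (- s * \<xi>\<^sup>2))) t"
    using c by simp
  moreover have "sqrt (2 * pi) / c = sqrt (pi / s)"
    by (simp add: c_def real_sqrt_divide real_sqrt_mult)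
  moreover have "- ((t / c)\<^sup>2) / 2 = - t\<^sup>2 / (4 * s)"
    using c by (simp add: power_divide)
  ultimately show ?thesis by (simp add: scaleR_conv_of_real)
qed

lemma gaussian_integrable:
  assumes "s > 0"
  shows "integrable lborel (\<lambda>\<xi>::real. exp (- s * (\<xi> - a)\<^sup>2))"
proof -
  have "integrable lborel (\<lambda>\<xi>. sqrt (pi / s) * normal_density a (1 / sqrt (2 * s)) \<xi>)"
    using assms by (intro integrable_mult_right integrable_normal_density) auto
  also have "(\<lambda>\<xi>. sqrt (pi / s) * normal_density a (1 / sqrt (2 * s)) \<xi>) = (\<lambda>\<xi>. exp (- s * (\<xi> - a)\<^sup>2))"
    using assms by (auto simp: normal_density_def power_divide real_sqrt_divide field_simps intro!: ext)
  finally show ?thesis .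
qed

lemma gaussian_integral:
  assumes "s > 0"
  shows "(\<integral>\<xi>. exp (- s * (\<xi> - a)\<^sup>2) \<partial>lborel) = sqrt (pi / s)"
proof -
  have "(\<integral>\<xi>. exp (- s * (\<xi> - a)\<^sup>2) \<partial>lborel) = (\<integral>\<xi>. sqrt (pi / s) * normal_density a (1 / sqrt (2 * s)) \<xi> \<partial>lborel)"
    using assms by (intro Bochner_Integration.integral_cong)
      (auto simp: normal_density_def power_divide real_sqrt_divide field_simps)
  then show ?thesis using assms by (simp add: integral_normal_density)
qed

text \<open>Fatou's lemma with a bound that may vary along the sequence. It removes the Gaussian
  damping in Plancherel's inequality, and it carries norm bounds from finite sections to their
  pointwise limit, whose integrability need not be known beforehand.\<close>

lemma nn_integral_le_limit:
  fixes u :: "nat \<Rightarrow> 'a \<Rightarrow> ennreal"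
  assumes "\<And>n. u n \<in> borel_measurable M" "\<And>t. (\<lambda>n. u n t) \<longlonglongrightarrow> g t"
    and "\<And>n. (\<integral>\<^sup>+t. u n t \<partial>M) \<le> C n" "C \<longlonglongrightarrow> L"
  shows "(\<integral>\<^sup>+t. g t \<partial>M) \<le> L"
proof -
  have "(\<integral>\<^sup>+t. g t \<partial>M) = (\<integral>\<^sup>+t. liminf (\<lambda>n. u n t) \<partial>M)"
    by (intro nn_integral_cong lim_imp_Liminf[OF sequentially_bot, symmetric] assms)
  also have "\<dots> \<le> liminf (\<lambda>n. \<integral>\<^sup>+t. u n t \<partial>M)"
    by (rule nn_integral_liminf) (rule assms)
  also have "\<dots> \<le> liminf C"
    by (intro Liminf_mono always_eventually allI assms)
  also have "\<dots> = L"
    by (intro lim_imp_Liminf[OF sequentially_bot] assms)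
  finally show ?thesis .
qed

text \<open>A priori \<open>ft H\<close> is merely bounded, so its square is damped by a Gaussian.
  Fubini turns the damped integral into a double integral of \<open>cnj (H \<eta>) * H \<xi>\<close>
  against a Gaussian kernel in \<open>\<xi> - \<eta>\<close>; a Schur estimate bounds it
  independently of the damping, and Fatou removes the damping.\<close>

lemma plancherel_le:
  assumes "integrable lborel H" "H \<in> L2_space lborel"
  shows "(\<integral>\<^sup>+t. ennreal ((cmod (ft H t))\<^sup>2) \<partial>lborel) \<le> ennreal (2 * pi * (\<integral>\<xi>. (cmod (H \<xi>))\<^sup>2 \<partial>lborel))"
proof -
  let ?E = "\<integral>\<xi>. (cmod (H \<xi>))\<^sup>2 \<partial>lborel"
  let ?B = "\<integral>\<xi>. cmod (H \<xi>) \<partial>lborel"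
  have H[measurable]: "H \<in> borel_measurable borel" using assms by auto
  have ftm[measurable]: "ft H \<in> borel_measurable borel" using assms by auto
  have reg: "(\<integral>\<^sup>+t. ennreal ((cmod (ft H t))\<^sup>2 * exp (- s * t\<^sup>2)) \<partial>lborel) \<le> ennreal (2 * pi * ?E)" if s: "s > 0" for s
  proof -
    let ?g = "\<lambda>t. complex_of_real (exp (- s * t\<^sup>2))"
    \<comment> \<open>The transform of the damping factor. Its total mass is \<open>2 * pi\<close>
      for every \<open>s\<close>, which makes the resulting bound independent of
      \<open>s\<close>.\<close>
    define \<gamma> where "\<gamma> u = sqrt (pi / s) * exp (- u\<^sup>2 / (4 * s))" for u :: real
    have \<gamma>[measurable]: "\<gamma> \<in> borel_measurable borel" and \<gamma>0: "\<gamma> u \<ge> 0" and \<gamma>_sym: "\<gamma> (u - w) = \<gamma> (w - u)" for u w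
      using s by (auto simp: \<gamma>_def[abs_def] power2_commute)
    have g: "integrable lborel ?g"
      using gaussian_integrable[OF s, of 0] by (simp add: complex_of_real_integrable_eq)
    have bd: "integrable lborel (\<lambda>t. ?g t * \<psi> t)" if [measurable]: "\<psi> \<in> borel_measurable borel" and "\<And>t. cmod (\<psi> t) \<le> C" for \<psi> C
    proof (rule Bochner_Integration.integrable_bound)
      show "integrable lborel (\<lambda>t. C * exp (- s * (t - 0)\<^sup>2))"
        by (intro integrable_mult_right gaussian_integrable s)
      show "AE t in lborel. norm (?g t * \<psi> t) \<le> norm (C * exp (- s * (t - 0)\<^sup>2))"
        using that(2) order_trans[OF norm_ge_zero that(2)] by (auto simp: norm_mult mult.commute intro!: mult_right_mono)
    qed measurable
    have hc: "integrable lborel (\<lambda>\<eta>. cnj (H \<eta>))" using assms by auto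
    have cnj_ft: "cnj (ft H t) = ft (\<lambda>\<eta>. cnj (H \<eta>)) (- 1 * t)" for t
      by (simp add: ft_def cis_cnj flip: Bochner_Integration.integral_cnj)
    let ?u = "\<lambda>t. ?g t * cnj (ft H t)"
    have u: "integrable lborel ?u" by (rule bd[where C = ?B]) (auto simp: norm_ft_le)
    have ftu: "ft ?u \<xi> = (\<integral>\<eta>. of_real (\<gamma> (\<xi> - \<eta>)) * cnj (H \<eta>) \<partial>lborel)" for \<xi>
    proof -
      let ?w = "\<lambda>t. ?g t * cis (\<xi> * t)"
      have w: "integrable lborel ?w" by (rule bd[where C = 1]) auto
      have ftw: "ft ?w (- 1 * \<eta>) = of_real (\<gamma> (\<xi> - \<eta>))" for \<eta>
        using gaussian_ft[OF s, of "\<xi> - \<eta>"]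
        by (simp add: ft_def \<gamma>_def mult.assoc cis_mult left_diff_distrib)
      have "ft ?u \<xi> = (\<integral>t. ?w t * ft (\<lambda>\<eta>. cnj (H \<eta>)) (- 1 * t) \<partial>lborel)"
        by (subst ft_def, intro Bochner_Integration.integral_cong refl) (simp add: cnj_ft ac_simps)
      also have "\<dots> = (\<integral>\<eta>. ft ?w (- 1 * \<eta>) * cnj (H \<eta>) \<partial>lborel)"
        by (rule ft_multiplication[OF w hc])
      finally show ?thesis unfolding ftw .
    qed
    have total: "(\<integral>\<^sup>+\<eta>. ennreal (\<gamma> (\<eta> - \<xi>)) \<partial>lborel) = ennreal (2 * pi)" for \<xi>
    proof -
      have e: "\<gamma> (\<eta> - \<xi>) = sqrt (pi / s) * exp (- (1 / (4 * s)) * (\<eta> - \<xi>)\<^sup>2)" for \<eta>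
        by (simp add: \<gamma>_def)
      have "sqrt (pi / s) * sqrt (pi / (1 / (4 * s))) = 2 * pi"
        using s by (simp add: real_sqrt_mult[symmetric] power2_eq_square[symmetric] real_sqrt_mult real_sqrt_divide)
      then show ?thesis unfolding e
        using s gaussian_integral[of "1 / (4 * s)" \<xi>] gaussian_integrable[of "1 / (4 * s)" \<xi>]
        by (subst nn_integral_eq_integral) auto
    qed
    have N2: "(\<integral>\<^sup>+\<xi>. ennreal ((cmod (H \<xi>))\<^sup>2) \<partial>lborel) = ennreal ?E"
      using assms by (intro nn_integral_eq_integral) auto
    have half: "ennreal (1/2) + ennreal (1/2) = 1"
      by (subst ennreal_plus[symmetric]) auto
    have "(\<integral>\<^sup>+t. ennreal ((cmod (ft H t))\<^sup>2 * exp (- s * t\<^sup>2)) \<partial>lborel) = ennreal (\<integral>t. (cmod (ft H t))\<^sup>2 * exp (- s * t\<^sup>2) \<partial>lborel)"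
    proof (rule nn_integral_eq_integral)
      have "integrable lborel (\<lambda>t. ?g t * of_real ((cmod (ft H t))\<^sup>2))"
        by (rule bd[where C = "?B\<^sup>2"]) (auto simp: norm_power intro!: power_mono norm_ft_le)
      then have "integrable lborel (\<lambda>t. complex_of_real ((cmod (ft H t))\<^sup>2 * exp (- s * t\<^sup>2)))"
        by (simp add: mult.commute)
      then show "integrable lborel (\<lambda>t. (cmod (ft H t))\<^sup>2 * exp (- s * t\<^sup>2))"
        unfolding complex_of_real_integrable_eq .
    qed auto
    also have "(\<integral>t. (cmod (ft H t))\<^sup>2 * exp (- s * t\<^sup>2) \<partial>lborel) = cmod (\<integral>t. ?u t * ft H (1 * t) \<partial>lborel)"
    proof -
      have "(\<integral>t. ?u t * ft H (1 * t) \<partial>lborel) = (\<integral>t. complex_of_real ((cmod (ft H t))\<^sup>2 * exp (- s * t\<^sup>2)) \<partial>lborel)"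
        by (intro Bochner_Integration.integral_cong refl) (simp add: complex_norm_square mult.commute mult.left_commute del: of_real_power)
      then show ?thesis by (simp only: integral_complex_of_real norm_of_real) (simp add: integral_nonneg_AE)
    qed
    also have "\<dots> = cmod (\<integral>\<xi>. ft ?u (1 * \<xi>) * H \<xi> \<partial>lborel)"
      by (subst ft_multiplication[OF u assms(1)]) (rule refl)
    also have "ennreal \<dots> \<le> (\<integral>\<^sup>+\<xi>. ennreal (cmod (ft ?u (1 * \<xi>) * H \<xi>)) \<partial>lborel)"
      by (rule integral_norm_bound_ennreal) (use integrable_ft_mult[OF u assms(1)] in \<open>simp only: mult_1\<close>)
    also have "\<dots> \<le> (\<integral>\<^sup>+\<xi>. (\<integral>\<^sup>+\<eta>. ennreal (\<gamma> (\<xi> - \<eta>) * cmod (H \<eta>)) \<partial>lborel) * ennreal (cmod (H \<xi>)) \<partial>lborel)"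
    proof (intro nn_integral_mono)
      fix \<xi>
      have "ennreal (cmod (ft ?u \<xi>)) \<le> (\<integral>\<^sup>+\<eta>. ennreal (cmod (of_real (\<gamma> (\<xi> - \<eta>)) * cnj (H \<eta>))) \<partial>lborel)"
        unfolding ftu
      proof (rule integral_norm_bound_ennreal, rule Bochner_Integration.integrable_bound)
        show "integrable lborel (\<lambda>\<eta>. sqrt (pi / s) * cmod (H \<eta>))" using assms by auto
        have "\<gamma> u \<le> sqrt (pi / s)" for u
          using s mult_left_mono[of "exp (- u\<^sup>2 / (4 * s))" 1 "sqrt (pi / s)"] by (simp add: \<gamma>_def)
        then show "AE \<eta> in lborel. norm (of_real (\<gamma> (\<xi> - \<eta>)) * cnj (H \<eta>)) \<le> norm (sqrt (pi / s) * cmod (H \<eta>))"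
          using \<gamma>0 s by (auto simp: norm_mult intro!: mult_right_mono)
      qed measurable
      then show "ennreal (cmod (ft ?u (1 * \<xi>) * H \<xi>)) \<le> (\<integral>\<^sup>+\<eta>. ennreal (\<gamma> (\<xi> - \<eta>) * cmod (H \<eta>)) \<partial>lborel) * ennreal (cmod (H \<xi>))"
        using \<gamma>0 by (simp add: norm_mult ennreal_mult' mult_right_mono)
    qed
    \<comment> \<open>Schur's test: the product of the two moduli is at most half the sum of their
      squares. The two halves have equal integrals because \<open>\<gamma>\<close> is even and the
      order of integration may be exchanged.\<close>
    also have "\<dots> \<le> (\<integral>\<^sup>+\<xi>. (\<integral>\<^sup>+\<eta>. ennreal (1/2) * (ennreal (\<gamma> (\<xi> - \<eta>)) * ennreal ((cmod (H \<eta>))\<^sup>2))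
        + ennreal (1/2) * (ennreal (\<gamma> (\<eta> - \<xi>)) * ennreal ((cmod (H \<xi>))\<^sup>2)) \<partial>lborel) \<partial>lborel)"
    proof (intro nn_integral_mono)
      fix \<xi>
      have "(\<integral>\<^sup>+\<eta>. ennreal (\<gamma> (\<xi> - \<eta>) * cmod (H \<eta>)) \<partial>lborel) * ennreal (cmod (H \<xi>))
        = (\<integral>\<^sup>+\<eta>. ennreal (\<gamma> (\<xi> - \<eta>) * cmod (H \<eta>)) * ennreal (cmod (H \<xi>)) \<partial>lborel)"
        by (simp add: nn_integral_multc)
      also have "\<dots> \<le> (\<integral>\<^sup>+\<eta>. ennreal (1/2) * (ennreal (\<gamma> (\<xi> - \<eta>)) * ennreal ((cmod (H \<eta>))\<^sup>2))
        + ennreal (1/2) * (ennreal (\<gamma> (\<eta> - \<xi>)) * ennreal ((cmod (H \<xi>))\<^sup>2)) \<partial>lborel)"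
      proof (intro nn_integral_mono)
        fix \<eta>
        have "\<gamma> (\<xi> - \<eta>) * (2 * cmod (H \<eta>) * cmod (H \<xi>)) \<le> \<gamma> (\<xi> - \<eta>) * ((cmod (H \<eta>))\<^sup>2 + (cmod (H \<xi>))\<^sup>2)"
          by (intro mult_left_mono sum_squares_bound \<gamma>0)
        then have "\<gamma> (\<xi> - \<eta>) * cmod (H \<eta>) * cmod (H \<xi>) \<le> 1/2 * (\<gamma> (\<xi> - \<eta>) * (cmod (H \<eta>))\<^sup>2) + 1/2 * (\<gamma> (\<eta> - \<xi>) * (cmod (H \<xi>))\<^sup>2)"
          unfolding \<gamma>_sym[of \<eta> \<xi>] by (simp add: algebra_simps)
        from ennreal_leI[OF this] show "ennreal (\<gamma> (\<xi> - \<eta>) * cmod (H \<eta>)) * ennreal (cmod (H \<xi>)) \<le> ennreal (1/2) * (ennreal (\<gamma> (\<xi> - \<eta>)) * ennreal ((cmod (H \<eta>))\<^sup>2))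
          + ennreal (1/2) * (ennreal (\<gamma> (\<eta> - \<xi>)) * ennreal ((cmod (H \<xi>))\<^sup>2))"
          by (simp only: ennreal_plus ennreal_mult \<gamma>0 mult_nonneg_nonneg norm_ge_zero zero_le_power
              zero_le_divide_1_iff zero_le_numeral)
      qed
      finally show "(\<integral>\<^sup>+\<eta>. ennreal (\<gamma> (\<xi> - \<eta>) * cmod (H \<eta>)) \<partial>lborel) * ennreal (cmod (H \<xi>)) \<le> \<dots>" .
    qed
    also have "\<dots> = ennreal (1/2) * (\<integral>\<^sup>+\<xi>. (\<integral>\<^sup>+\<eta>. ennreal (\<gamma> (\<xi> - \<eta>)) * ennreal ((cmod (H \<eta>))\<^sup>2) \<partial>lborel) \<partial>lborel)
       + ennreal (1/2) * (\<integral>\<^sup>+\<xi>. (\<integral>\<^sup>+\<eta>. ennreal (\<gamma> (\<eta> - \<xi>)) * ennreal ((cmod (H \<xi>))\<^sup>2) \<partial>lborel) \<partial>lborel)"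
      by (simp add: nn_integral_add nn_integral_cmult)
    also have "(\<integral>\<^sup>+\<xi>. (\<integral>\<^sup>+\<eta>. ennreal (\<gamma> (\<xi> - \<eta>)) * ennreal ((cmod (H \<eta>))\<^sup>2) \<partial>lborel) \<partial>lborel)
      = (\<integral>\<^sup>+\<xi>. (\<integral>\<^sup>+\<eta>. ennreal (\<gamma> (\<eta> - \<xi>)) * ennreal ((cmod (H \<xi>))\<^sup>2) \<partial>lborel) \<partial>lborel)"
      by (rule lborel_pair.Fubini'[symmetric]) simp
    also have "(\<integral>\<^sup>+\<xi>. (\<integral>\<^sup>+\<eta>. ennreal (\<gamma> (\<eta> - \<xi>)) * ennreal ((cmod (H \<xi>))\<^sup>2) \<partial>lborel) \<partial>lborel) = ennreal (2 * pi * ?E)"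
      by (simp add: nn_integral_multc total nn_integral_cmult N2 ennreal_mult)
    finally show ?thesis unfolding distrib_right[symmetric] half mult_1 .
  qed
  show ?thesis
  proof (rule nn_integral_le_limit)
    show "(\<lambda>n. ennreal ((cmod (ft H t))\<^sup>2 * exp (- (1 / real (Suc n)) * t\<^sup>2))) \<longlonglongrightarrow> ennreal ((cmod (ft H t))\<^sup>2)" for t
    proof -
      have "(\<lambda>n. (cmod (ft H t))\<^sup>2 * exp (- (1 / real (Suc n)) * t\<^sup>2)) \<longlonglongrightarrow> (cmod (ft H t))\<^sup>2 * exp (- 0 * t\<^sup>2)"
        by (intro tendsto_intros LIMSEQ_Suc[OF lim_1_over_n])
      then show ?thesis by (intro tendsto_ennrealI) simp
    qed
    show "(\<integral>\<^sup>+t. ennreal ((cmod (ft H t))\<^sup>2 * exp (- (1 / real (Suc n)) * t\<^sup>2)) \<partial>lborel) \<le> ennreal (2 * pi * ?E)" for n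
      by (rule reg) simp
  qed auto
qed

section \<open>Inversion for band-limited functions\<close>

text \<open>The kernel has mass \<open>2 * pi\<close> and concentrates at \<open>s\<close>. Since
  \<open>f\<close> is not assumed bounded, it is cut at distance \<open>1\<close> from
  \<open>s\<close>: the near part is bounded by compactness, and the far part is controlled by
  square integrability and the decay of the kernel.\<close>

lemma gaussian_approximate_identity:
  fixes f :: "real \<Rightarrow> complex"
  assumes cont: "continuous_on UNIV f" and L2: "f \<in> L2_space lborel"
  shows "(\<lambda>n. \<integral>t. f t * of_real (sqrt (pi * real (Suc n)) * exp (- (real (Suc n) / 4) * (t - s)\<^sup>2)) \<partial>lborel)
    \<longlonglongrightarrow> of_real (2 * pi) * f s"
proof -
  have fm[measurable]: "f \<in> borel_measurable borel"
    using cont by (rule borel_measurable_continuous_onI)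
  let ?N = "\<lambda>n. real (Suc n)"
  define k where "k n t = sqrt (pi * ?N n) * exp (- (?N n / 4) * (t - s)\<^sup>2)" for n t
  have km[measurable]: "k n \<in> borel_measurable borel" for n by (simp add: k_def[abs_def])
  define f1 where "f1 t = (if \<bar>t - s\<bar> \<le> 1 then f t else 0)" for t
  define f2 where "f2 t = (if \<bar>t - s\<bar> \<le> 1 then 0 else f t)" for t
  have [measurable]: "f1 \<in> borel_measurable borel" "f2 \<in> borel_measurable borel"
    unfolding f1_def[abs_def] f2_def[abs_def] by measurable
  have "compact (f ` {s - 1..s + 1})"
    by (rule compact_continuous_image[OF continuous_on_subset[OF cont]]) auto
  then obtain M where M: "\<And>t. t \<in> {s - 1..s + 1} \<Longrightarrow> cmod (f t) \<le> M"
    by (meson compact_imp_bounded bounded_iff imageI)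
  have M0: "M \<ge> 0" using order_trans[OF norm_ge_zero M[of s]] by simp
  have f1M: "cmod (f1 t) \<le> M" for t
  proof (cases "\<bar>t - s\<bar> \<le> 1")
    case True
    then have "t \<in> {s - 1..s + 1}" by auto
    then show ?thesis using M by (simp add: f1_def M0)
  qed (simp add: f1_def M0)
  have kint: "integrable lborel (\<lambda>t. k n t)" for n
    unfolding k_def by (intro integrable_mult_right gaussian_integrable) simp
  have near: "(\<lambda>n. \<integral>t. f1 t * of_real (k n t) \<partial>lborel) \<longlonglongrightarrow> of_real (2 * pi) * f s"
  proof -
    \<comment> \<open>Rescaling around \<open>s\<close> freezes the Gaussian and moves
      \<open>n\<close> into the argument of \<open>f1\<close>, so that continuity at
      \<open>s\<close> gives the pointwise limit under a fixed majorant.\<close>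
    have eq: "(\<integral>t. f1 t * of_real (k n t) \<partial>lborel)
        = (\<integral>z. f1 (s + 1 / sqrt (?N n) * z) * of_real (sqrt pi * exp (- (1/4) * (z - 0)\<^sup>2)) \<partial>lborel)" for n
    proof -
      have "(\<integral>t. f1 t * of_real (k n t) \<partial>lborel)
        = (1 / sqrt (?N n)) *\<^sub>R (\<integral>z. f1 (s + 1 / sqrt (?N n) * z) * of_real (k n (s + 1 / sqrt (?N n) * z)) \<partial>lborel)"
        by (subst lborel_integral_real_affine[where c = "1 / sqrt (?N n)" and t = s]) auto
      also have "\<dots> = (\<integral>z. (1 / sqrt (?N n)) *\<^sub>R (f1 (s + 1 / sqrt (?N n) * z) * of_real (k n (s + 1 / sqrt (?N n) * z))) \<partial>lborel)"
        by simp
      also have "\<dots> = (\<integral>z. f1 (s + 1 / sqrt (?N n) * z) * of_real (sqrt pi * exp (- (1/4) * (z - 0)\<^sup>2)) \<partial>lborel)"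
      proof (intro Bochner_Integration.integral_cong refl)
        fix z :: real
        have "k n (s + 1 / sqrt (?N n) * z) = sqrt (?N n) * (sqrt pi * exp (- (1/4) * (z - 0)\<^sup>2))"
          unfolding k_def by (simp add: power_mult_distrib power_divide real_sqrt_mult del: of_nat_Suc)
        then show "(1 / sqrt (?N n)) *\<^sub>R (f1 (s + 1 / sqrt (?N n) * z) * of_real (k n (s + 1 / sqrt (?N n) * z)))
          = f1 (s + 1 / sqrt (?N n) * z) * of_real (sqrt pi * exp (- (1/4) * (z - 0)\<^sup>2))"
          by (simp add: scaleR_conv_of_real del: of_nat_Suc)
      qed
      finally show ?thesis .
    qed
    have "(\<lambda>n. \<integral>z. f1 (s + 1 / sqrt (?N n) * z) * of_real (sqrt pi * exp (- (1/4) * (z - 0)\<^sup>2)) \<partial>lborel)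
      \<longlonglongrightarrow> (\<integral>z. f s * of_real (sqrt pi * exp (- (1/4) * (z - 0)\<^sup>2)) \<partial>lborel)"
    proof (rule integral_dominated_convergence[where w = "\<lambda>z. M * (sqrt pi * exp (- (1/4) * (z - 0)\<^sup>2))"])
      show "integrable lborel (\<lambda>z. M * (sqrt pi * exp (- (1/4) * (z - 0)\<^sup>2)))"
        by (intro integrable_mult_right gaussian_integrable) simp
      show "AE z in lborel. (\<lambda>n. f1 (s + 1 / sqrt (?N n) * z) * of_real (sqrt pi * exp (- (1/4) * (z - 0)\<^sup>2)))
          \<longlonglongrightarrow> f s * of_real (sqrt pi * exp (- (1/4) * (z - 0)\<^sup>2))"
      proof (intro AE_I2 tendsto_mult_right)
        fix z :: real
        have l: "(\<lambda>n. s + 1 / sqrt (?N n) * z) \<longlonglongrightarrow> s"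
          by real_asymp
        have "(\<lambda>n. f (s + 1 / sqrt (?N n) * z)) \<longlonglongrightarrow> f s"
          by (rule continuous_on_tendsto_compose[OF cont l]) auto
        moreover have "\<forall>\<^sub>F n in sequentially. f (s + 1 / sqrt (?N n) * z) = f1 (s + 1 / sqrt (?N n) * z)"
          using tendstoD[OF l, of 1] by (auto elim!: eventually_mono simp: f1_def dist_real_def)
        ultimately show "(\<lambda>n. f1 (s + 1 / sqrt (?N n) * z)) \<longlonglongrightarrow> f s"
          by (rule Lim_transform_eventually)
      qed
      show "AE z in lborel. norm (f1 (s + 1 / sqrt (?N n) * z) * of_real (sqrt pi * exp (- (1/4) * (z - 0)\<^sup>2)))
          \<le> M * (sqrt pi * exp (- (1/4) * (z - 0)\<^sup>2))" for n
        using f1M by (auto simp: norm_mult intro!: mult_right_mono)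
    qed measurable
    also have "(\<integral>z. f s * of_real (sqrt pi * exp (- (1/4) * (z - 0)\<^sup>2)) \<partial>lborel)
      = f s * of_real (\<integral>z. sqrt pi * exp (- (1/4) * (z - 0)\<^sup>2) \<partial>lborel)"
      by (simp only: integral_mult_right_zero integral_complex_of_real)
    also have "(\<integral>z. sqrt pi * exp (- (1/4) * (z - 0)\<^sup>2) \<partial>lborel) = sqrt pi * sqrt (pi / (1/4))"
      by (simp only: integral_mult_right_zero gaussian_integral)
    also have "\<dots> = 2 * pi" by (simp add: real_sqrt_mult)
    finally show ?thesis unfolding eq by (simp add: mult.commute)
  qed
  define E where "E = (\<integral>t. cmod (f t * of_real (exp (- (1/4) * (t - s)\<^sup>2))) \<partial>lborel)"
  have Eint: "integrable lborel (\<lambda>t. f t * of_real (exp (- (1/4) * (t - s)\<^sup>2)))"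
  proof (rule L2_space_mult_integrable[OF L2], rule L2_spaceI)
    have "integrable lborel (\<lambda>t. exp (- (1/2) * (t - s)\<^sup>2))"
      by (rule gaussian_integrable) simp
    also have "(\<lambda>t. exp (- (1/2) * (t - s)\<^sup>2)) = (\<lambda>t. (cmod (complex_of_real (exp (- (1/4) * (t - s)\<^sup>2))))\<^sup>2)"
      by (auto simp: exp_double[symmetric] simp del: of_real_exp)
    finally show "integrable lborel (\<lambda>t. (cmod (complex_of_real (exp (- (1/4) * (t - s)\<^sup>2))))\<^sup>2)" .
  qed measurable
  \<comment> \<open>Of the \<open>n + 1\<close> units in the exponent, \<open>n\<close> are spent on
    \<open>(t - s)\<^sup>2 \<ge> 1\<close> to gain \<open>exp (- real n / 4)\<close>; the remaining
    one keeps the product with \<open>f\<close> integrable.\<close>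
  have kf: "cmod (f2 t * of_real (k n t)) \<le> sqrt (pi * ?N n) * exp (- real n / 4) * cmod (f t * of_real (exp (- (1/4) * (t - s)\<^sup>2)))" for n t
  proof (cases "\<bar>t - s\<bar> \<le> 1")
    case False
    then have "1 \<le> (t - s)\<^sup>2"
      by (metis abs_le_square_iff abs_one less_eq_real_def not_le one_power2)
    then have "real n * 1 \<le> real n * (t - s)\<^sup>2" by (intro mult_left_mono) auto
    then have "exp (- (?N n / 4) * (t - s)\<^sup>2) \<le> exp (- real n / 4 + - (1/4) * (t - s)\<^sup>2)"
      by (simp add: field_simps)
    then have "cmod (f t) * (sqrt (pi * ?N n) * exp (- (?N n / 4) * (t - s)\<^sup>2)) \<le>
       cmod (f t) * (sqrt (pi * ?N n) * (exp (- real n / 4) * exp (- (1/4) * (t - s)\<^sup>2)))"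
      unfolding exp_add by (intro mult_left_mono) auto
    then show ?thesis
      using False by (simp add: f2_def k_def norm_mult ac_simps del: of_nat_Suc)
  qed (simp add: f2_def)
  have far_int: "integrable lborel (\<lambda>t. f2 t * of_real (k n t))" for n
    by (rule Bochner_Integration.integrable_bound[OF integrable_mult_right[OF integrable_norm[OF Eint], of "sqrt (pi * ?N n) * exp (- real n / 4)"]])
       (use kf in \<open>auto simp del: of_nat_Suc intro: order_trans\<close>)
  have far: "(\<lambda>n. \<integral>t. f2 t * of_real (k n t) \<partial>lborel) \<longlonglongrightarrow> 0"
  proof (rule Lim_null_comparison)
    show "\<forall>\<^sub>F n in sequentially. norm (\<integral>t. f2 t * of_real (k n t) \<partial>lborel) \<le> sqrt (pi * ?N n) * exp (- real n / 4) * E"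
    proof (intro always_eventually allI)
      fix n
      have "norm (\<integral>t. f2 t * of_real (k n t) \<partial>lborel) \<le> (\<integral>t. norm (f2 t * of_real (k n t)) \<partial>lborel)"
        by (rule integral_norm_bound)
      also have "\<dots> \<le> (\<integral>t. sqrt (pi * ?N n) * exp (- real n / 4) * cmod (f t * of_real (exp (- (1/4) * (t - s)\<^sup>2))) \<partial>lborel)"
        by (intro integral_mono kf integrable_mult_right integrable_norm Eint far_int)
      finally show "norm (\<integral>t. f2 t * of_real (k n t) \<partial>lborel) \<le> sqrt (pi * ?N n) * exp (- real n / 4) * E"
        by (simp add: E_def)
    qed
    have "(\<lambda>n. sqrt (pi * ?N n) * exp (- real n / 4)) \<longlonglongrightarrow> 0"
      by real_asymp
    then show "(\<lambda>n. sqrt (pi * ?N n) * exp (- real n / 4) * E) \<longlonglongrightarrow> 0"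
      using tendsto_mult_left_zero by blast
  qed
  have near_int: "integrable lborel (\<lambda>t. f1 t * of_real (k n t))" for n
    by (rule Bochner_Integration.integrable_bound[OF integrable_mult_right[OF integrable_norm[OF kint[of n]], of M]])
       (use f1M M0 in \<open>auto simp: norm_mult intro!: mult_right_mono\<close>)
  have "(\<integral>t. f t * of_real (k n t) \<partial>lborel) = (\<integral>t. f1 t * of_real (k n t) \<partial>lborel) + (\<integral>t. f2 t * of_real (k n t) \<partial>lborel)" for n
    unfolding Bochner_Integration.integral_add[OF near_int far_int, symmetric]
    by (intro Bochner_Integration.integral_cong) (auto simp: f1_def f2_def)
  then show ?thesis
    using tendsto_add[OF near far] by (simp add: k_def del: of_nat_Suc)
qed

lemma PW_pi_inversion:
  assumes "f \<in> PW_pi"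
  obtains F where "F \<in> L2_space lborel" "integrable lborel F" "\<And>\<xi>. \<xi> \<notin> {-pi..pi} \<Longrightarrow> F \<xi> = 0"
    "\<And>t. f t = ft F t"
proof -
  obtain G u where f: "f \<in> L2_space lborel" and cont: "continuous_on UNIV f"
    and u: "\<And>n. integrable lborel (u n)" "\<And>n. u n \<in> L2_space lborel"
    and uf: "L2_tendsto lborel u f sequentially"
    and uG: "L2_tendsto lborel (\<lambda>n. fourier (u n)) G sequentially"
    and G0: "AE x in lborel. x \<notin> {-pi..pi} \<longrightarrow> G x = 0"
    using assms by (auto simp: PW_pi_def has_fourier_L2_def)
  have G: "G \<in> L2_space lborel" using uG by (simp add: L2_tendsto_def)
  have [measurable]: "f \<in> borel_measurable borel" "G \<in> borel_measurable borel"
    using L2_space_measurable[OF f] L2_space_measurable[OF G] by simp_all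
  \<comment> \<open>The indicator turns vanishing almost everywhere outside the band into vanishing
    everywhere; it also makes \<open>F\<close> integrable, as a product of two square-integrable
    functions.\<close>
  define F where "F \<xi> = of_real (1 / (2 * pi)) * (indicator {-pi..pi} \<xi> * G \<xi>)" for \<xi>
  have FL2: "F \<in> L2_space lborel"
    by (rule L2_space_mono[OF G, where C = "1 / (2 * pi)"])
       (auto simp: F_def[abs_def] norm_mult norm_divide indicator_def)
  have ind: "(\<lambda>\<xi>. indicator {-pi..pi} \<xi> :: complex) \<in> L2_space lborel"
  proof (rule L2_spaceI)
    have "(\<lambda>\<xi>. (cmod (indicator {-pi..pi} \<xi>))\<^sup>2) = (\<lambda>\<xi>. indicator {-pi..pi} \<xi> :: real)"
      by (auto simp: indicator_def)
    then show "integrable lborel (\<lambda>\<xi>. (cmod (indicator {-pi..pi} \<xi>))\<^sup>2)" by simp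
  qed measurable
  have Fint: "integrable lborel F"
    unfolding F_def by (intro integrable_mult_right L2_space_mult_integrable ind G)
  have fourier_ft: "fourier g x = ft g (- 1 * x)" for g x
    by (simp add: fourier_def ft_def cis_conv_exp)
  have duality: "(\<integral>\<xi>. G \<xi> * \<phi> \<xi> \<partial>lborel) = (\<integral>t. f t * ft \<phi> (- 1 * t) \<partial>lborel)"
    if \<phi>: "integrable lborel \<phi>" "\<phi> \<in> L2_space lborel" "(\<lambda>t. ft \<phi> (- 1 * t)) \<in> L2_space lborel" for \<phi>
  proof -
    have "(\<lambda>n. \<integral>\<xi>. fourier (u n) \<xi> * \<phi> \<xi> \<partial>lborel) \<longlonglongrightarrow> (\<integral>\<xi>. G \<xi> * \<phi> \<xi> \<partial>lborel)"
      by (rule L2_tendsto_inner[OF uG \<phi>(2)])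
    moreover have "(\<integral>\<xi>. fourier (u n) \<xi> * \<phi> \<xi> \<partial>lborel) = (\<integral>t. u n t * ft \<phi> (- 1 * t) \<partial>lborel)" for n
      unfolding fourier_ft by (rule ft_multiplication[symmetric, OF u(1) \<phi>(1)])
    moreover have "(\<lambda>n. \<integral>t. u n t * ft \<phi> (- 1 * t) \<partial>lborel) \<longlonglongrightarrow> (\<integral>t. f t * ft \<phi> (- 1 * t) \<partial>lborel)"
      by (rule L2_tendsto_inner[OF uf \<phi>(3)])
    ultimately show ?thesis by (auto intro: LIMSEQ_unique)
  qed
  have "f s = ft F s" for s
  proof -
    \<comment> \<open>As \<open>n\<close> grows, \<open>\<phi> n\<close> tends to the character
      \<open>cis (s * \<xi>)\<close>, while its reflected transform \<open>\<gamma> n\<close> is the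
      kernel of \<open>gaussian_approximate_identity\<close>.\<close>
    define \<phi> where "\<phi> n \<xi> = complex_of_real (exp (- (1 / real (Suc n)) * \<xi>\<^sup>2)) * cis (s * \<xi>)" for n \<xi>
    define \<gamma> where "\<gamma> n t = sqrt (pi * real (Suc n)) * exp (- (real (Suc n) / 4) * (t - s)\<^sup>2)" for n t
    have \<phi>m[measurable]: "\<phi> n \<in> borel_measurable borel" for n
      unfolding \<phi>_def[abs_def] by measurable
    have \<phi>1: "integrable lborel (\<phi> n)" for n
      unfolding \<phi>_def using gaussian_integrable[of "1 / real (Suc n)" 0]
      by (intro integrable_mult_cis) (simp add: complex_of_real_integrable_eq)
    have \<phi>2: "\<phi> n \<in> L2_space lborel" for n
    proof (rule L2_spaceI)
      have "(cmod (\<phi> n \<xi>))\<^sup>2 = exp (- (2 / real (Suc n)) * (\<xi> - 0)\<^sup>2)" for \<xi>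
        by (simp add: \<phi>_def norm_mult exp_double[symmetric] del: of_real_exp of_nat_Suc)
      then show "integrable lborel (\<lambda>\<xi>. (cmod (\<phi> n \<xi>))\<^sup>2)"
        using gaussian_integrable[of "2 / real (Suc n)" 0] by simp
    qed measurable
    have \<phi>3: "ft (\<phi> n) (- 1 * t) = of_real (\<gamma> n t)" for n t
    proof -
      have "ft (\<phi> n) (- 1 * t) = ft (\<lambda>\<xi>. of_real (exp (- (1 / real (Suc n)) * \<xi>\<^sup>2))) (s - t)"
        by (simp add: ft_def \<phi>_def mult.assoc cis_mult left_diff_distrib del: of_nat_Suc)
      also have "\<dots> = of_real (\<gamma> n t)"
        by (subst gaussian_ft) (simp_all add: \<gamma>_def power2_commute field_simps del: of_nat_Suc)
      finally show ?thesis .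
    qed
    have \<phi>4: "(\<lambda>t. ft (\<phi> n) (- 1 * t)) \<in> L2_space lborel" for n
      unfolding \<phi>3
    proof (rule L2_spaceI)
      have "(cmod (complex_of_real (\<gamma> n t)))\<^sup>2 = pi * real (Suc n) * exp (- (real (Suc n) / 2) * (t - s)\<^sup>2)" for t
        by (simp add: \<gamma>_def norm_mult power_mult_distrib exp_double[symmetric] del: of_real_exp of_nat_Suc of_real_mult)
      then show "integrable lborel (\<lambda>t. (cmod (complex_of_real (\<gamma> n t)))\<^sup>2)"
        using gaussian_integrable[of "real (Suc n) / 2" s] by simp
      show "(\<lambda>t. complex_of_real (\<gamma> n t)) \<in> borel_measurable lborel"
        unfolding \<gamma>_def[abs_def] by measurable
    qed
    have "(\<lambda>n. \<integral>\<xi>. G \<xi> * \<phi> n \<xi> \<partial>lborel) \<longlonglongrightarrow> of_real (2 * pi) * f s"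
      unfolding duality[OF \<phi>1 \<phi>2 \<phi>4] \<phi>3 unfolding \<gamma>_def
      by (rule gaussian_approximate_identity[OF cont f])
    moreover have "(\<lambda>n. \<integral>\<xi>. G \<xi> * \<phi> n \<xi> \<partial>lborel) \<longlonglongrightarrow> (\<integral>\<xi>. of_real (2 * pi) * (F \<xi> * cis (s * \<xi>)) \<partial>lborel)"
    proof (rule integral_dominated_convergence[where w = "\<lambda>\<xi>. 2 * pi * cmod (F \<xi>)"])
      show "integrable lborel (\<lambda>\<xi>. 2 * pi * cmod (F \<xi>))" using Fint by auto
      have GF: "AE \<xi> in lborel. G \<xi> = of_real (2 * pi) * F \<xi>"
        using G0 by eventually_elim (auto simp: F_def indicator_def)
      show "AE \<xi> in lborel. (\<lambda>n. G \<xi> * \<phi> n \<xi>) \<longlonglongrightarrow> of_real (2 * pi) * (F \<xi> * cis (s * \<xi>))"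
        using GF
      proof eventually_elim
        case (elim \<xi>)
        have "(\<lambda>n. exp (- (1 / real (Suc n)) * \<xi>\<^sup>2)) \<longlonglongrightarrow> exp (- 0 * \<xi>\<^sup>2)"
          by (intro tendsto_intros LIMSEQ_Suc[OF lim_1_over_n])
        then have "(\<lambda>n. G \<xi> * (of_real (exp (- (1 / real (Suc n)) * \<xi>\<^sup>2)) * cis (s * \<xi>))) \<longlonglongrightarrow> G \<xi> * (of_real (exp (- 0 * \<xi>\<^sup>2)) * cis (s * \<xi>))"
          by (intro tendsto_mult tendsto_const tendsto_of_real)
        then show ?case unfolding \<phi>_def elim by (simp add: mult.assoc)
      qed
      show "AE \<xi> in lborel. norm (G \<xi> * \<phi> n \<xi>) \<le> 2 * pi * cmod (F \<xi>)" for n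
        using GF
      proof eventually_elim
        case (elim \<xi>)
        have "cmod (\<phi> n \<xi>) \<le> 1" by (simp add: \<phi>_def norm_mult del: of_real_exp)
        then show ?case
          using mult_left_le[of "cmod (\<phi> n \<xi>)" "2 * pi * cmod (F \<xi>)"] by (simp add: elim norm_mult)
      qed
    next
      have [measurable]: "F \<in> borel_measurable borel" using Fint by auto
      show "(\<lambda>\<xi>. of_real (2 * pi) * (F \<xi> * cis (s * \<xi>))) \<in> borel_measurable lborel" by measurable
      show "(\<lambda>\<xi>. G \<xi> * \<phi> n \<xi>) \<in> borel_measurable lborel" for n by measurable
    qed
    ultimately have "of_real (2 * pi) * f s = (\<integral>\<xi>. of_real (2 * pi) * (F \<xi> * cis (s * \<xi>)) \<partial>lborel)"
      by (rule LIMSEQ_unique)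
    also have "\<dots> = of_real (2 * pi) * ft F s" by (simp add: ft_def)
    finally show ?thesis by simp
  qed
  then show ?thesis using that[of F] FL2 Fint by (auto simp: F_def)
qed

section \<open>Coercive matrices on square-summable sequences\<close>

abbreviation l2_on :: "(int \<Rightarrow> complex) \<Rightarrow> int set \<Rightarrow> real" where
  "l2_on a J \<equiv> L2_set (\<lambda>j. cmod (a j)) J"

lemma has_sum_diff:
  fixes f g :: "'a \<Rightarrow> complex"
  assumes "(f has_sum a) A" "(g has_sum b) A"
  shows "((\<lambda>x. f x - g x) has_sum (a - b)) A"
  using has_sum_add[OF assms(1) has_sum_cmult_right[OF assms(2), of "-1"]] by simp

lemma l2_norm_nonneg [simp]: "0 \<le> l2_norm a"
  by (simp add: l2_norm_def infsum_nonneg)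

lemma l2_norm_power2: "(l2_norm a)\<^sup>2 = (\<Sum>\<^sub>\<infinity>j. (cmod (a j))\<^sup>2)"
  by (simp add: l2_norm_def infsum_nonneg)

lemma l2_on_power2: "(l2_on a J)\<^sup>2 = (\<Sum>j\<in>J. (cmod (a j))\<^sup>2)"
  by (simp add: L2_set_def sum_nonneg)

lemma l2_on_le_l2_norm:
  assumes "square_summable a" "finite J"
  shows "l2_on a J \<le> l2_norm a"
  unfolding L2_set_def l2_norm_def
  using assms by (intro real_sqrt_le_mono finite_sum_le_infsum) (auto simp: square_summable_def)

lemma norm_le_l2_norm: "square_summable a \<Longrightarrow> cmod (a j) \<le> l2_norm a"
  using l2_on_le_l2_norm[of a "{j}"] by (simp add: L2_set_def)

lemma l2_normI:
  assumes "\<And>J. finite J \<Longrightarrow> l2_on a J \<le> C"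
  shows "square_summable a" "l2_norm a \<le> C"
proof -
  have C: "0 \<le> C" using assms[of "{}"] by simp
  have le: "(\<Sum>j\<in>J. (cmod (a j))\<^sup>2) \<le> C\<^sup>2" if "finite J" for J
    using power_mono[OF assms[OF that], of 2] by (simp add: l2_on_power2)
  then show s: "square_summable a"
    unfolding square_summable_def
    by (intro nonneg_bdd_above_summable_on bdd_aboveI2[where M = "C\<^sup>2"]) auto
  then have "(l2_norm a)\<^sup>2 \<le> C\<^sup>2"
    unfolding l2_norm_power2 by (intro infsum_le_finite_sums le) (auto simp: square_summable_def)
  then show "l2_norm a \<le> C"
    using C by (simp add: power2_le_iff_abs_le)
qed

lemma l2_on_add: "l2_on (\<lambda>j. a j + b j) J \<le> l2_on a J + l2_on b J"
  by (rule order_trans[OF L2_set_mono L2_set_triangle_ineq]) (auto intro: norm_triangle_ineq)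

lemma l2_norm_add:
  assumes "square_summable a" "square_summable b"
  shows "square_summable (\<lambda>j. a j + b j)" "l2_norm (\<lambda>j. a j + b j) \<le> l2_norm a + l2_norm b"
proof -
  have "l2_on (\<lambda>j. a j + b j) J \<le> l2_norm a + l2_norm b" if "finite J" for J
    by (rule order_trans[OF l2_on_add]) (intro add_mono l2_on_le_l2_norm assms that)
  note * = this
  show "square_summable (\<lambda>j. a j + b j)" by (rule l2_normI(1), erule *)
  show "l2_norm (\<lambda>j. a j + b j) \<le> l2_norm a + l2_norm b" by (rule l2_normI(2), erule *)
qed

lemma l2_on_cmult: "l2_on (\<lambda>j. z * a j) J = cmod z * l2_on a J"
  by (simp add: norm_mult L2_set_right_distrib)

lemma l2_norm_cmult:
  assumes "square_summable a"
  shows "square_summable (\<lambda>j. z * a j)" "l2_norm (\<lambda>j. z * a j) \<le> cmod z * l2_norm a"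
proof -
  have "l2_on (\<lambda>j. z * a j) J \<le> cmod z * l2_norm a" if "finite J" for J
    unfolding l2_on_cmult by (intro mult_left_mono l2_on_le_l2_norm assms that) simp
  note * = this
  show "square_summable (\<lambda>j. z * a j)" by (rule l2_normI(1), erule *)
  show "l2_norm (\<lambda>j. z * a j) \<le> cmod z * l2_norm a" by (rule l2_normI(2), erule *)
qed

lemma square_summable_diff:
  assumes "square_summable a" "square_summable b"
  shows "square_summable (\<lambda>j. a j - b j)"
  using l2_norm_add(1)[OF assms(1) l2_norm_cmult(1)[OF assms(2), of "-1"]] by simp

lemma square_summable_cnj: "square_summable a \<Longrightarrow> square_summable (\<lambda>j. cnj (a j))"
  by (simp add: square_summable_def)

text \<open>Taking \<open>c = y\<close> on \<open>J\<close> turns the hypothesis into a bound of the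
  squared norm by \<open>C\<close> times the norm. Square summability of the matrix rows, of the
  image of the matrix, of the Gaussian translates and of the samples is obtained in this
  way.\<close>

lemma l2_norm_dual:
  assumes "\<And>c J. finite J \<Longrightarrow> cmod (\<Sum>j\<in>J. cnj (c j) * y j) \<le> C * l2_on c J" "0 \<le> C"
  shows "square_summable y" "l2_norm y \<le> C"
proof -
  have "l2_on y J \<le> C" if "finite J" for J
  proof -
    have "(\<Sum>j\<in>J. cnj (y j) * y j) = of_real ((l2_on y J)\<^sup>2)"
      by (simp add: l2_on_power2 complex_norm_square mult.commute del: of_real_power)
    then have "cmod (\<Sum>j\<in>J. cnj (y j) * y j) = (l2_on y J)\<^sup>2"
      by (simp only: norm_of_real abs_power2)
    then have "l2_on y J * l2_on y J \<le> C * l2_on y J"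
      using assms(1)[OF that, of y] by (simp add: power2_eq_square)
    then show ?thesis
      using assms(2) L2_set_nonneg[of "\<lambda>j. cmod (y j)" J] by (cases "l2_on y J = 0") auto
  qed
  note * = this
  show "square_summable y" by (rule l2_normI(1), erule *)
  show "l2_norm y \<le> C" by (rule l2_normI(2), erule *)
qed

lemma l2_cauchy_schwarz:
  assumes "square_summable a" "square_summable b"
  shows "(\<lambda>j. cmod (a j * b j)) summable_on UNIV" "cmod (\<Sum>\<^sub>\<infinity>j. a j * b j) \<le> l2_norm a * l2_norm b"
proof -
  have le: "(\<Sum>j\<in>J. cmod (a j * b j)) \<le> l2_norm a * l2_norm b" if "finite J" for J
  proof -
    have "(\<Sum>j\<in>J. cmod (a j * b j)) \<le> l2_on a J * l2_on b J"
      using L2_set_mult_ineq[of "\<lambda>j. cmod (a j)" "\<lambda>j. cmod (b j)" J] by (simp add: norm_mult)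
    also have "\<dots> \<le> l2_norm a * l2_norm b"
      using l2_on_le_l2_norm[OF _ that] assms by (intro mult_mono) auto
    finally show ?thesis .
  qed
  then show s: "(\<lambda>j. cmod (a j * b j)) summable_on UNIV"
    by (intro nonneg_bdd_above_summable_on bdd_aboveI2[where M = "l2_norm a * l2_norm b"]) auto
  have "cmod (\<Sum>\<^sub>\<infinity>j. a j * b j) \<le> (\<Sum>\<^sub>\<infinity>j. cmod (a j * b j))"
    by (rule norm_infsum_bound[OF s])
  also have "\<dots> \<le> l2_norm a * l2_norm b"
    by (rule infsum_le_finite_sums[OF s]) (use le in auto)
  finally show "cmod (\<Sum>\<^sub>\<infinity>j. a j * b j) \<le> l2_norm a * l2_norm b" .
qed

lemma l2_mult_summable:
  "square_summable a \<Longrightarrow> square_summable b \<Longrightarrow> (\<lambda>j. a j * b j) summable_on UNIV"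
  using l2_cauchy_schwarz(1) by (rule Infinite_Sum.abs_summable_summable)

section \<open>Tails left over by finite sections\<close>

definition l2_cut :: "(int \<Rightarrow> complex) \<Rightarrow> int set \<Rightarrow> int \<Rightarrow> complex" where
  "l2_cut a J j = (if j \<in> J then 0 else a j)"

lemma l2_cut_square_summable:
  assumes "square_summable a"
  shows "square_summable (l2_cut a J)"
proof (rule l2_normI)
  show "l2_on (l2_cut a J) S \<le> l2_norm a" if "finite S" for S
    by (rule order_trans[OF L2_set_mono l2_on_le_l2_norm[OF assms that]]) (auto simp: l2_cut_def)
qed

lemma l2_cut_tendsto:
  assumes "square_summable a"
  shows "((\<lambda>J. l2_norm (l2_cut a J)) \<longlongrightarrow> 0) (finite_subsets_at_top UNIV)"
proof -
  let ?g = "\<lambda>j. (cmod (a j))\<^sup>2"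
  have g: "?g summable_on UNIV" using assms by (simp add: square_summable_def)
  have "((\<lambda>J. sqrt (infsum ?g UNIV - sum ?g J)) \<longlongrightarrow> sqrt (infsum ?g UNIV - infsum ?g UNIV)) (finite_subsets_at_top UNIV)"
    using has_sum_infsum[OF g] unfolding has_sum_def by (intro tendsto_intros)
  moreover have "\<forall>\<^sub>F J in finite_subsets_at_top UNIV. sqrt (infsum ?g UNIV - sum ?g J) = l2_norm (l2_cut a J)"
  proof (rule eventually_finite_subsets_at_top_weakI)
    fix J :: "int set" assume J: "finite J"
    have "infsum ?g UNIV = infsum ?g J + infsum ?g (UNIV - J)"
      by (subst infsum_Un_disjoint[symmetric]) (auto intro!: summable_on_subset_banach[OF g] J)
    moreover have "infsum ?g (UNIV - J) = (\<Sum>\<^sub>\<infinity>j. (cmod (l2_cut a J j))\<^sup>2)"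
      by (intro infsum_cong_neutral) (auto simp: l2_cut_def)
    ultimately show "sqrt (infsum ?g UNIV - sum ?g J) = l2_norm (l2_cut a J)"
      using J by (simp add: l2_norm_def)
  qed
  ultimately have "((\<lambda>J. l2_norm (l2_cut a J)) \<longlongrightarrow> sqrt (infsum ?g UNIV - infsum ?g UNIV)) (finite_subsets_at_top UNIV)"
    by (rule Lim_transform_eventually)
  then show ?thesis by simp
qed

lemma infsum_mult_minus_sum:
  assumes "square_summable r" "square_summable a" "finite J"
  shows "(\<Sum>\<^sub>\<infinity>j. r j * a j) - (\<Sum>j\<in>J. r j * a j) = (\<Sum>\<^sub>\<infinity>j. r j * l2_cut a J j)"
proof -
  have "((\<lambda>j. if j \<in> J then r j * a j else 0) has_sum (\<Sum>j\<in>J. r j * a j)) UNIV"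
    using has_sum_finite[OF assms(3), of "\<lambda>j. r j * a j"]
    by (rule has_sum_cong_neutral[THEN iffD1, rotated -1]) auto
  from has_sum_diff[OF has_sum_infsum[OF l2_mult_summable[OF assms(1,2)]] this]
  have "((\<lambda>j. r j * l2_cut a J j) has_sum ((\<Sum>\<^sub>\<infinity>j. r j * a j) - (\<Sum>j\<in>J. r j * a j))) UNIV"
    by (rule has_sum_cong[THEN iffD1, rotated]) (auto simp: l2_cut_def)
  then show ?thesis by (simp add: infsumI)
qed

text \<open>The setting of the Lax-Milgram theorem, with the form given only on finitely supported
  sequences. Separate index sets in \<open>form_bound\<close> allow the columns to exhaust the
  integers while the rows stay fixed. The condition \<open>\<alpha> \<le> K\<close> keeps
  \<open>1 - \<alpha>\<^sup>2 / K\<^sup>2\<close>, the squared contraction factor of the iteration,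
  nonnegative.\<close>

locale coercive_matrix =
  fixes A :: "int \<Rightarrow> int \<Rightarrow> complex" and K \<alpha> :: real
  assumes form_bound: "\<And>S J c d. finite S \<Longrightarrow> finite J \<Longrightarrow>
      cmod (\<Sum>k\<in>S. cnj (d k) * (\<Sum>j\<in>J. A k j * c j)) \<le> K * l2_on d S * l2_on c J"
    and form_coercive: "\<And>J c. finite J \<Longrightarrow>
      \<alpha> * (l2_on c J)\<^sup>2 \<le> Re (\<Sum>k\<in>J. cnj (c k) * (\<Sum>j\<in>J. A k j * c j))"
    and \<alpha>: "0 < \<alpha>" "\<alpha> \<le> K"
begin

definition app :: "(int \<Rightarrow> complex) \<Rightarrow> int \<Rightarrow> complex" where
  "app a k = (\<Sum>\<^sub>\<infinity>j. A k j * a j)"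

lemma row_square_summable: "square_summable (A k)"
proof (rule l2_norm_dual)
  show "cmod (\<Sum>j\<in>J. cnj (c j) * A k j) \<le> K * l2_on c J" if "finite J" for c J
    using form_bound[of "{k}" J "\<lambda>_. 1" "\<lambda>j. cnj (c j)"] that
    by (simp add: L2_set_def mult.commute)
qed (use \<alpha> in auto)

lemma app_has_sum:
  "square_summable a \<Longrightarrow> ((\<lambda>j. A k j * a j) has_sum app a k) UNIV"
  unfolding app_def by (intro has_sum_infsum l2_mult_summable row_square_summable)

lemma app_diff:
  assumes "square_summable a" "square_summable b"
  shows "app (\<lambda>j. a j - b j) k = app a k - app b k"
proof -
  have "((\<lambda>j. A k j * (a j - b j)) has_sum (app a k - app b k)) UNIV"
    using has_sum_diff[OF app_has_sum[OF assms(1)] app_has_sum[OF assms(2)]] by (simp add: algebra_simps)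
  then show ?thesis unfolding app_def by (rule infsumI)
qed

text \<open>The finite form bound survives as the columns exhaust the integers for a fixed row set
  \<open>S\<close>; duality then converts it into a norm bound.\<close>

lemma app_bound:
  assumes "square_summable a"
  shows "square_summable (app a)" "l2_norm (app a) \<le> K * l2_norm a"
proof -
  have *: "cmod (\<Sum>k\<in>S. cnj (c k) * app a k) \<le> K * l2_norm a * l2_on c S" if S: "finite S" for c S
  proof (rule tendsto_upperbound)
    show "((\<lambda>J. cmod (\<Sum>k\<in>S. cnj (c k) * (\<Sum>j\<in>J. A k j * a j))) \<longlongrightarrow> cmod (\<Sum>k\<in>S. cnj (c k) * app a k)) (finite_subsets_at_top UNIV)"
      using app_has_sum[OF assms] unfolding has_sum_def by (intro tendsto_intros)
    show "\<forall>\<^sub>F J in finite_subsets_at_top UNIV. cmod (\<Sum>k\<in>S. cnj (c k) * (\<Sum>j\<in>J. A k j * a j)) \<le> K * l2_norm a * l2_on c S"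
    proof (rule eventually_finite_subsets_at_top_weakI)
      fix J :: "int set" assume J: "finite J"
      have "cmod (\<Sum>k\<in>S. cnj (c k) * (\<Sum>j\<in>J. A k j * a j)) \<le> K * l2_on c S * l2_on a J"
        by (rule form_bound[OF S J])
      also have "\<dots> \<le> K * l2_on c S * l2_norm a"
        using \<alpha> by (intro mult_left_mono l2_on_le_l2_norm assms J) auto
      finally show "cmod (\<Sum>k\<in>S. cnj (c k) * (\<Sum>j\<in>J. A k j * a j)) \<le> K * l2_norm a * l2_on c S"
        by (simp add: ac_simps)
    qed
  qed simp
  have K0: "0 \<le> K * l2_norm a" using \<alpha> by simp
  show "square_summable (app a)" by (rule l2_norm_dual(1)[OF * K0])
  show "l2_norm (app a) \<le> K * l2_norm a" by (rule l2_norm_dual(2)[OF * K0])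
qed

lemma app_cut:
  assumes "square_summable a" "finite J"
  shows "app a k - (\<Sum>j\<in>J. A k j * a j) = app (l2_cut a J) k"
  unfolding app_def by (rule infsum_mult_minus_sum[OF row_square_summable assms])

text \<open>A finite section solves the full equations only up to the image of the tail, which
  \<open>app_bound\<close> controls. This is the truncation error in every later estimate on
  sections.\<close>

lemma app_cut_bound:
  assumes "square_summable a" "finite J" "finite S"
  shows "cmod ((\<Sum>k\<in>S. cnj (c k) * app a k) - (\<Sum>k\<in>S. cnj (c k) * (\<Sum>j\<in>J. A k j * a j)))
    \<le> K * l2_norm (l2_cut a J) * l2_on c S"
proof -
  have "(\<Sum>k\<in>S. cnj (c k) * app a k) - (\<Sum>k\<in>S. cnj (c k) * (\<Sum>j\<in>J. A k j * a j))
     = (\<Sum>k\<in>S. cnj (c k) * app (l2_cut a J) k)"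
    by (simp add: app_cut[OF assms(1,2), symmetric] sum_subtractf[symmetric] algebra_simps)
  also have "cmod \<dots> \<le> (\<Sum>k\<in>S. cmod (c k) * cmod (app (l2_cut a J) k))"
    by (rule order_trans[OF norm_sum]) (simp add: norm_mult)
  also have "\<dots> \<le> l2_on c S * l2_on (app (l2_cut a J)) S"
    using L2_set_mult_ineq[of "\<lambda>k. cmod (c k)" "\<lambda>k. cmod (app (l2_cut a J) k)" S] by simp
  also have "\<dots> \<le> l2_on c S * (K * l2_norm (l2_cut a J))"
    using l2_cut_square_summable[OF assms(1)]
    by (intro mult_left_mono order_trans[OF l2_on_le_l2_norm[OF app_bound(1) assms(3)] app_bound(2)]) auto
  finally show ?thesis by (simp add: ac_simps)
qed

lemma app_coercive:
  assumes a: "square_summable a"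
  shows "\<alpha> * (l2_norm a)\<^sup>2 \<le> Re (\<Sum>\<^sub>\<infinity>k. cnj (a k) * app a k)"
proof (rule tendsto_le[OF finite_subsets_at_top_neq_bot])
  let ?F = "finite_subsets_at_top (UNIV :: int set)"
  let ?q = "\<lambda>J. \<Sum>k\<in>J. cnj (a k) * app a k"
  have "((\<lambda>k. cnj (a k) * app a k) has_sum (\<Sum>\<^sub>\<infinity>k. cnj (a k) * app a k)) UNIV"
    by (intro has_sum_infsum l2_mult_summable square_summable_cnj app_bound a)
  then have q: "(?q \<longlongrightarrow> (\<Sum>\<^sub>\<infinity>k. cnj (a k) * app a k)) ?F" by (simp add: has_sum_def)
  have "((\<lambda>J. Re (?q J) + K * l2_norm (l2_cut a J) * l2_norm a) \<longlongrightarrow> Re (\<Sum>\<^sub>\<infinity>k. cnj (a k) * app a k) + K * 0 * l2_norm a) ?F"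
    by (intro tendsto_intros q l2_cut_tendsto a)
  then show "((\<lambda>J. Re (?q J) + K * l2_norm (l2_cut a J) * l2_norm a) \<longlongrightarrow> Re (\<Sum>\<^sub>\<infinity>k. cnj (a k) * app a k)) ?F"
    by simp
  have "((\<lambda>j. (cmod (a j))\<^sup>2) has_sum (l2_norm a)\<^sup>2) UNIV"
    using a unfolding l2_norm_power2 square_summable_def by (rule has_sum_infsum)
  then show "((\<lambda>J. \<alpha> * (l2_on a J)\<^sup>2) \<longlongrightarrow> \<alpha> * (l2_norm a)\<^sup>2) ?F"
    unfolding has_sum_def l2_on_power2 by (intro tendsto_intros)
  show "\<forall>\<^sub>F J in ?F. \<alpha> * (l2_on a J)\<^sup>2 \<le> Re (?q J) + K * l2_norm (l2_cut a J) * l2_norm a"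
  proof (rule eventually_finite_subsets_at_top_weakI)
    fix J :: "int set" assume J: "finite J"
    let ?r = "\<Sum>k\<in>J. cnj (a k) * (\<Sum>j\<in>J. A k j * a j)"
    have "\<alpha> * (l2_on a J)\<^sup>2 \<le> Re ?r" by (rule form_coercive[OF J])
    also have "\<dots> \<le> Re (?q J) + cmod (?q J - ?r)"
      using complex_Re_le_cmod[of "?r - ?q J"] by (simp add: norm_minus_commute)
    also have "cmod (?q J - ?r) \<le> K * l2_norm (l2_cut a J) * l2_on a J"
      by (rule app_cut_bound[OF a J J])
    also have "\<dots> \<le> K * l2_norm (l2_cut a J) * l2_norm a"
      using \<alpha> by (intro mult_left_mono l2_on_le_l2_norm a J) auto
    finally show "\<alpha> * (l2_on a J)\<^sup>2 \<le> Re (?q J) + K * l2_norm (l2_cut a J) * l2_norm a" by simp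
  qed
qed

lemma app_inj:
  assumes "square_summable a" "square_summable b" "app a = app b"
  shows "a = b"
proof -
  let ?d = "\<lambda>j. a j - b j"
  have d: "square_summable ?d" by (rule square_summable_diff[OF assms(1,2)])
  have "\<alpha> * (l2_norm ?d)\<^sup>2 \<le> 0"
    using app_coercive[OF d] assms by (simp add: app_diff)
  then have "l2_norm ?d = 0" using \<alpha> by (simp add: mult_le_0_iff)
  then show ?thesis using norm_le_l2_norm[OF d] by (auto intro!: ext)
qed

text \<open>With \<tau> the step size, expanding the square gives at most
  \<open>1 - 2 * \<tau> * \<alpha> + \<tau>\<^sup>2 * K\<^sup>2\<close> times the squared norm of
  \<open>a\<close>. The choice \<open>\<tau> = \<alpha> / K\<^sup>2\<close> minimises this factor,
  with value \<open>1 - \<alpha>\<^sup>2 / K\<^sup>2\<close>.\<close>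

lemma richardson_contraction:
  assumes a: "square_summable a"
  shows "l2_norm (\<lambda>k. a k - of_real (\<alpha> / K\<^sup>2) * app a k) \<le> sqrt (1 - \<alpha>\<^sup>2 / K\<^sup>2) * l2_norm a"
proof -
  define \<tau> where "\<tau> = \<alpha> / K\<^sup>2"
  have K: "0 < K" using \<alpha> by simp
  have \<tau>: "0 < \<tau>" using \<alpha> K by (simp add: \<tau>_def)
  have s1: "((\<lambda>j. (cmod (a j))\<^sup>2) has_sum (l2_norm a)\<^sup>2) UNIV"
    using a unfolding l2_norm_power2 square_summable_def by (rule has_sum_infsum)
  have s2: "((\<lambda>j. (cmod (app a j))\<^sup>2) has_sum (l2_norm (app a))\<^sup>2) UNIV"
    using app_bound(1)[OF a] unfolding l2_norm_power2 square_summable_def by (rule has_sum_infsum)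
  have "((\<lambda>k. cnj (a k) * app a k) has_sum (\<Sum>\<^sub>\<infinity>k. cnj (a k) * app a k)) UNIV"
    by (intro has_sum_infsum l2_mult_summable square_summable_cnj app_bound a)
  then have s3: "((\<lambda>k. Re (cnj (a k) * app a k)) has_sum Re (\<Sum>\<^sub>\<infinity>k. cnj (a k) * app a k)) UNIV"
    by (rule has_sum_Re)
  have "((\<lambda>k. (cmod (a k))\<^sup>2 + ((-2 * \<tau>) * Re (cnj (a k) * app a k) + \<tau>\<^sup>2 * (cmod (app a k))\<^sup>2)) has_sum
     ((l2_norm a)\<^sup>2 + ((-2 * \<tau>) * Re (\<Sum>\<^sub>\<infinity>k. cnj (a k) * app a k) + \<tau>\<^sup>2 * (l2_norm (app a))\<^sup>2))) UNIV"
    by (intro has_sum_add has_sum_cmult_right s1 s2 s3)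
  moreover have "(cmod (a k))\<^sup>2 + ((-2 * \<tau>) * Re (cnj (a k) * app a k) + \<tau>\<^sup>2 * (cmod (app a k))\<^sup>2)
      = (cmod (a k - of_real \<tau> * app a k))\<^sup>2" for k
    unfolding cmod_power2 by (simp add: power2_eq_square algebra_simps)
  ultimately have "(l2_norm (\<lambda>k. a k - of_real \<tau> * app a k))\<^sup>2
     = (l2_norm a)\<^sup>2 + ((-2 * \<tau>) * Re (\<Sum>\<^sub>\<infinity>k. cnj (a k) * app a k) + \<tau>\<^sup>2 * (l2_norm (app a))\<^sup>2)"
    unfolding l2_norm_power2[of "\<lambda>k. a k - of_real \<tau> * app a k"] by (simp add: infsumI)
  also have "\<dots> \<le> (l2_norm a)\<^sup>2 + ((-2 * \<tau>) * (\<alpha> * (l2_norm a)\<^sup>2) + \<tau>\<^sup>2 * (K * l2_norm a)\<^sup>2)"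
    using app_coercive[OF a] app_bound(2)[OF a] \<tau>
    by (intro add_mono mult_left_mono mult_left_mono_neg power_mono order_refl) auto
  also have "\<dots> = (1 - \<alpha>\<^sup>2 / K\<^sup>2) * (l2_norm a)\<^sup>2"
    using K by (simp add: \<tau>_def power_mult_distrib field_simps power2_eq_square)
  finally have "sqrt ((l2_norm (\<lambda>k. a k - of_real \<tau> * app a k))\<^sup>2) \<le> sqrt ((1 - \<alpha>\<^sup>2 / K\<^sup>2) * (l2_norm a)\<^sup>2)"
    by (rule real_sqrt_le_mono)
  then show ?thesis by (simp add: real_sqrt_mult \<tau>_def)
qed

text \<open>Solved by the Richardson iteration \<open>s \<mapsto> s + \<tau> (y - A s)\<close>.\<close>

lemma app_surj:
  assumes y: "square_summable y"
  obtains a where "square_summable a" "app a = y"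
proof -
  define \<tau> where "\<tau> = \<alpha> / K\<^sup>2"
  define q where "q = sqrt (1 - \<alpha>\<^sup>2 / K\<^sup>2)"
  have K: "0 < K" using \<alpha> by simp
  have \<tau>: "0 < \<tau>" using \<alpha> K by (simp add: \<tau>_def)
  have "\<alpha>\<^sup>2 \<le> K\<^sup>2" using \<alpha> by (intro power_mono) auto
  then have "\<alpha>\<^sup>2 / K\<^sup>2 \<le> 1" "0 < \<alpha>\<^sup>2 / K\<^sup>2"
    using K \<alpha>(1) by simp_all
  then have q: "0 \<le> q" "q < 1" by (simp_all add: q_def)
  define s where "s = rec_nat (\<lambda>_. 0) (\<lambda>_ b k. b k + of_real \<tau> * (y k - app b k))"
  have s0: "s 0 = (\<lambda>_. 0)" and sS: "s (Suc n) = (\<lambda>k. s n k + of_real \<tau> * (y k - app (s n) k))" for n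
    by (simp_all add: s_def)
  have ss: "square_summable (s n)" for n
  proof (induction n)
    case 0 show ?case by (simp add: s0 square_summable_def)
  next
    case (Suc n)
    then show ?case unfolding sS
      by (intro l2_norm_add(1) l2_norm_cmult(1) square_summable_diff y app_bound(1))
  qed
  \<comment> \<open>The increments satisfy the homogeneous recursion, from which \<open>y\<close>
    has disappeared, so the contraction makes them decay geometrically.\<close>
  define d where "d n k = s (Suc n) k - s n k" for n k
  have ds: "square_summable (d n)" for n
    unfolding d_def by (intro square_summable_diff ss)
  have dS: "d (Suc n) = (\<lambda>k. d n k - of_real \<tau> * app (d n) k)" for n
  proof
    fix k
    have *: "d m k = of_real \<tau> * (y k - app (s m) k)" for m
      by (simp add: d_def sS)
    have "app (d n) k = app (s (Suc n)) k - app (s n) k"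
      unfolding d_def by (rule app_diff[OF ss ss])
    then show "d (Suc n) k = d n k - of_real \<tau> * app (d n) k"
      unfolding *[of n] *[of "Suc n"] by (simp only: right_diff_distrib) simp
  qed
  define r where "r = l2_norm (d 0)"
  have r: "0 \<le> r" by (simp add: r_def)
  have dn: "l2_norm (d n) \<le> q ^ n * r" for n
  proof (induction n)
    case (Suc n)
    have "l2_norm (d (Suc n)) \<le> q * l2_norm (d n)"
      unfolding dS q_def \<tau>_def by (rule richardson_contraction[OF ds])
    also have "\<dots> \<le> q * (q ^ n * r)" using Suc q by (intro mult_left_mono)
    finally show ?case by (simp add: ac_simps)
  qed (simp add: r_def)
  have sum_d: "(\<Sum>n<N. d n k) = s N k" for N k
    by (induction N) (auto simp: d_def s0)
  have summ: "summable (\<lambda>n. d n k)" for k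
  proof (rule summable_comparison_test')
    show "summable (\<lambda>n. q ^ n * r)" using q by (intro summable_mult2 summable_geometric) auto
    show "norm (d n k) \<le> q ^ n * r" for n
      by (rule order_trans[OF norm_le_l2_norm[OF ds] dn])
  qed
  define a where "a k = (\<Sum>n. d n k)" for k
  have lim: "(\<lambda>N. s N k) \<longlonglongrightarrow> a k" for k
    using summable_LIMSEQ[OF summ, of k] by (simp add: sum_d a_def)
  have step: "l2_norm (\<lambda>k. s (N + M) k - s N k) \<le> q ^ N * r * (\<Sum>m<M. q ^ m)" for N M
  proof (induction M)
    case 0 show ?case by (simp add: l2_norm_def)
  next
    case (Suc M)
    have "l2_norm (\<lambda>k. (s (N + M) k - s N k) + d (N + M) k)
        \<le> l2_norm (\<lambda>k. s (N + M) k - s N k) + l2_norm (d (N + M))"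
      by (intro l2_norm_add(2) square_summable_diff ss ds)
    also have "\<dots> \<le> q ^ N * r * (\<Sum>m<M. q ^ m) + q ^ (N + M) * r"
      by (intro add_mono Suc dn)
    finally show ?case by (simp add: d_def algebra_simps power_add)
  qed
  \<comment> \<open>The limit is coordinatewise; the geometric bound on
    \<open>s (N + M) - s N\<close> passes to it on each finite index set and hence to the whole
    norm. Completeness of the sequence space is not invoked.\<close>
  have tail: "square_summable (\<lambda>k. a k - s N k) \<and> l2_norm (\<lambda>k. a k - s N k) \<le> q ^ N * r * (1 / (1 - q))" for N
  proof -
    have "l2_on (\<lambda>k. a k - s N k) J \<le> q ^ N * r * (1 / (1 - q))" if J: "finite J" for J
    proof (rule tendsto_upperbound[OF _ _ sequentially_bot])
      have "(\<lambda>M. s (N + M) k) \<longlonglongrightarrow> a k" for k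
        using LIMSEQ_ignore_initial_segment[OF lim, of N k] by (simp add: add.commute)
      then show "(\<lambda>M. l2_on (\<lambda>k. s (N + M) k - s N k) J) \<longlonglongrightarrow> l2_on (\<lambda>k. a k - s N k) J"
        unfolding L2_set_def by (intro tendsto_intros)
      show "\<forall>\<^sub>F M in sequentially. l2_on (\<lambda>k. s (N + M) k - s N k) J \<le> q ^ N * r * (1 / (1 - q))"
      proof (intro always_eventually allI)
        fix M
        have "(\<Sum>m<M. q ^ m) \<le> 1 / (1 - q)"
          using q sum_le_suminf[OF summable_geometric[of q], of "{..<M}"] suminf_geometric[of q] by simp
        then have "q ^ N * r * (\<Sum>m<M. q ^ m) \<le> q ^ N * r * (1 / (1 - q))"
          using q r by (intro mult_left_mono) auto
        then show "l2_on (\<lambda>k. s (N + M) k - s N k) J \<le> q ^ N * r * (1 / (1 - q))"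
          using l2_on_le_l2_norm[OF square_summable_diff[OF ss ss] J, of "N + M" N] step[of N M] by linarith
      qed
    qed
    note * = this
    show ?thesis by (intro conjI, rule l2_normI(1), erule *, rule l2_normI(2), erule *)
  qed
  have a: "square_summable a" using tail[of 0] by (simp add: s0)
  have "app a k = y k" for k
  proof -
    have qlim: "(\<lambda>N. q ^ N) \<longlonglongrightarrow> 0" using q by (intro LIMSEQ_power_zero) simp
    have "(\<lambda>N. app (s N) k) \<longlonglongrightarrow> app a k"
    proof (rule LIM_zero_cancel, rule Lim_null_comparison)
      show "(\<lambda>N. K * (q ^ N * r * (1 / (1 - q)))) \<longlonglongrightarrow> 0"
        using tendsto_mult_left[OF tendsto_mult_right[OF tendsto_mult_right[OF qlim, of r], of "1 / (1 - q)"], of K]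
        by simp
      show "\<forall>\<^sub>F N in sequentially. norm (app (s N) k - app a k) \<le> K * (q ^ N * r * (1 / (1 - q)))"
      proof (intro always_eventually allI)
        fix N
        have "norm (app (s N) k - app a k) = cmod (app (\<lambda>j. a j - s N j) k)"
          using app_diff[OF a ss] by (simp add: norm_minus_commute)
        also have "\<dots> \<le> l2_norm (app (\<lambda>j. a j - s N j))"
          using tail[of N] by (intro norm_le_l2_norm app_bound(1)) simp
        also have "\<dots> \<le> K * l2_norm (\<lambda>j. a j - s N j)"
          using tail[of N] by (intro app_bound(2)) simp
        also have "\<dots> \<le> K * (q ^ N * r * (1 / (1 - q)))"
          using tail[of N] K by (intro mult_left_mono) auto
        finally show "norm (app (s N) k - app a k) \<le> K * (q ^ N * r * (1 / (1 - q)))" .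
      qed
    qed
    \<comment> \<open>Each increment is \<tau> times the residual \<open>y - app (s N)\<close>, so
      decay of the increments is convergence of the residuals to \<open>0\<close>.\<close>
    moreover have "(\<lambda>N. app (s N) k) \<longlonglongrightarrow> y k"
    proof (rule LIM_zero_cancel, rule Lim_null_comparison)
      show "(\<lambda>N. q ^ N * r / \<tau>) \<longlonglongrightarrow> 0"
        using tendsto_mult_right[OF qlim, of "r / \<tau>"] by simp
      show "\<forall>\<^sub>F N in sequentially. norm (app (s N) k - y k) \<le> q ^ N * r / \<tau>"
      proof (intro always_eventually allI)
        fix N
        have "cmod (d N k) \<le> q ^ N * r"
          by (rule order_trans[OF norm_le_l2_norm[OF ds] dn])
        moreover have "cmod (d N k) = \<tau> * norm (app (s N) k - y k)"
          using \<tau> by (simp add: d_def sS norm_mult norm_minus_commute)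
        ultimately show "norm (app (s N) k - y k) \<le> q ^ N * r / \<tau>"
          using \<tau> by (simp add: pos_le_divide_eq mult.commute)
      qed
    qed
    ultimately show ?thesis by (rule LIMSEQ_unique)
  qed
  then show ?thesis using that[OF a] by auto
qed

end

section \<open>Riesz sequences of exponentials\<close>

definition trig :: "(int \<Rightarrow> real) \<Rightarrow> (int \<Rightarrow> complex) \<Rightarrow> int set \<Rightarrow> real \<Rightarrow> complex" where
  "trig x a J \<xi> = (\<Sum>j\<in>J. a j * cis (- (x j * \<xi>)))"

abbreviation band :: "real measure" where
  "band \<equiv> restrict_space lborel {-pi..pi}"

lemma trig_measurable [measurable]: "trig x a J \<in> borel_measurable borel"
  unfolding trig_def by measurable

lemma norm_trig_le: "cmod (trig x a J \<xi>) \<le> (\<Sum>j\<in>J. cmod (a j))"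
  unfolding trig_def by (rule order_trans[OF norm_sum]) (simp add: norm_mult)

lemma integral_band:
  fixes g :: "real \<Rightarrow> 'a :: {banach, second_countable_topology}"
  shows "integral\<^sup>L band g = (\<integral>\<xi>. indicator {-pi..pi} \<xi> *\<^sub>R g \<xi> \<partial>lborel)"
  by (rule integral_restrict_space) simp

lemma integrable_band:
  fixes g :: "real \<Rightarrow> 'a :: {banach, second_countable_topology}"
  shows "integrable band g \<longleftrightarrow> integrable lborel (\<lambda>\<xi>. indicator {-pi..pi} \<xi> *\<^sub>R g \<xi>)"
  by (rule integrable_restrict_space) simp

lemma measurable_band:
  fixes g :: "real \<Rightarrow> 'a :: topological_space"
  assumes "g \<in> borel_measurable borel" shows "g \<in> borel_measurable band"
  by (rule measurable_restrict_space1) (use assms in simp)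

lemma L2_space_band_bounded:
  assumes "g \<in> borel_measurable borel" "\<And>\<xi>. cmod (g \<xi>) \<le> C"
  shows "g \<in> L2_space band"
proof (rule L2_spaceI)
  have [measurable]: "g \<in> borel_measurable borel" by fact
  show "g \<in> borel_measurable band" by (rule measurable_band) fact
  show "integrable band (\<lambda>\<xi>. (cmod (g \<xi>))\<^sup>2)"
    unfolding integrable_band
  proof (rule Bochner_Integration.integrable_bound)
    show "integrable lborel (\<lambda>\<xi>. C\<^sup>2 * indicator {-pi..pi} \<xi> :: real)" by simp
    show "AE \<xi> in lborel. norm (indicator {-pi..pi} \<xi> *\<^sub>R (cmod (g \<xi>))\<^sup>2) \<le> norm (C\<^sup>2 * indicator {-pi..pi} \<xi> :: real)"
    proof -
      have "(cmod (g \<xi>))\<^sup>2 \<le> C\<^sup>2" for \<xi>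
        by (intro power_mono assms(2)) simp
      then show ?thesis by (auto simp: indicator_def)
    qed
  qed measurable
qed

lemma trig_L2_band: "trig x a J \<in> L2_space band"
  by (rule L2_space_band_bounded[OF _ norm_trig_le]) measurable

lemma integrable_mult_trig:
  assumes "integrable lborel h"
  shows "integrable lborel (\<lambda>\<xi>. h \<xi> * trig x a J \<xi>)" "integrable lborel (\<lambda>\<xi>. h \<xi> * cnj (trig x a J \<xi>))"
proof -
  have [measurable]: "h \<in> borel_measurable borel" using assms by auto
  have i: "integrable lborel (\<lambda>\<xi>. (\<Sum>j\<in>J. cmod (a j)) * cmod (h \<xi>))" using assms by auto
  have "cmod (h \<xi> * trig x a J \<xi>) \<le> norm ((\<Sum>j\<in>J. cmod (a j)) * cmod (h \<xi>))" for \<xi>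
    using mult_right_mono[OF norm_trig_le[of x a J \<xi>], of "cmod (h \<xi>)"]
    by (simp add: norm_mult mult.commute sum_nonneg)
  then show "integrable lborel (\<lambda>\<xi>. h \<xi> * trig x a J \<xi>)" "integrable lborel (\<lambda>\<xi>. h \<xi> * cnj (trig x a J \<xi>))"
    by (auto intro!: Bochner_Integration.integrable_bound[OF i] simp: norm_mult)
qed

lemma ft_mult_trig:
  assumes "integrable lborel w"
  shows "ft (\<lambda>\<xi>. w \<xi> * trig x a J \<xi>) t = (\<Sum>j\<in>J. ft w (t - x j) * a j)"
proof -
  have c: "cis ((t - x j) * \<xi>) = cis (t * \<xi>) * cis (- (x j * \<xi>))" for j \<xi>
    by (simp add: cis_mult left_diff_distrib)
  have "ft (\<lambda>\<xi>. w \<xi> * trig x a J \<xi>) t = (\<integral>\<xi>. (\<Sum>j\<in>J. w \<xi> * cis ((t - x j) * \<xi>) * a j) \<partial>lborel)"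
    unfolding ft_def trig_def c sum_distrib_left sum_distrib_right
    by (intro Bochner_Integration.integral_cong sum.cong refl) (simp only: ac_simps)
  also have "\<dots> = (\<Sum>j\<in>J. ft w (t - x j) * a j)"
    unfolding ft_def by (subst Bochner_Integration.integral_sum) (auto intro!: integrable_mult_cis assms)
  finally show ?thesis .
qed

text \<open>Sampling \<open>ft h\<close> at \<open>x k\<close> is pairing \<open>h\<close> with the
  \<open>k\<close>-th exponential. This translates interpolation conditions into orthogonality on
  the frequency side.\<close>

lemma sum_cnj_ft:
  assumes "integrable lborel h"
  shows "(\<Sum>k\<in>S. cnj (d k) * ft h (x k)) = (\<integral>\<xi>. h \<xi> * cnj (trig x d S \<xi>) \<partial>lborel)"
proof -
  have "(\<integral>\<xi>. h \<xi> * cnj (trig x d S \<xi>) \<partial>lborel) = (\<integral>\<xi>. (\<Sum>k\<in>S. cnj (d k) * (h \<xi> * cis (x k * \<xi>))) \<partial>lborel)"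
    unfolding trig_def
    by (intro Bochner_Integration.integral_cong refl) (simp add: sum_distrib_left cis_cnj ac_simps)
  also have "\<dots> = (\<Sum>k\<in>S. cnj (d k) * ft h (x k))"
    unfolding ft_def by (subst Bochner_Integration.integral_sum) (auto intro!: integrable_mult_cis assms)
  finally show ?thesis by simp
qed

text \<open>The fixed majorant, for \<open>\<lambda> \<le> 1\<close>, of the weights \<open>gweight \<lambda>\<close> outside the band.\<close>

definition vweight :: "real \<Rightarrow> real" where
  "vweight \<xi> = min 1 (exp ((pi\<^sup>2 - \<xi>\<^sup>2) / 4))"

lemma vweight_measurable [measurable]: "vweight \<in> borel_measurable borel"
  unfolding vweight_def[abs_def] by measurable

lemma vweight_pos [simp]: "0 < vweight \<xi>" and vweight_le_1 [simp]: "vweight \<xi> \<le> 1"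
  by (auto simp: vweight_def)

lemma vweight_nonneg [simp]: "0 \<le> vweight \<xi>"
  using vweight_pos[of \<xi>] by linarith

lemma in_band_iff: "\<xi> \<in> {-pi..pi} \<longleftrightarrow> \<xi>\<^sup>2 \<le> pi\<^sup>2"
  using abs_le_square_iff[of \<xi> pi] by (auto simp: abs_le_iff)

lemma vweight_in: "\<xi> \<in> {-pi..pi} \<Longrightarrow> vweight \<xi> = 1"
  unfolding in_band_iff by (simp add: vweight_def)

lemma vweight_out: "\<xi> \<notin> {-pi..pi} \<Longrightarrow> vweight \<xi> = exp ((pi\<^sup>2 - \<xi>\<^sup>2) / 4)"
  unfolding in_band_iff by (simp add: vweight_def)

lemma vweight_integrable: "integrable lborel vweight"
proof (rule Bochner_Integration.integrable_bound)
  show "integrable lborel (\<lambda>\<xi>. exp (pi\<^sup>2 / 4) * exp (- (1/4) * (\<xi> - 0)\<^sup>2))"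
    by (intro integrable_mult_right gaussian_integrable) simp
  have "vweight \<xi> \<le> exp (pi\<^sup>2 / 4) * exp (- (1/4) * (\<xi> - 0)\<^sup>2)" for \<xi>
    by (simp add: vweight_def exp_add[symmetric] field_simps)
  then show "AE \<xi> in lborel. norm (vweight \<xi>) \<le> norm (exp (pi\<^sup>2 / 4) * exp (- (1/4) * (\<xi> - 0)\<^sup>2))"
    by simp
qed measurable

lemma sqrt_vweight_L2: "(\<lambda>\<xi>. complex_of_real (sqrt (vweight \<xi>))) \<in> L2_space lborel"
  by (rule L2_spaceI) (auto simp: vweight_integrable)

text \<open>The form in which the Riesz basis enters: two-sided norm equivalence on finite sums,
  with one constant, and approximation of every function on the band by finite sums.\<close>

locale riesz_exponentials =
  fixes x :: "int \<Rightarrow> real" and B :: real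
  assumes B: "0 < B"
    and upper: "\<And>J a. finite J \<Longrightarrow> L2_norm band (trig x a J) \<le> B * l2_on a J"
    and lower: "\<And>J a. finite J \<Longrightarrow> l2_on a J \<le> B * L2_norm band (trig x a J)"
    and dense: "\<And>h. h \<in> L2_space band \<Longrightarrow>
      \<exists>a. L2_tendsto band (\<lambda>J. trig x a J) h (finite_subsets_at_top UNIV)"

lemma riesz_basis_sequence_exponentials:
  assumes "riesz_basis_sequence x"
  obtains B where "riesz_exponentials x B"
proof -
  let ?e = "\<lambda>j t. exp (- \<i> * complex_of_real (x j * t))"
  have e: "(\<Sum>j\<in>J. a j * ?e j t) = trig x a J t" for a J t
    by (simp add: trig_def cis_conv_exp)
  have rb: "riesz_basis band ?e" using assms by (simp add: riesz_basis_sequence_def)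
  have hs: "has_L2_sum band ?e a h \<longleftrightarrow> L2_tendsto band (\<lambda>J. trig x a J) h (finite_subsets_at_top UNIV)" for a h
    unfolding has_L2_sum_def e ..
  obtain B where B: "B > 0" and BB: "\<And>c. square_summable c \<Longrightarrow> \<exists>h. has_L2_sum band ?e c h \<and>
             inverse B * l2_norm c \<le> L2_norm band h \<and> L2_norm band h \<le> B * l2_norm c"
    using rb unfolding riesz_basis_def by blast
  have fin: "inverse B * l2_on a J \<le> L2_norm band (trig x a J) \<and> L2_norm band (trig x a J) \<le> B * l2_on a J"
    if J: "finite J" for J a
  proof -
    \<comment> \<open>Padding by zero: along finite sets containing \<open>J\<close> the partial
      sums are constantly \<open>trig x a J\<close>, so this function is at distance
      \<open>0\<close> from \<open>h\<close> and has the same norm.\<close>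
    define c where "c j = (if j \<in> J then a j else 0)" for j
    have sq: "((\<lambda>j. (cmod (c j))\<^sup>2) has_sum (\<Sum>j\<in>J. (cmod (a j))\<^sup>2)) UNIV"
      using has_sum_finite[OF J, of "\<lambda>j. (cmod (a j))\<^sup>2"]
      by (rule has_sum_cong_neutral[THEN iffD1, rotated -1]) (auto simp: c_def)
    then have c: "square_summable c" unfolding square_summable_def by (rule has_sum_imp_summable)
    have cn: "l2_norm c = l2_on a J"
      using infsumI[OF sq] by (simp add: l2_norm_def L2_set_def)
    obtain h where h: "has_L2_sum band ?e c h" and b: "inverse B * l2_norm c \<le> L2_norm band h" "L2_norm band h \<le> B * l2_norm c"
      using BB[OF c] by blast
    have hL: "h \<in> L2_space band" and
      lim: "((\<lambda>S. L2_norm band (\<lambda>t. trig x c S t - h t)) \<longlongrightarrow> 0) (finite_subsets_at_top UNIV)"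
      using h unfolding hs L2_tendsto_def by auto
    have "\<forall>\<^sub>F S in finite_subsets_at_top UNIV. L2_norm band (\<lambda>t. trig x c S t - h t) = L2_norm band (\<lambda>t. trig x a J t - h t)"
      unfolding eventually_finite_subsets_at_top
    proof (intro exI conjI allI impI)
      show "finite J" by fact
      fix S assume S: "finite S \<and> J \<subseteq> S \<and> S \<subseteq> UNIV"
      have "trig x c S t = trig x a J t" for t
        unfolding trig_def using S by (intro sum.mono_neutral_cong_right) (auto simp: c_def)
      then show "L2_norm band (\<lambda>t. trig x c S t - h t) = L2_norm band (\<lambda>t. trig x a J t - h t)" by simp
    qed simp
    then have "((\<lambda>S. L2_norm band (\<lambda>t. trig x a J t - h t)) \<longlongrightarrow> 0) (finite_subsets_at_top (UNIV :: int set))"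
      by (rule Lim_transform_eventually[OF lim])
    then have z: "L2_norm band (\<lambda>t. trig x a J t - h t) = 0"
      by (simp add: tendsto_const_iff)
    have "L2_norm band (trig x a J) = L2_norm band h"
      using L2_norm_triangle_sub[OF trig_L2_band hL, of x a J] L2_norm_triangle_sub[OF hL trig_L2_band, of x a J]
      by (simp add: z L2_norm_minus_commute[of band h])
    then show ?thesis using b cn by simp
  qed
  have "riesz_exponentials x B"
  proof
    show "0 < B" by (rule B)
    show "L2_norm band (trig x a J) \<le> B * l2_on a J" if "finite J" for J a
      using fin[OF that] by blast
    show "l2_on a J \<le> B * L2_norm band (trig x a J)" if "finite J" for J a
    proof -
      have "inverse B * l2_on a J \<le> L2_norm band (trig x a J)" using fin[OF that] by blast
      then show ?thesis using B by (simp add: field_simps)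
    qed
    show "\<exists>a. L2_tendsto band (\<lambda>J. trig x a J) h (finite_subsets_at_top UNIV)" if "h \<in> L2_space band" for h
    proof -
      have "\<exists>!a. square_summable a \<and> has_L2_sum band ?e a h"
        using rb that unfolding riesz_basis_def by blast
      then show ?thesis unfolding hs by blast
    qed
  qed
  then show ?thesis by (rule that)
qed

section \<open>A weighted Bessel inequality on the whole line\<close>

text \<open>For \<open>n \<ge> 1\<close>, inserting
  \<open>\<bar>\<xi>\<bar> \<ge> (2 * n - 1) * pi\<close> bounds the exponent of the weight by
  \<open>pi\<^sup>2 * n * (1 - n)\<close>, hence by \<open>1 - n\<close>. For \<open>n = 0\<close>
  the bound \<open>exp 1\<close> exceeds \<open>1\<close>, the maximum of the weight.\<close>

lemma vweight_le_exp:
  assumes "2 * pi * real n - pi \<le> \<bar>\<xi>\<bar>"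
  shows "vweight \<xi> \<le> exp (1 - real n)"
proof (cases "n = 0")
  case True
  then show ?thesis using vweight_le_1[of \<xi>] by (simp add: order_trans[of _ 1])
next
  case False
  then have n: "real n \<ge> 1" by simp
  have "0 \<le> (2 * real n - 1) * pi" using n by simp
  moreover have "(2 * real n - 1) * pi \<le> \<bar>\<xi>\<bar>" using assms by (simp add: algebra_simps)
  ultimately have sq: "((2 * real n - 1) * pi)\<^sup>2 \<le> \<xi>\<^sup>2"
    using power_mono[of "(2 * real n - 1) * pi" "\<bar>\<xi>\<bar>" 2] by simp
  define p where "p = pi\<^sup>2 * real n"
  define q where "q = pi\<^sup>2 * (real n * real n)"
  have a: "((2 * real n - 1) * pi)\<^sup>2 = 4 * q - 4 * p + pi\<^sup>2"
    by (simp add: p_def q_def power2_eq_square algebra_simps)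
  have eq: "pi\<^sup>2 * (real n * (1 - real n)) = p - q"
    by (simp add: p_def q_def algebra_simps)
  have "(pi\<^sup>2 - \<xi>\<^sup>2) / 4 \<le> pi\<^sup>2 * (real n * (1 - real n))"
    using sq unfolding eq a by (simp add: field_simps)
  also have "\<dots> \<le> 1 * (1 - real n)"
  proof -
    have "1 \<le> pi\<^sup>2 * real n"
      using n pi_gt3 mult_mono[of 1 "pi\<^sup>2" 1 "real n"] one_le_power[of pi 2] by simp
    then have "(pi\<^sup>2 * real n) * (1 - real n) \<le> 1 * (1 - real n)"
      using n by (intro mult_right_mono_neg) auto
    then show ?thesis by (simp add: mult.assoc)
  qed
  finally show ?thesis by (simp add: vweight_def min_le_iff_disj)
qed

context riesz_exponentials
begin

lemma trig_window:
  assumes J: "finite J"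
  shows "(\<integral>\<^sup>+\<xi>. ennreal ((cmod (trig x a J \<xi>))\<^sup>2) * indicator {s - pi..s + pi} \<xi> \<partial>lborel)
    \<le> ennreal (B\<^sup>2 * (l2_on a J)\<^sup>2)"
proof -
  \<comment> \<open>A translation only multiplies the coefficients by unimodular factors.\<close>
  define a' where "a' j = a j * cis (- (x j * s))" for j
  have sh: "trig x a J (s + 1 * \<xi>) = trig x a' J \<xi>" for \<xi>
    by (simp add: trig_def a'_def mult.assoc cis_mult algebra_simps)
  have "(\<integral>\<^sup>+\<xi>. ennreal ((cmod (trig x a J \<xi>))\<^sup>2) * indicator {s - pi..s + pi} \<xi> \<partial>lborel)
     = (\<integral>\<^sup>+\<xi>. ennreal ((cmod (trig x a J (s + 1 * \<xi>)))\<^sup>2) * indicator {s - pi..s + pi} (s + 1 * \<xi>) \<partial>lborel)"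
    by (subst nn_integral_real_affine[where c = 1 and t = s]) auto
  also have "\<dots> = (\<integral>\<^sup>+\<xi>. ennreal (indicator {-pi..pi} \<xi> *\<^sub>R (cmod (trig x a' J \<xi>))\<^sup>2) \<partial>lborel)"
    unfolding sh by (intro nn_integral_cong) (auto simp: indicator_def)
  also have "\<dots> = ennreal (\<integral>\<xi>. indicator {-pi..pi} \<xi> *\<^sub>R (cmod (trig x a' J \<xi>))\<^sup>2 \<partial>lborel)"
    using L2_space_integrable[OF trig_L2_band[of x a' J]] unfolding integrable_band
    by (intro nn_integral_eq_integral) auto
  also have "\<dots> = ennreal ((L2_norm band (trig x a' J))\<^sup>2)"
    by (simp only: L2_norm_power2 integral_band)
  also have "\<dots> \<le> ennreal ((B * l2_on a' J)\<^sup>2)"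
    by (intro ennreal_leI power_mono upper J) simp
  also have "l2_on a' J = l2_on a J" by (simp add: a'_def norm_mult)
  finally show ?thesis by (simp add: power_mult_distrib)
qed

text \<open>The line is covered by windows of length \<open>2 * pi\<close> centred at the multiples
  of \<open>2 * pi\<close>. On each window the upper Riesz inequality holds with the same constant,
  and the weight decays geometrically in the window index.\<close>

lemma vweight_bessel:
  obtains Om where "0 < Om"
    "\<And>J a. finite J \<Longrightarrow> (\<lambda>\<xi>. of_real (sqrt (vweight \<xi>)) * trig x a J \<xi>) \<in> L2_space lborel"
    "\<And>J a. finite J \<Longrightarrow> L2_norm lborel (\<lambda>\<xi>. of_real (sqrt (vweight \<xi>)) * trig x a J \<xi>) \<le> Om * l2_on a J"
proof -
  define W where "W = (\<Sum>n. exp (1 - real n))"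
  have summ: "summable (\<lambda>n. exp (1 - real n))"
  proof -
    have "summable (\<lambda>n. exp 1 * exp (-1) ^ n :: real)"
      by (intro summable_mult summable_geometric) simp
    then show ?thesis by (simp add: exp_diff exp_minus power_inverse exp_of_nat_mult[symmetric] divide_inverse)
  qed
  have W: "0 < W" unfolding W_def by (rule suminf_pos[OF summ]) simp
  \<comment> \<open>\<open>W\<close> sums the weight bounds over the windows on one side, and the
    factor \<open>2\<close> accounts for both sides; the central window is counted twice.\<close>
  define Om where "Om = sqrt (2 * W * B\<^sup>2)"
  have bound: "(\<integral>\<^sup>+\<xi>. ennreal ((cmod (of_real (sqrt (vweight \<xi>)) * trig x a J \<xi>))\<^sup>2) \<partial>lborel) \<le> ennreal ((Om * l2_on a J)\<^sup>2)"
    if J: "finite J" for a J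
  proof -
    let ?T = "\<lambda>\<xi>. ennreal ((cmod (trig x a J \<xi>))\<^sup>2)"
    let ?s = "\<lambda>n. 2 * pi * real n"
    let ?f = "\<lambda>n \<xi>. ennreal (exp (1 - real n)) * (?T \<xi> * indicator {?s n - pi..?s n + pi} \<xi> + ?T \<xi> * indicator {- ?s n - pi..- ?s n + pi} \<xi>)"
    have "(\<integral>\<^sup>+\<xi>. ennreal ((cmod (of_real (sqrt (vweight \<xi>)) * trig x a J \<xi>))\<^sup>2) \<partial>lborel) \<le> (\<integral>\<^sup>+\<xi>. (\<Sum>n. ?f n \<xi>) \<partial>lborel)"
    proof (intro nn_integral_mono)
      fix \<xi> :: real
      \<comment> \<open>The index of the window containing the modulus of \<open>\<xi>\<close>; the
        sign of \<open>\<xi>\<close> decides between the windows centred at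
        \<open>2 * pi * n\<close> and at its negative.\<close>
      define n where "n = nat \<lfloor>(\<bar>\<xi>\<bar> + pi) / (2 * pi)\<rfloor>"
      have "0 \<le> (\<bar>\<xi>\<bar> + pi) / (2 * pi)" by simp
      then have n: "real n \<le> (\<bar>\<xi>\<bar> + pi) / (2 * pi)" "(\<bar>\<xi>\<bar> + pi) / (2 * pi) < real n + 1"
        unfolding n_def by (simp_all add: of_nat_nat)
      then have n1: "?s n - pi \<le> \<bar>\<xi>\<bar>" and n2: "\<bar>\<xi>\<bar> \<le> ?s n + pi"
        by (simp_all add: field_simps)
      have v: "vweight \<xi> \<le> exp (1 - real n)" by (rule vweight_le_exp[OF n1])
      have "ennreal ((cmod (of_real (sqrt (vweight \<xi>)) * trig x a J \<xi>))\<^sup>2) = ennreal (vweight \<xi>) * ?T \<xi>"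
        by (simp add: norm_mult power_mult_distrib ennreal_mult)
      also have "\<dots> \<le> ennreal (exp (1 - real n)) * ?T \<xi>"
        by (intro mult_right_mono ennreal_leI v) simp
      also have "\<dots> \<le> ?f n \<xi>"
      proof (intro mult_left_mono)
        consider "\<xi> \<in> {?s n - pi..?s n + pi}" | "\<xi> \<in> {- ?s n - pi..- ?s n + pi}"
          using n1 n2 by (cases "\<xi> \<ge> 0") auto
        then show "?T \<xi> \<le> ?T \<xi> * indicator {?s n - pi..?s n + pi} \<xi> + ?T \<xi> * indicator {- ?s n - pi..- ?s n + pi} \<xi>"
          by cases simp_all
      qed simp
      also have "\<dots> \<le> (\<Sum>n. ?f n \<xi>)"
        using sum_le_suminf[of "\<lambda>n. ?f n \<xi>" "{n}"] by simp
      finally show "ennreal ((cmod (of_real (sqrt (vweight \<xi>)) * trig x a J \<xi>))\<^sup>2) \<le> (\<Sum>n. ?f n \<xi>)" .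
    qed
    also have "\<dots> = (\<Sum>n. \<integral>\<^sup>+\<xi>. ?f n \<xi> \<partial>lborel)"
      by (rule nn_integral_suminf) measurable
    also have "\<dots> \<le> (\<Sum>n. ennreal (exp (1 - real n) * (2 * (B\<^sup>2 * (l2_on a J)\<^sup>2))))"
    proof (intro suminf_le)
      fix n
      have "(\<integral>\<^sup>+\<xi>. ?f n \<xi> \<partial>lborel) = ennreal (exp (1 - real n)) *
        ((\<integral>\<^sup>+\<xi>. ?T \<xi> * indicator {?s n - pi..?s n + pi} \<xi> \<partial>lborel) + (\<integral>\<^sup>+\<xi>. ?T \<xi> * indicator {- ?s n - pi..- ?s n + pi} \<xi> \<partial>lborel))"
        by (simp add: nn_integral_cmult nn_integral_add)
      also have "\<dots> \<le> ennreal (exp (1 - real n)) * (ennreal (B\<^sup>2 * (l2_on a J)\<^sup>2) + ennreal (B\<^sup>2 * (l2_on a J)\<^sup>2))"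
        by (intro mult_left_mono add_mono trig_window J) simp
      also have "\<dots> = ennreal (exp (1 - real n) * (2 * (B\<^sup>2 * (l2_on a J)\<^sup>2)))"
        by (simp add: ennreal_plus[symmetric] ennreal_mult'[symmetric] del: ennreal_plus)
      finally show "(\<integral>\<^sup>+\<xi>. ?f n \<xi> \<partial>lborel) \<le> ennreal (exp (1 - real n) * (2 * (B\<^sup>2 * (l2_on a J)\<^sup>2)))" .
    qed simp_all
    also have "\<dots> = ennreal (\<Sum>n. exp (1 - real n) * (2 * (B\<^sup>2 * (l2_on a J)\<^sup>2)))"
      by (rule suminf_ennreal2) (auto intro: summable_mult2 summ)
    also have "(\<Sum>n. exp (1 - real n) * (2 * (B\<^sup>2 * (l2_on a J)\<^sup>2))) = (Om * l2_on a J)\<^sup>2"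
      using W by (simp add: suminf_mult2[OF summ, symmetric] W_def[symmetric] Om_def power_mult_distrib)
    finally show ?thesis .
  qed
  have L: "(\<lambda>\<xi>. of_real (sqrt (vweight \<xi>)) * trig x a J \<xi>) \<in> L2_space lborel" if "finite J" for a J
  proof (rule L2_spaceI)
    show "integrable lborel (\<lambda>\<xi>. (cmod (of_real (sqrt (vweight \<xi>)) * trig x a J \<xi>))\<^sup>2)"
      using order.strict_trans1[OF bound[OF that, of a], of \<infinity>] by (intro integrableI_nonneg) auto
  qed measurable
  show ?thesis
  proof (rule that[of Om])
    show "0 < Om" using W B by (simp add: Om_def)
    show "L2_norm lborel (\<lambda>\<xi>. of_real (sqrt (vweight \<xi>)) * trig x a J \<xi>) \<le> Om * l2_on a J" if J: "finite J" for J a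
    proof -
      let ?g = "\<lambda>\<xi>. of_real (sqrt (vweight \<xi>)) * trig x a J \<xi>"
      have "ennreal ((L2_norm lborel ?g)\<^sup>2) = (\<integral>\<^sup>+\<xi>. ennreal ((cmod (?g \<xi>))\<^sup>2) \<partial>lborel)"
        unfolding L2_norm_power2 by (rule nn_integral_eq_integral[symmetric]) (use L[OF J] in auto)
      also have "\<dots> \<le> ennreal ((Om * l2_on a J)\<^sup>2)" by (rule bound[OF J])
      finally have "(L2_norm lborel ?g)\<^sup>2 \<le> (Om * l2_on a J)\<^sup>2"
        by (simp only: ennreal_le_iff zero_le_power2)
      moreover have "0 \<le> Om * l2_on a J" using W B by (simp add: Om_def)
      ultimately show ?thesis by (simp add: power2_le_iff_abs_le)
    qed
  qed (use L in auto)
qed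

end

section \<open>The Gaussian interpolation matrix\<close>

text \<open>
  \<open>gscale l * gweight l\<close> is the inverse-transform density of \<open>t \<mapsto> exp (- l * t\<^sup>2)\<close>, normalised so
  that \<open>gweight l (\<plusminus> pi) = 1\<close>.
\<close>

definition gweight :: "real \<Rightarrow> real \<Rightarrow> real" where
  "gweight l \<xi> = exp ((pi\<^sup>2 - \<xi>\<^sup>2) / (4 * l))"

definition gscale :: "real \<Rightarrow> real" where
  "gscale l = 1 / (exp (pi\<^sup>2 / (4 * l)) * sqrt (4 * pi * l))"

lemma gscale_pos: "0 < l \<Longrightarrow> 0 < gscale l"
  by (simp add: gscale_def)

lemma gweight_pos [simp]: "0 < gweight l \<xi>" and gweight_nonneg [simp]: "0 \<le> gweight l \<xi>"
  by (simp_all add: gweight_def)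

lemma gweight_measurable [measurable]: "gweight l \<in> borel_measurable borel"
  unfolding gweight_def[abs_def] by measurable

lemma gweight_eq: "gweight l \<xi> = exp (pi\<^sup>2 / (4 * l)) * exp (- (1 / (4 * l)) * \<xi>\<^sup>2)"
  by (simp add: gweight_def exp_add[symmetric] diff_divide_distrib)

lemma gweight_integrable:
  assumes "0 < l" shows "integrable lborel (gweight l)"
proof -
  have "integrable lborel (\<lambda>\<xi>. exp (pi\<^sup>2 / (4 * l)) * exp (- (1 / (4 * l)) * (\<xi> - 0)\<^sup>2))"
    using assms by (intro integrable_mult_right gaussian_integrable) simp
  then show ?thesis by (simp add: gweight_eq[abs_def])
qed

lemma ft_gweight:
  assumes "0 < l"
  shows "ft (\<lambda>\<xi>. of_real (gweight l \<xi>)) t = of_real (exp (- l * t\<^sup>2) / gscale l)"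
proof -
  have "ft (\<lambda>\<xi>. of_real (gweight l \<xi>)) t
      = of_real (exp (pi\<^sup>2 / (4 * l))) * ft (\<lambda>\<xi>. of_real (exp (- (1 / (4 * l)) * \<xi>\<^sup>2))) t"
    unfolding ft_def gweight_eq of_real_mult mult.assoc by simp
  also have "\<dots> = of_real (exp (- l * t\<^sup>2) / gscale l)"
    using assms by (subst gaussian_ft) (simp_all add: gscale_def mult.commute mult.left_commute)
  finally show ?thesis .
qed

lemma gweight_in:
  assumes "0 < l" "\<xi> \<in> {-pi..pi}" shows "1 \<le> gweight l \<xi>"
  using assms unfolding in_band_iff by (simp add: gweight_def)

text \<open>Outside the band the exponent is negative, so a smaller \<open>l\<close> means a smaller
  weight, and \<open>l = 1\<close> gives \<open>vweight\<close>. This comparison carries no factor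
  depending on \<open>l\<close>, which is why the error estimate can use it.\<close>

lemma gweight_out:
  assumes "0 < l" "l \<le> 1" "\<xi> \<notin> {-pi..pi}" shows "gweight l \<xi> \<le> vweight \<xi>"
proof -
  have neg: "pi\<^sup>2 - \<xi>\<^sup>2 \<le> 0" using assms(3) unfolding in_band_iff by simp
  have "1 / 4 \<le> 1 / (4 * l)" using assms by (simp add: field_simps)
  then have "(1 / (4 * l)) * (pi\<^sup>2 - \<xi>\<^sup>2) \<le> (1 / 4) * (pi\<^sup>2 - \<xi>\<^sup>2)"
    using neg by (rule mult_right_mono_neg)
  then show ?thesis unfolding vweight_out[OF assms(3)] gweight_def by simp
qed

text \<open>The factor is the maximum of the weight, attained at the origin. It is unbounded as
  \<open>l\<close> tends to \<open>0\<close>, so this comparison serves only at a fixed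
  \<open>l\<close>.\<close>

lemma gweight_le:
  assumes "0 < l" "l \<le> 1" shows "gweight l \<xi> \<le> exp (pi\<^sup>2 / (4 * l)) * vweight \<xi>"
proof (cases "\<xi> \<in> {-pi..pi}")
  case True
  have "exp (pi\<^sup>2 / (4 * l)) * exp (- (1 / (4 * l)) * \<xi>\<^sup>2) \<le> exp (pi\<^sup>2 / (4 * l)) * 1"
    using assms by (intro mult_left_mono) auto
  then show ?thesis unfolding gweight_eq vweight_in[OF True] .
next
  case False
  have "1 * vweight \<xi> \<le> exp (pi\<^sup>2 / (4 * l)) * vweight \<xi>"
    using assms by (intro mult_right_mono) auto
  then show ?thesis using gweight_out[OF assms False] by linarith
qed

text \<open>A cofinal sequence of finite sets, through which limits over all finite sets become the
  sequential limits required by Fatou's lemma.\<close>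

lemma symmetric_intervals_at_top:
  "filterlim (\<lambda>n. {- int n..int n}) (finite_subsets_at_top UNIV) sequentially"
  unfolding filterlim_finite_subsets_at_top
proof (intro allI impI)
  fix X :: "int set" assume X: "finite X \<and> X \<subseteq> UNIV"
  then have "bdd_above (abs ` X)" by (intro bdd_above_finite) simp
  then obtain M where M: "\<And>j. j \<in> X \<Longrightarrow> \<bar>j\<bar> \<le> M"
    unfolding bdd_above_def by auto
  show "\<forall>\<^sub>F n in sequentially. finite {- int n..int n} \<and> X \<subseteq> {- int n..int n} \<and> {- int n..int n} \<subseteq> UNIV"
    using eventually_ge_at_top[of "nat M"]
  proof eventually_elim
    case (elim n)
    then have "M \<le> int n" by simp
    then show ?case using M by force
  qed
qed

text \<open>\<open>Om\<close> is a parameter rather than obtained inside, so that one value can be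
  fixed before \<open>l\<close> is chosen.\<close>

locale gaussian_setup = riesz_exponentials +
  fixes Om l :: real
  assumes Om: "0 < Om"
    and vtrig_L2: "\<And>J a. finite J \<Longrightarrow> (\<lambda>\<xi>. of_real (sqrt (vweight \<xi>)) * trig x a J \<xi>) \<in> L2_space lborel"
    and vtrig_norm: "\<And>J a. finite J \<Longrightarrow> L2_norm lborel (\<lambda>\<xi>. of_real (sqrt (vweight \<xi>)) * trig x a J \<xi>) \<le> Om * l2_on a J"
    and l: "0 < l" "l \<le> 1"
begin

abbreviation W :: "real \<Rightarrow> complex" where "W \<xi> \<equiv> of_real (gweight l \<xi>)"

definition peak :: real where "peak = exp (pi\<^sup>2 / (4 * l))"

definition V :: real where "V = L2_norm lborel (\<lambda>\<xi>. complex_of_real (sqrt (vweight \<xi>)))"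

text \<open>The maximum with \<open>1 / B\<^sup>2\<close> secures the requirement
  \<open>\<alpha> \<le> K\<close> of \<open>coercive_matrix\<close>.\<close>

definition form_const :: real where "form_const = max (peak * Om\<^sup>2) (1 / B\<^sup>2)"

lemma peak_pos: "0 < peak" by (simp add: peak_def)

lemma V_nonneg: "0 \<le> V" by (simp add: V_def)

lemma W_integrable: "integrable lborel W"
  using gweight_integrable[OF l(1)] by (simp add: complex_of_real_integrable_eq)

lemma gweight_le_peak: "gweight l \<xi> \<le> peak * vweight \<xi>"
  unfolding peak_def by (rule gweight_le[OF l])

lemma vtrig_prod:
  assumes "finite J" "finite S"
  shows "integrable lborel (\<lambda>\<xi>. vweight \<xi> * (cmod (trig x c J \<xi>) * cmod (trig x d S \<xi>)))"
    and "(\<integral>\<xi>. vweight \<xi> * (cmod (trig x c J \<xi>) * cmod (trig x d S \<xi>)) \<partial>lborel) \<le> Om\<^sup>2 * l2_on c J * l2_on d S"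
proof -
  let ?f = "\<lambda>\<xi>. of_real (sqrt (vweight \<xi>)) * trig x c J \<xi>" and ?g = "\<lambda>\<xi>. of_real (sqrt (vweight \<xi>)) * trig x d S \<xi>"
  have e: "vweight \<xi> * (cmod (trig x c J \<xi>) * cmod (trig x d S \<xi>)) = cmod (?f \<xi> * ?g \<xi>)" for \<xi>
  proof -
    have "cmod (?f \<xi> * ?g \<xi>) = (sqrt (vweight \<xi>) * sqrt (vweight \<xi>)) * (cmod (trig x c J \<xi>) * cmod (trig x d S \<xi>))"
      by (simp only: norm_mult norm_of_real abs_of_nonneg[OF real_sqrt_ge_zero[OF vweight_nonneg]] ac_simps)
    then show ?thesis by simp
  qed
  show "integrable lborel (\<lambda>\<xi>. vweight \<xi> * (cmod (trig x c J \<xi>) * cmod (trig x d S \<xi>)))"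
    unfolding e by (intro integrable_norm L2_space_mult_integrable vtrig_L2 assms)
  have "(\<integral>\<xi>. cmod (?f \<xi> * ?g \<xi>) \<partial>lborel) \<le> L2_norm lborel ?f * L2_norm lborel ?g"
    by (intro L2_cauchy_schwarz_norm vtrig_L2 assms)
  also have "\<dots> \<le> (Om * l2_on c J) * (Om * l2_on d S)"
    using Om by (intro mult_mono vtrig_norm assms) auto
  finally show "(\<integral>\<xi>. vweight \<xi> * (cmod (trig x c J \<xi>) * cmod (trig x d S \<xi>)) \<partial>lborel) \<le> Om\<^sup>2 * l2_on c J * l2_on d S"
    unfolding e by (simp add: power2_eq_square ac_simps)
qed

text \<open>The Gaussian matrix is a Gram matrix: that of the exponentials in the space weighted by
  \<open>W\<close>.\<close>

lemma form_eq:
  assumes "finite J"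
  shows "(\<Sum>k\<in>S. cnj (d k) * (\<Sum>j\<in>J. ft W (x k - x j) * c j)) = (\<integral>\<xi>. W \<xi> * trig x c J \<xi> * cnj (trig x d S \<xi>) \<partial>lborel)"
  unfolding ft_mult_trig[OF W_integrable, symmetric]
  by (rule sum_cnj_ft[OF integrable_mult_trig(1)[OF W_integrable]])

lemma form_integrable:
  "integrable lborel (\<lambda>\<xi>. W \<xi> * trig x c J \<xi> * cnj (trig x d S \<xi>))"
  by (rule integrable_mult_trig(2)[OF integrable_mult_trig(1)[OF W_integrable]])

lemma energy_eq:
  "(\<integral>\<xi>. W \<xi> * trig x c J \<xi> * cnj (trig x c J \<xi>) \<partial>lborel) = of_real (\<integral>\<xi>. gweight l \<xi> * (cmod (trig x c J \<xi>))\<^sup>2 \<partial>lborel)"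
  and energy_integrable: "integrable lborel (\<lambda>\<xi>. gweight l \<xi> * (cmod (trig x c J \<xi>))\<^sup>2)"
proof -
  have e: "W \<xi> * trig x c J \<xi> * cnj (trig x c J \<xi>) = complex_of_real (gweight l \<xi> * (cmod (trig x c J \<xi>))\<^sup>2)" for \<xi>
    by (simp add: complex_norm_square mult.assoc del: of_real_power)
  show "(\<integral>\<xi>. W \<xi> * trig x c J \<xi> * cnj (trig x c J \<xi>) \<partial>lborel) = of_real (\<integral>\<xi>. gweight l \<xi> * (cmod (trig x c J \<xi>))\<^sup>2 \<partial>lborel)"
    unfolding e by (rule integral_complex_of_real)
  show "integrable lborel (\<lambda>\<xi>. gweight l \<xi> * (cmod (trig x c J \<xi>))\<^sup>2)"
    using form_integrable[of c J c J] unfolding e complex_of_real_integrable_eq .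
qed

text \<open>The part of the integral outside the band is dropped and the weight inside is replaced
  by \<open>1\<close>, so the lower Riesz inequality gives a constant free of
  \<open>l\<close>.\<close>

lemma energy_lower:
  assumes J: "finite J"
  shows "1 / B\<^sup>2 * (l2_on c J)\<^sup>2 \<le> (\<integral>\<xi>. gweight l \<xi> * (cmod (trig x c J \<xi>))\<^sup>2 \<partial>lborel)"
proof -
  have "(l2_on c J)\<^sup>2 \<le> (B * L2_norm band (trig x c J))\<^sup>2"
    by (intro power_mono lower J) simp
  then have "1 / B\<^sup>2 * (l2_on c J)\<^sup>2 \<le> (L2_norm band (trig x c J))\<^sup>2"
    using B by (simp add: power_mult_distrib field_simps)
  also have "\<dots> = (\<integral>\<xi>. indicator {-pi..pi} \<xi> *\<^sub>R (cmod (trig x c J \<xi>))\<^sup>2 \<partial>lborel)"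
    by (simp only: L2_norm_power2 integral_band)
  also have "\<dots> \<le> (\<integral>\<xi>. gweight l \<xi> * (cmod (trig x c J \<xi>))\<^sup>2 \<partial>lborel)"
  proof (rule integral_mono[OF _ energy_integrable])
    show "integrable lborel (\<lambda>\<xi>. indicator {-pi..pi} \<xi> *\<^sub>R (cmod (trig x c J \<xi>))\<^sup>2)"
      using L2_space_integrable[OF trig_L2_band[of x c J]] unfolding integrable_band .
    show "indicator {-pi..pi} \<xi> *\<^sub>R (cmod (trig x c J \<xi>))\<^sup>2 \<le> gweight l \<xi> * (cmod (trig x c J \<xi>))\<^sup>2" for \<xi>
      using mult_right_mono[OF gweight_in[OF l(1), of \<xi>], of "(cmod (trig x c J \<xi>))\<^sup>2"]
      by (cases "\<xi> \<in> {-pi..pi}") auto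
  qed
  finally show ?thesis .
qed

text \<open>The upper constant contains \<open>peak\<close> and degenerates with \<open>l\<close>,
  whereas the coercivity constant \<open>1 / B\<^sup>2\<close> does not.\<close>

sublocale cm: coercive_matrix "\<lambda>k j. ft W (x k - x j)" form_const "1 / B\<^sup>2"
proof
  show "0 < 1 / B\<^sup>2" using B by simp
  show "1 / B\<^sup>2 \<le> form_const" by (simp add: form_const_def)
  show "1 / B\<^sup>2 * (l2_on c J)\<^sup>2 \<le> Re (\<Sum>k\<in>J. cnj (c k) * (\<Sum>j\<in>J. ft W (x k - x j) * c j))" if "finite J" for J c
    unfolding form_eq[OF that] energy_eq using energy_lower[OF that] by simp
  show "cmod (\<Sum>k\<in>S. cnj (d k) * (\<Sum>j\<in>J. ft W (x k - x j) * c j)) \<le> form_const * l2_on d S * l2_on c J"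
    if S: "finite S" and J: "finite J" for S J c d
  proof -
    have "cmod (\<integral>\<xi>. W \<xi> * trig x c J \<xi> * cnj (trig x d S \<xi>) \<partial>lborel) \<le> (\<integral>\<xi>. cmod (W \<xi> * trig x c J \<xi> * cnj (trig x d S \<xi>)) \<partial>lborel)"
      by (rule integral_norm_bound)
    also have "\<dots> \<le> (\<integral>\<xi>. peak * (vweight \<xi> * (cmod (trig x c J \<xi>) * cmod (trig x d S \<xi>))) \<partial>lborel)"
    proof (rule integral_mono)
      show "cmod (W \<xi> * trig x c J \<xi> * cnj (trig x d S \<xi>)) \<le> peak * (vweight \<xi> * (cmod (trig x c J \<xi>) * cmod (trig x d S \<xi>)))" for \<xi>
        using mult_right_mono[OF gweight_le_peak[of \<xi>], of "cmod (trig x c J \<xi>) * cmod (trig x d S \<xi>)"]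
        by (simp add: norm_mult mult.assoc)
    qed (intro integrable_norm form_integrable integrable_mult_right vtrig_prod(1) J S)+
    also have "\<dots> = peak * (\<integral>\<xi>. vweight \<xi> * (cmod (trig x c J \<xi>) * cmod (trig x d S \<xi>)) \<partial>lborel)"
      by simp
    also have "\<dots> \<le> peak * (Om\<^sup>2 * l2_on c J * l2_on d S)"
      using peak_pos by (intro mult_left_mono vtrig_prod(2) J S) simp
    also have "\<dots> = (peak * Om\<^sup>2) * (l2_on d S * l2_on c J)" by simp
    also have "\<dots> \<le> form_const * (l2_on d S * l2_on c J)"
      by (intro mult_right_mono) (auto simp: form_const_def)
    finally show ?thesis unfolding form_eq[OF J] by (simp add: mult.assoc)
  qed
qed

lemma ft_W_trig_bound:
  assumes J: "finite J"
  shows "cmod (ft (\<lambda>\<xi>. W \<xi> * trig x a J \<xi>) t) \<le> peak * (V * (Om * l2_on a J))"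
proof -
  let ?g = "\<lambda>\<xi>. of_real (sqrt (vweight \<xi>)) * trig x a J \<xi>"
  have e: "vweight \<xi> * cmod (trig x a J \<xi>) = cmod (of_real (sqrt (vweight \<xi>)) * ?g \<xi>)" for \<xi>
  proof -
    have "cmod (of_real (sqrt (vweight \<xi>)) * ?g \<xi>) = (sqrt (vweight \<xi>) * sqrt (vweight \<xi>)) * cmod (trig x a J \<xi>)"
      by (simp only: norm_mult norm_of_real abs_of_nonneg[OF real_sqrt_ge_zero[OF vweight_nonneg]] ac_simps)
    then show ?thesis by simp
  qed
  have i: "integrable lborel (\<lambda>\<xi>. cmod (of_real (sqrt (vweight \<xi>)) * ?g \<xi>))"
    by (intro integrable_norm L2_space_mult_integrable sqrt_vweight_L2 vtrig_L2 J)
  have "cmod (ft (\<lambda>\<xi>. W \<xi> * trig x a J \<xi>) t) \<le> (\<integral>\<xi>. cmod (W \<xi> * trig x a J \<xi>) \<partial>lborel)"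
    by (rule norm_ft_le)
  also have "\<dots> \<le> (\<integral>\<xi>. peak * cmod (of_real (sqrt (vweight \<xi>)) * ?g \<xi>) \<partial>lborel)"
  proof (rule integral_mono)
    show "cmod (W \<xi> * trig x a J \<xi>) \<le> peak * cmod (of_real (sqrt (vweight \<xi>)) * ?g \<xi>)" for \<xi>
      unfolding e[symmetric] using mult_right_mono[OF gweight_le_peak[of \<xi>], of "cmod (trig x a J \<xi>)"]
      by (simp add: norm_mult mult.assoc)
  qed (intro integrable_norm integrable_mult_trig(1) W_integrable integrable_mult_right i)+
  also have "\<dots> = peak * (\<integral>\<xi>. cmod (of_real (sqrt (vweight \<xi>)) * ?g \<xi>) \<partial>lborel)" by simp
  also have "\<dots> \<le> peak * (V * L2_norm lborel ?g)"
    unfolding V_def using peak_pos by (intro mult_left_mono L2_cauchy_schwarz_norm sqrt_vweight_L2 vtrig_L2 J) simp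
  also have "\<dots> \<le> peak * (V * (Om * l2_on a J))"
    using peak_pos V_nonneg by (intro mult_left_mono vtrig_norm J) auto
  finally show ?thesis .
qed

section \<open>Translates of the Gaussian and the series they generate\<close>

text \<open>Dual to \<open>ft_W_trig_bound\<close>. The bound does not depend on \<open>t\<close>,
  which makes the series converge uniformly on the line and its sum continuous.\<close>

lemma translates_square_summable: "square_summable (\<lambda>j. ft W (t - x j))"
  and translates_l2_norm: "l2_norm (\<lambda>j. ft W (t - x j)) \<le> peak * (V * Om)"
proof -
  have *: "cmod (\<Sum>j\<in>J. cnj (c j) * ft W (t - x j)) \<le> peak * (V * Om) * l2_on c J" if "finite J" for c J
    using ft_W_trig_bound[OF that, of "\<lambda>j. cnj (c j)" t]
    by (simp add: ft_mult_trig[OF W_integrable] mult.commute mult.left_commute)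
  have "0 \<le> peak * (V * Om)" using peak_pos V_nonneg Om by simp
  note l2_norm_dual[OF * this]
  then show "square_summable (\<lambda>j. ft W (t - x j))" "l2_norm (\<lambda>j. ft W (t - x j)) \<le> peak * (V * Om)"
    by simp_all
qed

text \<open>The Gaussian series in the rescaled coefficients \<open>b = gscale l * a\<close>, for
  which the matrix of the interpolation problem becomes the one of \<open>cm\<close>.\<close>

definition series :: "(int \<Rightarrow> complex) \<Rightarrow> real \<Rightarrow> complex" where
  "series b t = (\<Sum>\<^sub>\<infinity>j. ft W (t - x j) * b j)"

lemma app_eq_series: "cm.app b k = series b (x k)"
  by (simp add: cm.app_def series_def)

lemma series_partial:
  assumes "square_summable b" "finite J"
  shows "cmod (series b t - ft (\<lambda>\<xi>. W \<xi> * trig x b J \<xi>) t) \<le> peak * (V * Om) * l2_norm (l2_cut b J)"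
proof -
  have "series b t - ft (\<lambda>\<xi>. W \<xi> * trig x b J \<xi>) t = (\<Sum>\<^sub>\<infinity>j. ft W (t - x j) * l2_cut b J j)"
    unfolding series_def ft_mult_trig[OF W_integrable]
    by (rule infsum_mult_minus_sum[OF translates_square_summable assms])
  also have "cmod \<dots> \<le> l2_norm (\<lambda>j. ft W (t - x j)) * l2_norm (l2_cut b J)"
    by (intro l2_cauchy_schwarz(2) translates_square_summable l2_cut_square_summable assms)
  also have "\<dots> \<le> peak * (V * Om) * l2_norm (l2_cut b J)"
    by (intro mult_right_mono translates_l2_norm) simp
  finally show ?thesis .
qed

lemma series_uniform_limit:
  assumes "square_summable b"
  shows "uniform_limit UNIV (\<lambda>J. ft (\<lambda>\<xi>. W \<xi> * trig x b J \<xi>)) (series b) (finite_subsets_at_top UNIV)"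
  unfolding uniform_limit_iff
proof (intro allI impI)
  fix e :: real assume e: "e > 0"
  have "((\<lambda>J. peak * (V * Om) * l2_norm (l2_cut b J)) \<longlongrightarrow> peak * (V * Om) * 0) (finite_subsets_at_top UNIV)"
    by (intro tendsto_intros l2_cut_tendsto assms)
  then have "\<forall>\<^sub>F J in finite_subsets_at_top UNIV. peak * (V * Om) * l2_norm (l2_cut b J) < e"
    using e by (simp add: order_tendsto_iff)
  moreover have "\<forall>\<^sub>F J :: int set in finite_subsets_at_top UNIV. finite J"
    by (rule eventually_finite_subsets_at_top_weakI)
  ultimately show "\<forall>\<^sub>F J in finite_subsets_at_top UNIV. \<forall>t\<in>UNIV. dist (ft (\<lambda>\<xi>. W \<xi> * trig x b J \<xi>) t) (series b t) < e"
  proof eventually_elim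
    case (elim J)
    then show ?case
      using series_partial[OF assms, of J] by (auto simp: dist_norm norm_minus_commute intro: order.strict_trans1)
  qed
qed

lemma series_limit:
  assumes "square_summable b"
  shows "(\<lambda>n. ft (\<lambda>\<xi>. W \<xi> * trig x b {- int n..int n} \<xi>) t) \<longlonglongrightarrow> series b t"
  using filterlim_compose[OF tendsto_uniform_limitI[OF series_uniform_limit[OF assms] UNIV_I] symmetric_intervals_at_top] .

lemma series_continuous:
  assumes "square_summable b"
  shows "continuous_on UNIV (series b)"
proof (rule uniform_limit_theorem[OF _ series_uniform_limit[OF assms]])
  have "continuous_on UNIV (ft (\<lambda>\<xi>. W \<xi> * trig x b J \<xi>))" for J
    unfolding ft_mult_trig[OF W_integrable, abs_def] ft_gweight[OF l(1)]
    by (intro continuous_intros) (use gscale_pos[OF l(1)] in auto)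
  then show "\<forall>\<^sub>F J in finite_subsets_at_top UNIV. continuous_on UNIV (ft (\<lambda>\<xi>. W \<xi> * trig x b J \<xi>))"
    by simp
qed simp

lemma series_measurable:
  assumes "square_summable b" shows "series b \<in> borel_measurable borel"
  by (rule borel_measurable_continuous_onI[OF series_continuous[OF assms]])

end

context gaussian_setup
begin

lemma form_const_pos: "0 < form_const"
  using cm.\<alpha> by linarith

lemma gaussian_series_eq:
  "gaussian_series x l a t = series (\<lambda>j. of_real (gscale l) * a j) t"
  unfolding gaussian_series_def series_def
proof (intro infsum_cong)
  fix j
  show "a j * complex_of_real (exp (- l * (t - x j)\<^sup>2)) = ft W (t - x j) * (of_real (gscale l) * a j)"
    unfolding ft_gweight[OF l(1)] using gscale_pos[OF l(1)] by simp
qed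

text \<open>The sections are transforms of \<open>W * trig\<close>, whose norms are bounded
  uniformly in the section. Plancherel's inequality bounds the transforms, and Fatou's lemma carries
  the bound to the sum.\<close>

lemma series_L2:
  assumes b: "square_summable b"
  shows "series b \<in> L2_space lborel"
proof (rule L2_spaceI)
  have [measurable]: "series b \<in> borel_measurable borel" by (rule series_measurable[OF b])
  show "series b \<in> borel_measurable lborel" by simp
  let ?J = "\<lambda>n. {- int n..int n}"
  let ?H = "\<lambda>n \<xi>. W \<xi> * trig x b (?J n) \<xi>"
  have Hint: "integrable lborel (?H n)" for n by (intro integrable_mult_trig W_integrable)
  have HL: "?H n \<in> L2_space lborel" and Hn: "L2_norm lborel (?H n) \<le> peak * (Om * l2_norm b)" for n
  proof -
    let ?g = "\<lambda>\<xi>. of_real peak * (of_real (sqrt (vweight \<xi>)) * trig x b (?J n) \<xi>)"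
    have g: "?g \<in> L2_space lborel" by (intro L2_space_cmult vtrig_L2) simp
    have le: "cmod (?H n \<xi>) \<le> cmod (?g \<xi>)" for \<xi>
    proof -
      \<comment> \<open>As \<open>vweight\<close> is at most \<open>1\<close>, it lies below its
        square root, which is the weight that the Bessel bound handles.\<close>
      have "vweight \<xi> * vweight \<xi> \<le> vweight \<xi> * 1" by (intro mult_left_mono) simp_all
      then have "vweight \<xi> \<le> sqrt (vweight \<xi>)"
        by (intro real_le_rsqrt) (simp add: power2_eq_square)
      then have "gweight l \<xi> \<le> peak * sqrt (vweight \<xi>)"
        using gweight_le_peak[of \<xi>] mult_left_mono[of "vweight \<xi>" "sqrt (vweight \<xi>)" peak] peak_pos by linarith
      from mult_right_mono[OF this, of "cmod (trig x b (?J n) \<xi>)"] show ?thesis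
        using peak_pos by (simp add: norm_mult mult.assoc)
    qed
    show HL: "?H n \<in> L2_space lborel"
      by (rule L2_space_mono[OF g, where C = 1]) (use Hint le in auto)
    have "(L2_norm lborel (?H n))\<^sup>2 \<le> (L2_norm lborel ?g)\<^sup>2"
      unfolding L2_norm_power2
      by (intro integral_mono power_mono le L2_space_integrable HL g) simp
    then have "L2_norm lborel (?H n) \<le> L2_norm lborel ?g"
      by (simp add: power2_le_iff_abs_le)
    also have "L2_norm lborel ?g = peak * L2_norm lborel (\<lambda>\<xi>. of_real (sqrt (vweight \<xi>)) * trig x b (?J n) \<xi>)"
      using peak_pos by (simp add: L2_norm_def norm_mult power_mult_distrib real_sqrt_mult)
    also have "\<dots> \<le> peak * (Om * l2_norm b)"
      using peak_pos Om l2_on_le_l2_norm[OF b, of "?J n"]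
      by (intro mult_left_mono order_trans[OF vtrig_norm]) auto
    finally show "L2_norm lborel (?H n) \<le> peak * (Om * l2_norm b)" .
  qed
  have "(\<integral>\<^sup>+t. ennreal ((cmod (series b t))\<^sup>2) \<partial>lborel) \<le> ennreal (2 * pi * (peak * (Om * l2_norm b))\<^sup>2)"
  proof (rule nn_integral_le_limit)
    show "(\<lambda>t. ennreal ((cmod (ft (?H n) t))\<^sup>2)) \<in> borel_measurable lborel" for n
      using ft_measurable[OF Hint] by measurable
    show "(\<lambda>n. ennreal ((cmod (ft (?H n) t))\<^sup>2)) \<longlonglongrightarrow> ennreal ((cmod (series b t))\<^sup>2)" for t
      by (intro tendsto_intros tendsto_ennrealI series_limit b)
    show "(\<integral>\<^sup>+t. ennreal ((cmod (ft (?H n) t))\<^sup>2) \<partial>lborel) \<le> ennreal (2 * pi * (peak * (Om * l2_norm b))\<^sup>2)" for n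
    proof (rule order_trans[OF plancherel_le[OF Hint HL]])
      show "ennreal (2 * pi * (\<integral>\<xi>. (cmod (?H n \<xi>))\<^sup>2 \<partial>lborel)) \<le> ennreal (2 * pi * (peak * (Om * l2_norm b))\<^sup>2)"
        unfolding L2_norm_power2[symmetric]
        by (intro ennreal_leI mult_left_mono power_mono Hn) simp_all
    qed
  qed simp
  then have "(\<integral>\<^sup>+t. ennreal ((cmod (series b t))\<^sup>2) \<partial>lborel) < \<infinity>"
    by (rule order.strict_trans1) simp
  then show "integrable lborel (\<lambda>t. (cmod (series b t))\<^sup>2)"
    by (intro integrableI_nonneg) simp_all
qed

text \<open>For square-summable coefficients, summability, continuity and square integrability are
  supplied by the results on \<open>series\<close>. What remains is the matrix equation, so
  injectivity of \<open>app\<close> gives uniqueness and its surjectivity existence.\<close>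

lemma is_gaussian_coeffs_iff:
  "is_gaussian_coeffs x l f a \<longleftrightarrow>
    square_summable (\<lambda>j. of_real (gscale l) * a j) \<and> cm.app (\<lambda>j. of_real (gscale l) * a j) = (\<lambda>k. f (x k))"
proof -
  let ?b = "\<lambda>j. of_real (gscale l) * a j"
  have k: "complex_of_real (gscale l) \<noteq> 0" using gscale_pos[OF l(1)] by simp
  have summ: "(\<lambda>j. a j * complex_of_real (exp (- l * (t - x j)\<^sup>2))) summable_on UNIV" if "square_summable ?b" for t
  proof -
    have "(\<lambda>j. ft W (t - x j) * ?b j) summable_on UNIV"
      by (rule l2_mult_summable[OF translates_square_summable that])
    then show ?thesis
      unfolding ft_gweight[OF l(1)] using gscale_pos[OF l(1)] by (simp add: mult.commute)
  qed
  have gs: "gaussian_series x l a = series ?b" by (rule ext) (rule gaussian_series_eq)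
  show ?thesis
  proof
    assume A: "is_gaussian_coeffs x l f a"
    show "square_summable ?b \<and> cm.app ?b = (\<lambda>k. f (x k))"
    proof
      show "square_summable ?b"
        by (rule l2_norm_cmult(1)) (use A in \<open>simp add: is_gaussian_coeffs_def\<close>)
      show "cm.app ?b = (\<lambda>k. f (x k))"
        using A unfolding is_gaussian_coeffs_def gs by (intro ext) (simp add: app_eq_series)
    qed
  next
    assume A: "square_summable ?b \<and> cm.app ?b = (\<lambda>k. f (x k))"
    then have b: "square_summable ?b" and app: "cm.app ?b = (\<lambda>k. f (x k))" by simp_all
    show "is_gaussian_coeffs x l f a"
      unfolding is_gaussian_coeffs_def gs
    proof (intro conjI allI)
      have "(\<lambda>j. inverse (of_real (gscale l)) * ?b j) = a"
        using k by (simp add: fun_eq_iff)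
      then show "square_summable a"
        using l2_norm_cmult(1)[OF b, of "inverse (of_real (gscale l))"] by simp
      show "series ?b (x k) = f (x k)" for k
        using fun_cong[OF app, of k] by (simp add: app_eq_series)
    qed (rule summ[OF b] series_continuous[OF b] series_L2[OF b])+
  qed
qed

lemma gaussian_interpolant_eq_series:
  assumes b: "square_summable b" "cm.app b = (\<lambda>k. f (x k))"
  shows "gaussian_interpolant x l f = series b"
proof -
  let ?k = "complex_of_real (gscale l)"
  have k: "?k \<noteq> 0" using gscale_pos[OF l(1)] by simp
  have "(THE a. is_gaussian_coeffs x l f a) = (\<lambda>j. b j / ?k)"
  proof (rule the_equality)
    show "is_gaussian_coeffs x l f (\<lambda>j. b j / ?k)"
      unfolding is_gaussian_coeffs_iff using b k by simp
    fix a assume "is_gaussian_coeffs x l f a"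
    then have "(\<lambda>j. ?k * a j) = b"
      unfolding is_gaussian_coeffs_iff using cm.app_inj[OF _ b(1)] b(2) by simp
    then show "a = (\<lambda>j. b j / ?k)" using k by auto
  qed
  then show ?thesis
    unfolding gaussian_interpolant_def using k by (intro ext) (simp add: gaussian_series_eq)
qed

end

section \<open>Error of the interpolant\<close>

locale gaussian_approximation = gaussian_setup +
  fixes F :: "real \<Rightarrow> complex"
  assumes F_L2: "F \<in> L2_space lborel" and F_int: "integrable lborel F"
    and F_supp: "\<And>\<xi>. \<xi> \<notin> {-pi..pi} \<Longrightarrow> F \<xi> = 0"
begin

text \<open>The quantity \<delta> of the energy inequality: the squared norm of \<open>F\<close> for
  the weight dual to \<open>gweight l\<close>.\<close>

definition defect :: real where
  "defect = (\<integral>\<xi>. (cmod (F \<xi>))\<^sup>2 / gweight l \<xi> \<partial>lborel)"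

lemma F_measurable [measurable]: "F \<in> borel_measurable borel"
  using F_int by auto

lemma F_band: "F \<in> L2_space band"
proof (rule L2_spaceI)
  show "F \<in> borel_measurable band" by (rule measurable_band) measurable
  have "indicator {-pi..pi} \<xi> *\<^sub>R (cmod (F \<xi>))\<^sup>2 = (cmod (F \<xi>))\<^sup>2" for \<xi>
    using F_supp[of \<xi>] by (cases "\<xi> \<in> {-pi..pi}") auto
  then show "integrable band (\<lambda>\<xi>. (cmod (F \<xi>))\<^sup>2)"
    unfolding integrable_band by (simp only: L2_space_integrable[OF F_L2])
qed

text \<open>By duality from the upper Riesz inequality, which applies because \<open>F\<close> is
  supported in the band.\<close>

lemma samples_square_summable: "square_summable (\<lambda>k. ft F (x k))"
proof (rule l2_norm_dual(1))
  show "0 \<le> L2_norm band F * B" using B by simp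
  fix c J assume J: "finite (J :: int set)"
  have "(\<Sum>k\<in>J. cnj (c k) * ft F (x k)) = (\<integral>\<xi>. F \<xi> * cnj (trig x c J \<xi>) \<partial>lborel)"
    by (rule sum_cnj_ft[OF F_int])
  also have "\<dots> = (\<integral>\<xi>. F \<xi> * cnj (trig x c J \<xi>) \<partial>band)"
    unfolding integral_band using F_supp by (intro Bochner_Integration.integral_cong) (auto simp: indicator_def)
  also have "cmod \<dots> \<le> L2_norm band F * L2_norm band (trig x c J)"
    using L2_cauchy_schwarz[OF F_band L2_space_cnj[OF trig_L2_band]] unfolding L2_norm_cnj .
  also have "\<dots> \<le> L2_norm band F * (B * l2_on c J)"
    by (intro mult_left_mono upper J) simp
  finally show "cmod (\<Sum>k\<in>J. cnj (c k) * ft F (x k)) \<le> L2_norm band F * B * l2_on c J"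
    by (simp add: mult.assoc)
qed

lemma defect_integrable: "integrable lborel (\<lambda>\<xi>. (cmod (F \<xi>))\<^sup>2 / gweight l \<xi>)"
proof (rule Bochner_Integration.integrable_bound)
  show "integrable lborel (\<lambda>\<xi>. (cmod (F \<xi>))\<^sup>2)" using F_L2 by simp
  have "(cmod (F \<xi>))\<^sup>2 / gweight l \<xi> \<le> (cmod (F \<xi>))\<^sup>2" for \<xi>
  proof (cases "\<xi> \<in> {-pi..pi}")
    case True
    then show ?thesis
      using mult_left_mono[OF gweight_in[OF l(1) True], of "(cmod (F \<xi>))\<^sup>2"] by (simp add: divide_le_eq)
  qed (simp add: F_supp)
  then show "AE \<xi> in lborel. norm ((cmod (F \<xi>))\<^sup>2 / gweight l \<xi>) \<le> norm ((cmod (F \<xi>))\<^sup>2)"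
    by simp
qed measurable

text \<open>The energy inequality for a finite section. The energy \<open>?Q\<close> differs from
  the pairing \<open>?P\<close> with the samples by the truncation error, and \<open>?P\<close> is
  at most half of \<open>defect\<close> plus half of \<open>?Q\<close>. Absorbing the latter half
  doubles both remaining terms.\<close>

lemma energy_upper:
  assumes b: "square_summable b" "cm.app b = (\<lambda>k. ft F (x k))" and J: "finite J"
  shows "1 / B\<^sup>2 * (l2_on b J)\<^sup>2 \<le> defect + 2 * (form_const * l2_norm (l2_cut b J) * l2_norm b)"
proof -
  let ?Q = "\<integral>\<xi>. gweight l \<xi> * (cmod (trig x b J \<xi>))\<^sup>2 \<partial>lborel"
  let ?P = "\<Sum>k\<in>J. cnj (b k) * ft F (x k)"
  have "Re ?P \<le> cmod (\<integral>\<xi>. F \<xi> * cnj (trig x b J \<xi>) \<partial>lborel)"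
    unfolding sum_cnj_ft[OF F_int] by (rule complex_Re_le_cmod)
  also have "\<dots> \<le> (\<integral>\<xi>. cmod (F \<xi> * cnj (trig x b J \<xi>)) \<partial>lborel)"
    by (rule integral_norm_bound)
  also have "\<dots> \<le> (\<integral>\<xi>. 1/2 * ((cmod (F \<xi>))\<^sup>2 / gweight l \<xi>) + 1/2 * (gweight l \<xi> * (cmod (trig x b J \<xi>))\<^sup>2) \<partial>lborel)"
  proof (rule integral_mono)
    fix \<xi> :: real
    \<comment> \<open>The square root of the weight is moved from one factor to the other before the
      product is split into squares.\<close>
    define g where "g = sqrt (gweight l \<xi>)"
    have g: "g > 0" "g\<^sup>2 = gweight l \<xi>" by (simp_all add: g_def)
    have "2 * (cmod (F \<xi>) / g) * (g * cmod (trig x b J \<xi>)) \<le> (cmod (F \<xi>) / g)\<^sup>2 + (g * cmod (trig x b J \<xi>))\<^sup>2"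
      by (rule sum_squares_bound)
    then show "cmod (F \<xi> * cnj (trig x b J \<xi>)) \<le> 1/2 * ((cmod (F \<xi>))\<^sup>2 / gweight l \<xi>) + 1/2 * (gweight l \<xi> * (cmod (trig x b J \<xi>))\<^sup>2)"
      using g(1) by (simp add: power_divide power_mult_distrib g(2) norm_mult)
  qed (intro integrable_norm integrable_mult_trig(2) F_int Bochner_Integration.integrable_add integrable_mult_right defect_integrable energy_integrable)+
  also have "\<dots> = 1/2 * defect + 1/2 * ?Q"
    unfolding defect_def
    by (subst Bochner_Integration.integral_add)
       (simp_all only: integral_mult_right_zero integrable_mult_right defect_integrable energy_integrable)
  finally have 1: "Re ?P \<le> 1/2 * defect + 1/2 * ?Q" .
  have "cmod (?P - (\<Sum>k\<in>J. cnj (b k) * (\<Sum>j\<in>J. ft W (x k - x j) * b j))) \<le> form_const * l2_norm (l2_cut b J) * l2_on b J"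
    using cm.app_cut_bound[OF b(1) J J, of b] unfolding b(2) .
  moreover have "form_const * l2_norm (l2_cut b J) * l2_on b J \<le> form_const * l2_norm (l2_cut b J) * l2_norm b"
    using form_const_pos by (intro mult_left_mono l2_on_le_l2_norm b(1) J) auto
  moreover have "(\<Sum>k\<in>J. cnj (b k) * (\<Sum>j\<in>J. ft W (x k - x j) * b j)) = of_real ?Q"
    unfolding form_eq[OF J] energy_eq ..
  ultimately have "cmod (of_real ?Q - ?P) \<le> form_const * l2_norm (l2_cut b J) * l2_norm b"
    by (simp add: norm_minus_commute)
  then have "?Q - Re ?P \<le> form_const * l2_norm (l2_cut b J) * l2_norm b"
    using complex_Re_le_cmod[of "of_real ?Q - ?P"] by simp
  with 1 energy_lower[OF J, of b] show ?thesis by linarith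
qed

text \<open>The section exhausts the integers at a fixed \<open>l\<close>, so the large factor
  \<open>form_const\<close> multiplies a tail that vanishes and leaves no trace in the
  bound.\<close>

lemma coefficients_bound:
  assumes b: "square_summable b" "cm.app b = (\<lambda>k. ft F (x k))"
  shows "(l2_norm b)\<^sup>2 \<le> B\<^sup>2 * defect"
proof -
  let ?F = "finite_subsets_at_top (UNIV :: int set)"
  have "1 / B\<^sup>2 * (l2_norm b)\<^sup>2 \<le> defect + 2 * (form_const * 0 * l2_norm b)"
  proof (rule tendsto_le[OF finite_subsets_at_top_neq_bot])
    show "((\<lambda>J. defect + 2 * (form_const * l2_norm (l2_cut b J) * l2_norm b)) \<longlongrightarrow> defect + 2 * (form_const * 0 * l2_norm b)) ?F"
      by (intro tendsto_intros l2_cut_tendsto b)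
    have "((\<lambda>j. (cmod (b j))\<^sup>2) has_sum (l2_norm b)\<^sup>2) UNIV"
      using b(1) unfolding l2_norm_power2 square_summable_def by (rule has_sum_infsum)
    then show "((\<lambda>J. 1 / B\<^sup>2 * (l2_on b J)\<^sup>2) \<longlongrightarrow> 1 / B\<^sup>2 * (l2_norm b)\<^sup>2) ?F"
      unfolding has_sum_def l2_on_power2 by (intro tendsto_intros)
    show "\<forall>\<^sub>F J in ?F. 1 / B\<^sup>2 * (l2_on b J)\<^sup>2 \<le> defect + 2 * (form_const * l2_norm (l2_cut b J) * l2_norm b)"
      by (rule eventually_finite_subsets_at_top_weakI) (rule energy_upper[OF b])
  qed
  then show ?thesis using B by (simp add: field_simps)
qed

text \<open>On the whole line \<open>F - W * trig\<close> is orthogonal to the exponentials up to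
  truncation. Its pairing over the band alone therefore equals, up to truncation, the pairing of
  \<open>W * trig\<close> over the exterior, where \<open>vweight\<close> dominates \<open>W\<close>
  and the Bessel bound yields \<open>Om\<^sup>2\<close>. Density converts this functional bound into
  a norm bound, at the cost of a factor \<open>B\<close>.\<close>

lemma in_band_bound:
  assumes b: "square_summable b" "cm.app b = (\<lambda>k. ft F (x k))" and J: "finite J"
  shows "(\<lambda>\<xi>. F \<xi> - W \<xi> * trig x b J \<xi>) \<in> L2_space band"
    and "L2_norm band (\<lambda>\<xi>. F \<xi> - W \<xi> * trig x b J \<xi>) \<le> B * (form_const * l2_norm (l2_cut b J) + Om\<^sup>2 * l2_norm b)"
proof -
  let ?D = "\<lambda>\<xi>. F \<xi> - W \<xi> * trig x b J \<xi>"
  let ?R = "form_const * l2_norm (l2_cut b J) + Om\<^sup>2 * l2_norm b"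
  have R0: "0 \<le> ?R" using form_const_pos by simp
  show D: "?D \<in> L2_space band"
  proof (intro L2_space_diff F_band, rule L2_space_band_bounded)
    show "cmod (W \<xi> * trig x b J \<xi>) \<le> peak * (\<Sum>j\<in>J. cmod (b j))" for \<xi>
    proof -
      have "peak * vweight \<xi> \<le> peak * 1" using peak_pos by (intro mult_left_mono) simp_all
      then have "gweight l \<xi> \<le> peak" using gweight_le_peak[of \<xi>] by linarith
      then show ?thesis
        using peak_pos norm_trig_le[of x b J \<xi>] by (simp add: norm_mult mult_mono)
    qed
  qed measurable
  have test: "cmod (\<integral>\<xi>. ?D \<xi> * cnj (trig x c S \<xi>) \<partial>band) \<le> ?R * l2_on c S" if S: "finite S" for c S
  proof -
    let ?i = "\<lambda>\<xi>. indicator {-pi..pi} \<xi> :: real"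
    let ?w = "\<lambda>\<xi>. W \<xi> * trig x b J \<xi> * cnj (trig x c S \<xi>)"
    have iw: "integrable lborel (\<lambda>\<xi>. (1 - ?i \<xi>) *\<^sub>R ?w \<xi>)"
      by (rule Bochner_Integration.integrable_bound[OF form_integrable[of b J c S]])
         (auto simp: indicator_def norm_mult)
    have "(\<integral>\<xi>. ?D \<xi> * cnj (trig x c S \<xi>) \<partial>band)
        = (\<integral>\<xi>. F \<xi> * cnj (trig x c S \<xi>) - ?w \<xi> + (1 - ?i \<xi>) *\<^sub>R ?w \<xi> \<partial>lborel)"
      unfolding integral_band
    proof (intro Bochner_Integration.integral_cong refl)
      fix \<xi> :: real
      show "?i \<xi> *\<^sub>R (?D \<xi> * cnj (trig x c S \<xi>)) = F \<xi> * cnj (trig x c S \<xi>) - ?w \<xi> + (1 - ?i \<xi>) *\<^sub>R ?w \<xi>"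
        using F_supp[of \<xi>] by (cases "\<xi> \<in> {-pi..pi}") (simp_all add: left_diff_distrib)
    qed
    also have "\<dots> = (\<integral>\<xi>. F \<xi> * cnj (trig x c S \<xi>) \<partial>lborel) - (\<integral>\<xi>. ?w \<xi> \<partial>lborel) + (\<integral>\<xi>. (1 - ?i \<xi>) *\<^sub>R ?w \<xi> \<partial>lborel)"
      using iw form_integrable[of b J c S] integrable_mult_trig(2)[OF F_int, of x c S] by simp
    finally have split: "(\<integral>\<xi>. ?D \<xi> * cnj (trig x c S \<xi>) \<partial>band)
        = (\<integral>\<xi>. F \<xi> * cnj (trig x c S \<xi>) \<partial>lborel) - (\<integral>\<xi>. ?w \<xi> \<partial>lborel) + (\<integral>\<xi>. (1 - ?i \<xi>) *\<^sub>R ?w \<xi> \<partial>lborel)" .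
    have t1: "cmod ((\<integral>\<xi>. F \<xi> * cnj (trig x c S \<xi>) \<partial>lborel) - (\<integral>\<xi>. ?w \<xi> \<partial>lborel)) \<le> form_const * l2_norm (l2_cut b J) * l2_on c S"
      using cm.app_cut_bound[OF b(1) J S, of c] unfolding b(2) sum_cnj_ft[OF F_int] form_eq[OF J] .
    have "cmod (\<integral>\<xi>. (1 - ?i \<xi>) *\<^sub>R ?w \<xi> \<partial>lborel) \<le> (\<integral>\<xi>. vweight \<xi> * (cmod (trig x b J \<xi>) * cmod (trig x c S \<xi>)) \<partial>lborel)"
    proof (rule order_trans[OF integral_norm_bound], rule integral_mono)
      show "integrable lborel (\<lambda>\<xi>. norm ((1 - ?i \<xi>) *\<^sub>R ?w \<xi>))" using iw by (rule integrable_norm)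
      show "integrable lborel (\<lambda>\<xi>. vweight \<xi> * (cmod (trig x b J \<xi>) * cmod (trig x c S \<xi>)))" by (rule vtrig_prod(1)[OF J S])
      show "norm ((1 - ?i \<xi>) *\<^sub>R ?w \<xi>) \<le> vweight \<xi> * (cmod (trig x b J \<xi>) * cmod (trig x c S \<xi>))" for \<xi>
      proof (cases "\<xi> \<in> {-pi..pi}")
        case False
        then show ?thesis
          using mult_right_mono[OF gweight_out[OF l False], of "cmod (trig x b J \<xi>) * cmod (trig x c S \<xi>)"]
          by (simp add: norm_mult mult.assoc)
      qed simp
    qed
    also have "\<dots> \<le> Om\<^sup>2 * l2_on b J * l2_on c S" by (rule vtrig_prod(2)[OF J S])
    also have "\<dots> \<le> Om\<^sup>2 * l2_norm b * l2_on c S"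
      by (intro mult_right_mono mult_left_mono l2_on_le_l2_norm b(1) J) auto
    finally have t2: "cmod (\<integral>\<xi>. (1 - ?i \<xi>) *\<^sub>R ?w \<xi> \<partial>lborel) \<le> Om\<^sup>2 * l2_norm b * l2_on c S" .
    show ?thesis
      unfolding split distrib_right by (rule order_trans[OF norm_triangle_ineq add_mono[OF t1 t2]])
  qed
  \<comment> \<open>Only the finite sums approximating the error are tested; the lower Riesz
    inequality replaces their coefficient norm by their norm on the band.\<close>
  obtain a where a: "L2_tendsto band (\<lambda>S. trig x a S) ?D (finite_subsets_at_top UNIV)"
    using dense[OF D] by blast
  show "L2_norm band ?D \<le> B * ?R"
  proof (rule L2_norm_le_dense[OF D a finite_subsets_at_top_neq_bot])
    show "\<forall>\<^sub>F S in finite_subsets_at_top UNIV. cmod (\<integral>\<xi>. ?D \<xi> * cnj (trig x a S \<xi>) \<partial>band) \<le> B * ?R * L2_norm band (trig x a S)"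
    proof (rule eventually_finite_subsets_at_top_weakI)
      fix S :: "int set" assume S: "finite S"
      show "cmod (\<integral>\<xi>. ?D \<xi> * cnj (trig x a S \<xi>) \<partial>band) \<le> B * ?R * L2_norm band (trig x a S)"
        using order_trans[OF test[OF S] mult_left_mono[OF lower[OF S] R0]] by (simp add: ac_simps)
    qed
    show "0 \<le> B * ?R" using B R0 by simp
  qed
qed

end

context gaussian_approximation
begin

text \<open>One weighted norm of the spectral error controls both modes of convergence:
  Cauchy-Schwarz against \<open>sqrt vweight\<close>, whose norm is \<open>V\<close>, bounds the
  error uniformly, and \<open>sqrt vweight \<le> 1\<close> together with Plancherel's inequality
  bounds it in mean square.\<close>

lemma error_bound:
  assumes b: "square_summable b" "cm.app b = (\<lambda>k. ft F (x k))" and J: "finite J"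
  defines "e \<equiv> (B * (form_const * l2_norm (l2_cut b J) + Om\<^sup>2 * l2_norm b))\<^sup>2 + (Om * l2_norm b)\<^sup>2"
  shows "cmod (ft F t - ft (\<lambda>\<xi>. W \<xi> * trig x b J \<xi>) t) \<le> V * sqrt e"
    and "(\<integral>\<^sup>+t. ennreal ((cmod (ft F t - ft (\<lambda>\<xi>. W \<xi> * trig x b J \<xi>) t))\<^sup>2) \<partial>lborel) \<le> ennreal (2 * pi * e)"
proof -
  define H where "H \<xi> = F \<xi> - W \<xi> * trig x b J \<xi>" for \<xi>
  have Wi: "integrable lborel (\<lambda>\<xi>. W \<xi> * trig x b J \<xi>)"
    by (intro integrable_mult_trig W_integrable)
  have H_int: "integrable lborel H"
    unfolding H_def by (intro Bochner_Integration.integrable_diff F_int Wi)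
  have [measurable]: "H \<in> borel_measurable borel" using H_int by auto
  have ftH: "ft H t = ft F t - ft (\<lambda>\<xi>. W \<xi> * trig x b J \<xi>) t" for t
    unfolding ft_def H_def left_diff_distrib
    by (intro Bochner_Integration.integral_diff integrable_mult_cis F_int Wi)
  \<comment> \<open>Division by \<open>sqrt vweight\<close> changes nothing on the band. Outside,
    the numerator is at most \<open>vweight\<close> times the modulus of the exponential sum, so one
    square root survives and the Bessel bound applies.\<close>
  define h where "h \<xi> = H \<xi> / of_real (sqrt (vweight \<xi>))" for \<xi>
  have sqrt_nz: "complex_of_real (sqrt (vweight \<xi>)) \<noteq> 0" for \<xi>
    using less_imp_neq[OF vweight_pos[of \<xi>]] by simp
  have Hh: "H \<xi> = of_real (sqrt (vweight \<xi>)) * h \<xi>" for \<xi>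
    unfolding h_def by (simp only: times_divide_eq_right nonzero_mult_div_cancel_left[OF sqrt_nz])
  have [measurable]: "h \<in> borel_measurable borel" unfolding h_def[abs_def] by measurable
  let ?i = "\<lambda>\<xi>. indicator {-pi..pi} \<xi> *\<^sub>R (cmod (F \<xi> - W \<xi> * trig x b J \<xi>))\<^sup>2"
  let ?g = "\<lambda>\<xi>. of_real (sqrt (vweight \<xi>)) * trig x b J \<xi>"
  have ii: "integrable lborel ?i"
    using L2_space_integrable[OF in_band_bound(1)[OF b J]] unfolding integrable_band .
  have gi: "integrable lborel (\<lambda>\<xi>. (cmod (?g \<xi>))\<^sup>2)"
    by (intro L2_space_integrable vtrig_L2 J)
  have h_le: "(cmod (h \<xi>))\<^sup>2 \<le> ?i \<xi> + (cmod (?g \<xi>))\<^sup>2" for \<xi>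
  proof (cases "\<xi> \<in> {-pi..pi}")
    case True
    then show ?thesis by (simp add: h_def H_def vweight_in)
  next
    case False
    have "cmod (h \<xi>) = gweight l \<xi> * cmod (trig x b J \<xi>) / sqrt (vweight \<xi>)"
      using F_supp[OF False] by (simp add: h_def H_def norm_mult norm_divide)
    also have "\<dots> \<le> vweight \<xi> * cmod (trig x b J \<xi>) / sqrt (vweight \<xi>)"
      by (intro divide_right_mono mult_right_mono gweight_out[OF l False]) simp_all
    also have "\<dots> = vweight \<xi> / sqrt (vweight \<xi>) * cmod (trig x b J \<xi>)" by simp
    also have "\<dots> = sqrt (vweight \<xi>) * cmod (trig x b J \<xi>)"
      by (simp only: real_div_sqrt[OF vweight_nonneg])
    finally have "(cmod (h \<xi>))\<^sup>2 \<le> (sqrt (vweight \<xi>) * cmod (trig x b J \<xi>))\<^sup>2"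
      by (intro power_mono) simp_all
    then show ?thesis using False by (simp add: norm_mult)
  qed
  have h_int: "integrable lborel (\<lambda>\<xi>. (cmod (h \<xi>))\<^sup>2)"
  proof (rule Bochner_Integration.integrable_bound[OF Bochner_Integration.integrable_add[OF ii gi]])
    have "norm ((cmod (h \<xi>))\<^sup>2) \<le> norm (?i \<xi> + (cmod (?g \<xi>))\<^sup>2)" for \<xi>
      unfolding real_norm_def abs_power2 by (rule order_trans[OF h_le abs_ge_self])
    then show "AE \<xi> in lborel. norm ((cmod (h \<xi>))\<^sup>2) \<le> norm (?i \<xi> + (cmod (?g \<xi>))\<^sup>2)"
      by (rule AE_I2)
  qed measurable
  have h_L2: "h \<in> L2_space lborel" by (rule L2_spaceI[OF _ h_int]) simp
  have "(L2_norm lborel h)\<^sup>2 \<le> (\<integral>\<xi>. ?i \<xi> + (cmod (?g \<xi>))\<^sup>2 \<partial>lborel)"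
    unfolding L2_norm_power2
    by (intro integral_mono h_le h_int Bochner_Integration.integrable_add ii gi)
  also have "\<dots> = (\<integral>\<xi>. ?i \<xi> \<partial>lborel) + (\<integral>\<xi>. (cmod (?g \<xi>))\<^sup>2 \<partial>lborel)"
    by (rule Bochner_Integration.integral_add[OF ii gi])
  also have "\<dots> = (L2_norm band (\<lambda>\<xi>. F \<xi> - W \<xi> * trig x b J \<xi>))\<^sup>2 + (L2_norm lborel ?g)\<^sup>2"
    unfolding L2_norm_power2 integral_band ..
  also have "\<dots> \<le> e"
    unfolding e_def
  proof (intro add_mono power_mono)
    show "L2_norm band (\<lambda>\<xi>. F \<xi> - W \<xi> * trig x b J \<xi>) \<le> B * (form_const * l2_norm (l2_cut b J) + Om\<^sup>2 * l2_norm b)"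
      by (rule in_band_bound(2)[OF b J])
    show "L2_norm lborel ?g \<le> Om * l2_norm b"
      by (rule order_trans[OF vtrig_norm[OF J] mult_left_mono[OF l2_on_le_l2_norm[OF b(1) J]]]) (use Om in simp)
  qed simp_all
  finally have h_norm: "(L2_norm lborel h)\<^sup>2 \<le> e" .
  have "cmod (ft H t) \<le> (\<integral>\<xi>. cmod (of_real (sqrt (vweight \<xi>)) * h \<xi>) \<partial>lborel)"
    using norm_ft_le[of H t] unfolding Hh .
  also have "\<dots> \<le> V * L2_norm lborel h"
    unfolding V_def by (rule L2_cauchy_schwarz_norm[OF sqrt_vweight_L2 h_L2])
  also have "\<dots> \<le> V * sqrt e"
    using h_norm by (intro mult_left_mono V_nonneg real_le_rsqrt)
  finally show "cmod (ft F t - ft (\<lambda>\<xi>. W \<xi> * trig x b J \<xi>) t) \<le> V * sqrt e"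
    unfolding ftH .
  have H_le: "cmod (H \<xi>) \<le> 1 * cmod (h \<xi>)" for \<xi>
  proof -
    have "sqrt (vweight \<xi>) \<le> 1" by simp
    then have "sqrt (vweight \<xi>) * cmod (h \<xi>) \<le> 1 * cmod (h \<xi>)" by (intro mult_right_mono) simp_all
    then show ?thesis unfolding Hh by (simp add: norm_mult)
  qed
  have H_L2: "H \<in> L2_space lborel"
    by (rule L2_space_mono[OF h_L2 _ H_le]) simp
  have "(\<integral>\<xi>. (cmod (H \<xi>))\<^sup>2 \<partial>lborel) \<le> (L2_norm lborel h)\<^sup>2"
    unfolding L2_norm_power2
    by (intro integral_mono power_mono L2_space_integrable H_L2 h_L2) (use H_le in simp_all)
  also note h_norm
  finally have "2 * pi * (\<integral>\<xi>. (cmod (H \<xi>))\<^sup>2 \<partial>lborel) \<le> 2 * pi * e" by simp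
  then show "(\<integral>\<^sup>+t. ennreal ((cmod (ft F t - ft (\<lambda>\<xi>. W \<xi> * trig x b J \<xi>) t))\<^sup>2) \<partial>lborel) \<le> ennreal (2 * pi * e)"
    unfolding ftH[symmetric] by (rule order_trans[OF plancherel_le[OF H_int H_L2] ennreal_leI])
qed

text \<open>Without the tail, the two squares in \<open>error_bound\<close> contribute
  \<open>(B * Om\<^sup>2)\<^sup>2\<close> and \<open>Om\<^sup>2\<close> times the squared norm of
  \<open>b\<close>; the last factor comes from \<open>coefficients_bound\<close>.\<close>

definition err_const :: real where
  "err_const = ((B * Om\<^sup>2)\<^sup>2 + Om\<^sup>2) * B\<^sup>2"

lemma series_error:
  assumes b: "square_summable b" "cm.app b = (\<lambda>k. ft F (x k))"
  shows "cmod (ft F t - series b t) \<le> V * sqrt (err_const * defect)"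
    and "L2_norm lborel (\<lambda>t. series b t - ft F t) \<le> sqrt (2 * pi * (err_const * defect))"
proof -
  let ?J = "\<lambda>n. {- int n..int n}"
  define e where "e n = (B * (form_const * l2_norm (l2_cut b (?J n)) + Om\<^sup>2 * l2_norm b))\<^sup>2 + (Om * l2_norm b)\<^sup>2" for n
  define e' where "e' = (B * (form_const * 0 + Om\<^sup>2 * l2_norm b))\<^sup>2 + (Om * l2_norm b)\<^sup>2"
  have lim: "e \<longlonglongrightarrow> e'"
    unfolding e_def[abs_def] e'_def
    by (intro tendsto_intros filterlim_compose[OF l2_cut_tendsto[OF b(1)] symmetric_intervals_at_top])
  have "e' = ((B * Om\<^sup>2)\<^sup>2 + Om\<^sup>2) * (l2_norm b)\<^sup>2"
    by (simp add: e'_def power_mult_distrib algebra_simps)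
  also have "\<dots> \<le> ((B * Om\<^sup>2)\<^sup>2 + Om\<^sup>2) * (B\<^sup>2 * defect)"
    by (intro mult_left_mono coefficients_bound b) simp
  finally have e'_le: "e' \<le> err_const * defect" by (simp add: err_const_def mult.assoc)
  have part: "(\<lambda>n. cmod (ft F t - ft (\<lambda>\<xi>. W \<xi> * trig x b (?J n) \<xi>) t)) \<longlonglongrightarrow> cmod (ft F t - series b t)" for t
    by (intro tendsto_intros series_limit b)
  have "cmod (ft F t - series b t) \<le> V * sqrt e'"
  proof (rule LIMSEQ_le[OF part])
    show "(\<lambda>n. V * sqrt (e n)) \<longlonglongrightarrow> V * sqrt e'" by (intro tendsto_intros lim)
    show "\<exists>N. \<forall>n\<ge>N. cmod (ft F t - ft (\<lambda>\<xi>. W \<xi> * trig x b (?J n) \<xi>) t) \<le> V * sqrt (e n)"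
      unfolding e_def using error_bound(1)[OF b] by simp
  qed
  also have "\<dots> \<le> V * sqrt (err_const * defect)"
    by (intro mult_left_mono real_sqrt_le_mono e'_le V_nonneg)
  finally show "cmod (ft F t - series b t) \<le> V * sqrt (err_const * defect)" .
  have [measurable]: "ft F \<in> borel_measurable borel" by (rule ft_measurable[OF F_int])
  have [measurable]: "series b \<in> borel_measurable borel" by (rule series_measurable[OF b(1)])
  have "(\<integral>\<^sup>+t. ennreal ((cmod (ft F t - series b t))\<^sup>2) \<partial>lborel) \<le> ennreal (2 * pi * e')"
  proof (rule nn_integral_le_limit)
    show "(\<lambda>t. ennreal ((cmod (ft F t - ft (\<lambda>\<xi>. W \<xi> * trig x b (?J n) \<xi>) t))\<^sup>2)) \<in> borel_measurable lborel" for n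
    proof -
      have [measurable]: "ft (\<lambda>\<xi>. W \<xi> * trig x b (?J n) \<xi>) \<in> borel_measurable borel"
        by (intro ft_measurable integrable_mult_trig W_integrable)
      show ?thesis by measurable
    qed
    show "(\<lambda>n. ennreal ((cmod (ft F t - ft (\<lambda>\<xi>. W \<xi> * trig x b (?J n) \<xi>) t))\<^sup>2)) \<longlonglongrightarrow> ennreal ((cmod (ft F t - series b t))\<^sup>2)" for t
      by (intro tendsto_ennrealI tendsto_power part)
    show "(\<lambda>n. ennreal (2 * pi * e n)) \<longlonglongrightarrow> ennreal (2 * pi * e')"
      by (intro tendsto_ennrealI tendsto_intros lim)
    show "(\<integral>\<^sup>+t. ennreal ((cmod (ft F t - ft (\<lambda>\<xi>. W \<xi> * trig x b (?J n) \<xi>) t))\<^sup>2) \<partial>lborel) \<le> ennreal (2 * pi * e n)" for n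
      unfolding e_def by (rule error_bound(2)[OF b]) simp
  qed
  also have "\<dots> \<le> ennreal (2 * pi * (err_const * defect))"
    by (intro ennreal_leI mult_left_mono e'_le) simp
  finally have nn: "(\<integral>\<^sup>+t. ennreal ((cmod (ft F t - series b t))\<^sup>2) \<partial>lborel) \<le> ennreal (2 * pi * (err_const * defect))" .
  have "0 \<le> e'" by (simp add: e'_def)
  then have nonneg: "0 \<le> 2 * pi * (err_const * defect)" using e'_le by simp
  have "(\<integral>t. (cmod (ft F t - series b t))\<^sup>2 \<partial>lborel) \<le> 2 * pi * (err_const * defect)"
    using nn nonneg by (intro integral_real_bounded) simp_all
  then have "L2_norm lborel (\<lambda>t. ft F t - series b t) \<le> sqrt (2 * pi * (err_const * defect))"
    unfolding L2_norm_def by (rule real_sqrt_le_mono)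
  then show "L2_norm lborel (\<lambda>t. series b t - ft F t) \<le> sqrt (2 * pi * (err_const * defect))"
    by (simp only: L2_norm_minus_commute)
qed

end

section \<open>Vanishing of the defect and conclusion\<close>

text \<open>Dominated convergence with majorant the squared modulus of \<open>F\<close>, since the
  weight is at least \<open>1\<close> on the band. The substitution \<open>l = inverse s\<close>
  turns the limit at \<open>0\<close> from the right into one at infinity.\<close>

lemma weighted_energy_tendsto:
  assumes F: "F \<in> L2_space lborel" and supp: "\<And>\<xi>. \<xi> \<notin> {-pi..pi} \<Longrightarrow> F \<xi> = 0"
  shows "((\<lambda>l. \<integral>\<xi>. (cmod (F \<xi>))\<^sup>2 / gweight l \<xi> \<partial>lborel) \<longlongrightarrow> 0) (at_right 0)"
proof -
  have [measurable]: "F \<in> borel_measurable borel" using L2_space_measurable[OF F] by simp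
  have "((\<lambda>s. \<integral>\<xi>. (cmod (F \<xi>))\<^sup>2 / gweight (inverse s) \<xi> \<partial>lborel) \<longlongrightarrow> (\<integral>\<xi>. 0 \<partial>(lborel :: real measure))) at_top"
  proof (rule integral_dominated_convergence_at_top)
    show "integrable lborel (\<lambda>\<xi>. (cmod (F \<xi>))\<^sup>2)" using F by simp
    show "\<forall>\<^sub>F s in at_top. AE \<xi> in lborel. norm ((cmod (F \<xi>))\<^sup>2 / gweight (inverse s) \<xi>) \<le> (cmod (F \<xi>))\<^sup>2"
      using eventually_gt_at_top[of 0]
    proof eventually_elim
      case (elim s)
      have "(cmod (F \<xi>))\<^sup>2 / gweight (inverse s) \<xi> \<le> (cmod (F \<xi>))\<^sup>2" for \<xi>
      proof (cases "\<xi> \<in> {-pi..pi}")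
        case True
        have "1 \<le> gweight (inverse s) \<xi>" by (rule gweight_in[OF _ True]) (use elim in simp)
        then show ?thesis
          using mult_left_mono[of 1 "gweight (inverse s) \<xi>" "(cmod (F \<xi>))\<^sup>2"] by (simp add: divide_le_eq)
      qed (simp add: supp)
      then show ?case by simp
    qed
    show "AE \<xi> in lborel. ((\<lambda>s. (cmod (F \<xi>))\<^sup>2 / gweight (inverse s) \<xi>) \<longlongrightarrow> 0) at_top"
    proof -
      \<comment> \<open>At the band edges the weight is \<open>1\<close> for every \<open>l\<close>,
        so the integrand need not decay there; the two points form a null set.\<close>
      have "AE \<xi> in lborel. \<xi> \<noteq> pi \<and> \<xi> \<noteq> - pi"
        by (intro AE_conjI AE_lborel_singleton)
      then show ?thesis
      proof eventually_elim
        case (elim \<xi>)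
        show ?case
        proof (cases "\<xi> \<in> {-pi..pi}")
          case True
          then have "\<bar>\<xi>\<bar> < pi" using elim by (simp add: abs_less_iff)
          then have "\<bar>\<xi>\<bar>\<^sup>2 < pi\<^sup>2" by (rule power_strict_mono) simp_all
          then have c: "0 < (pi\<^sup>2 - \<xi>\<^sup>2) / 4" by simp
          have at_top: "filterlim (\<lambda>s. ((pi\<^sup>2 - \<xi>\<^sup>2) / 4) * s) at_top at_top"
            by (rule filterlim_tendsto_pos_mult_at_top[OF tendsto_const c filterlim_ident])
          have at_bot: "filterlim (\<lambda>s. - (((pi\<^sup>2 - \<xi>\<^sup>2) / 4) * s)) at_bot at_top"
            using at_top unfolding filterlim_uminus_at_bot by simp
          have "((\<lambda>s. (cmod (F \<xi>))\<^sup>2 * exp (- (((pi\<^sup>2 - \<xi>\<^sup>2) / 4) * s))) \<longlongrightarrow> (cmod (F \<xi>))\<^sup>2 * 0) at_top"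
            by (intro tendsto_mult_left filterlim_compose[OF exp_at_bot at_bot])
          moreover have "(cmod (F \<xi>))\<^sup>2 / gweight (inverse s) \<xi> = (cmod (F \<xi>))\<^sup>2 * exp (- (((pi\<^sup>2 - \<xi>\<^sup>2) / 4) * s))" for s
          proof -
            have "(pi\<^sup>2 - \<xi>\<^sup>2) / (4 * inverse s) = ((pi\<^sup>2 - \<xi>\<^sup>2) / 4) * s"
              by (simp only: divide_inverse inverse_mult_distrib inverse_inverse_eq mult.assoc)
            then show ?thesis unfolding gweight_def exp_minus by (simp only: divide_inverse)
          qed
          ultimately show ?thesis by simp
        next
          case False
          then show ?thesis by (simp add: supp)
        qed
      qed
    qed
  qed simp_all
  then have "((\<lambda>s. \<integral>\<xi>. (cmod (F \<xi>))\<^sup>2 / gweight (inverse s) \<xi> \<partial>lborel) \<longlongrightarrow> 0) at_top" by simp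
  from filterlim_compose[OF this filterlim_inverse_at_top_right] show ?thesis by simp
qed

theorem theorem1p1:
  fixes x :: "int \<Rightarrow> real" and f :: "real \<Rightarrow> complex"
  assumes "riesz_basis_sequence x"
    and "f \<in> PW_pi"
  shows "L2_tendsto lborel (\<lambda>l. gaussian_interpolant x l f) f (at_right 0)
       \<and> uniform_limit UNIV (\<lambda>l. gaussian_interpolant x l f) f (at_right 0)"
proof -
  obtain B where "riesz_exponentials x B" by (rule riesz_basis_sequence_exponentials[OF assms(1)])
  then interpret riesz_exponentials x B .
  obtain Om where Om: "0 < Om"
    "\<And>J a. finite J \<Longrightarrow> (\<lambda>\<xi>. of_real (sqrt (vweight \<xi>)) * trig x a J \<xi>) \<in> L2_space lborel"
    "\<And>J a. finite J \<Longrightarrow> L2_norm lborel (\<lambda>\<xi>. of_real (sqrt (vweight \<xi>)) * trig x a J \<xi>) \<le> Om * l2_on a J"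
    by (rule vweight_bessel) (rule that, simp_all)
  obtain F where F: "F \<in> L2_space lborel" "integrable lborel F" "\<And>\<xi>. \<xi> \<notin> {-pi..pi} \<Longrightarrow> F \<xi> = 0"
    and fF: "\<And>t. f t = ft F t"
    by (rule PW_pi_inversion[OF assms(2)]) (rule that, simp_all)
  have f_eq: "f = ft F" by (rule ext) (rule fF)
  have f_L2: "f \<in> L2_space lborel" using assms(2) by (simp add: PW_pi_def)
  define \<delta> where "\<delta> l = (\<integral>\<xi>. (cmod (F \<xi>))\<^sup>2 / gweight l \<xi> \<partial>lborel)" for l
  have \<delta>: "(\<delta> \<longlongrightarrow> 0) (at_right 0)"
    unfolding \<delta>_def[abs_def] by (rule weighted_energy_tendsto[OF F(1,3)])
  \<comment> \<open>\<open>C\<close> and \<open>v\<close> are the values of \<open>err_const\<close>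
    and \<open>V\<close>, written out before \<open>l\<close> is introduced so that they are visibly
    independent of it.\<close>
  define C where "C = ((B * Om\<^sup>2)\<^sup>2 + Om\<^sup>2) * B\<^sup>2"
  define v where "v = L2_norm lborel (\<lambda>\<xi>. complex_of_real (sqrt (vweight \<xi>)))"
  have main: "gaussian_interpolant x l f \<in> L2_space lborel \<and>
      L2_norm lborel (\<lambda>t. gaussian_interpolant x l f t - f t) \<le> sqrt (2 * pi * (C * \<delta> l)) \<and>
      (\<forall>t. dist (gaussian_interpolant x l f t) (f t) \<le> v * sqrt (C * \<delta> l))"
    if l: "0 < l" "l \<le> 1" for l
  proof -
    interpret gaussian_approximation x B Om l F
      by unfold_locales (fact Om l F)+
    obtain b where b: "square_summable b" "cm.app b = (\<lambda>k. ft F (x k))"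
      by (rule cm.app_surj[OF samples_square_summable])
    have gi: "gaussian_interpolant x l f = series b"
      by (rule gaussian_interpolant_eq_series[OF b(1)]) (simp add: b(2) f_eq)
    show ?thesis
      unfolding gi C_def v_def \<delta>_def err_const_def[symmetric] defect_def[symmetric] V_def[symmetric]
      using series_L2[OF b(1)] series_error[OF b] by (simp add: f_eq dist_norm norm_minus_commute)
  qed
  have ev: "\<forall>\<^sub>F l in at_right 0. 0 < l \<and> l \<le> (1 :: real)"
    unfolding eventually_at_right_field by (intro exI[of _ 1]) auto
  have "((\<lambda>l. sqrt (2 * pi * (C * \<delta> l))) \<longlongrightarrow> sqrt (2 * pi * (C * 0))) (at_right 0)"
    by (intro tendsto_intros \<delta>)
  then have lim2: "((\<lambda>l. sqrt (2 * pi * (C * \<delta> l))) \<longlongrightarrow> 0) (at_right 0)" by simp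
  have "((\<lambda>l. v * sqrt (C * \<delta> l)) \<longlongrightarrow> v * sqrt (C * 0)) (at_right 0)"
    by (intro tendsto_intros \<delta>)
  then have limu: "((\<lambda>l. v * sqrt (C * \<delta> l)) \<longlongrightarrow> 0) (at_right 0)" by simp
  show ?thesis
  proof
    show "L2_tendsto lborel (\<lambda>l. gaussian_interpolant x l f) f (at_right 0)"
      unfolding L2_tendsto_def
    proof (intro conjI f_L2)
      show "\<forall>\<^sub>F l in at_right 0. gaussian_interpolant x l f \<in> L2_space lborel"
        using ev by eventually_elim (use main in simp)
      show "((\<lambda>l. L2_norm lborel (\<lambda>t. gaussian_interpolant x l f t - f t)) \<longlongrightarrow> 0) (at_right 0)"
      proof (rule Lim_null_comparison[OF _ lim2])
        show "\<forall>\<^sub>F l in at_right 0. norm (L2_norm lborel (\<lambda>t. gaussian_interpolant x l f t - f t)) \<le> sqrt (2 * pi * (C * \<delta> l))"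
          using ev by eventually_elim (use main in simp)
      qed
    qed
    show "uniform_limit UNIV (\<lambda>l. gaussian_interpolant x l f) f (at_right 0)"
      unfolding uniform_limit_iff
    proof (intro allI impI)
      fix e :: real assume "e > 0"
      with limu have "\<forall>\<^sub>F l in at_right 0. v * sqrt (C * \<delta> l) < e"
        by (simp add: order_tendsto_iff)
      then show "\<forall>\<^sub>F l in at_right 0. \<forall>t\<in>UNIV. dist (gaussian_interpolant x l f t) (f t) < e"
        using ev
      proof eventually_elim
        case (elim l)
        then have "\<forall>t. dist (gaussian_interpolant x l f t) (f t) \<le> v * sqrt (C * \<delta> l)"
          using main[of l] by simp
        with elim(1) show ?case by (auto intro: le_less_trans)
      qed
    qed
  qed
qed

end
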